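(* Let $n\ge 2$ and $2\le p\le n$, and let $\mathbb{G}\subset G(p,\mathbb{R}^n)$ be a closed subset invariant under a subgroup $K\subset\mathrm{O}(n)$ acting transitively on $S^{n-1}$. Assume $\mathbb{G}$ has the transitivity property. Then strong uniqueness of tangents holds for all $\mathbb{G}$-plurisubharmonic functions: for every $\mathbb{G}$-plurisubharmonic function $u\not\equiv-\infty$ defined on a neighborhood of $0$, there is exactly one tangent to $u$ at $0$, and it equals $\Theta(u,0)K_p(|x|)$.
   Context: $G(p,\mathbb{R}^n)$ is the Grassmannian of unoriented $p$-dimensional linear subspaces of $\mathbb{R}^n$. $\mathbb{G}$ has the transitivity property if for any two vectors $x,y\in\mathbb{R}^n$ there exist $W_1,\dots,W_k\in\mathbb{G}$ with $x\in W_1$, $y\in W_k$ and $\dim(W_i\cap W_{i+1})>0$ for $i=1,\dots,k-1$. Set $F(\mathbb{G})=\{A\in\mathrm{Sym}^2(\mathbb{R}^n):\mathrm{tr}(A|_W)\ge0\ \forall W\in\mathbb{G}\}$. An upper semicontinuous $u:\Omega\to[-\infty,\infty)$ is $\mathbb{G}$-plurisubharmonic if for every $x\in\Omega$ and every $C^2$ function $\varphi$ near $x$ with $u\le\varphi$ near $x$ and $u(x)=\varphi(x)$, $D^2\varphi(x)\in F(\mathbb{G})$. Riesz kernel: $K_p(t)=\log t$ if $p=2$, $K_p(t)=-t^{2-p}$ if $p>2$. With $M(u,r)=\sup_{|x|\le r}u$, the flow is $u_r(x)=r^{p-2}u(rx)$ if $p\neq 2$, $u_r(x)=u(rx)-M(u,r)$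 if $p=2$; a tangent to $u$ at $0$ is any $L^1_{loc}(\mathbb{R}^n)$-limit of $u_{r_j}$ with $r_j\to0$ (identified with its upper semicontinuous representative). The density is $\Theta(u,0)=\lim_{r<s\downarrow0}\frac{M(u,r)-M(u,s)}{K_p(r)-K_p(s)}$. *)

theory Defs
  imports "HOL-Analysis.Analysis" "HOL-Probability.Probability"
begin

definition grassmannian :: "nat \<Rightarrow> ('a::euclidean_space) set set" where
  "grassmannian p = {W. subspace W \<and> dim W = p}"

text \<open>Orthogonal projection onto a subspace W, and its matrix; the topology of the
  Grassmannian is the one induced by W \<mapsto> projection matrix.\<close>
definition oproj :: "(real^'n) set \<Rightarrow> real^'n \<Rightarrow> real^'n" where
  "oproj W x = (SOME y. y \<in> W \<and> (\<forall>w\<in>W. (x - y) \<bullet> w = 0))"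

definition proj_matrix :: "(real^'n) set \<Rightarrow> real^'n^'n" where
  "proj_matrix W = matrix (oproj W)"

definition closed_in_grassmannian :: "nat \<Rightarrow> (real^'n) set set \<Rightarrow> bool" where
  "closed_in_grassmannian p GG \<longleftrightarrow> GG \<subseteq> grassmannian p \<and> closed (proj_matrix ` GG)"

definition trace_on :: "real^'n^'n \<Rightarrow> (real^'n) set \<Rightarrow> real" where
  "trace_on A W = (let B = (SOME B. B \<subseteq> W \<and> pairwise orthogonal B \<and> (\<forall>b\<in>B. norm b = 1) \<and> span B = W)
                   in \<Sum>b\<in>B. b \<bullet> (A *v b))"

definition symmetric_matrix :: "real^'n^'n \<Rightarrow> bool" where
  "symmetric_matrix A \<longleftrightarrow> transpose A = A"

definition Fcone :: "(real^'n) set set \<Rightarrow> (real^'n^'n) set" where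
  "Fcone GG = {A. symmetric_matrix A \<and> (\<forall>W\<in>GG. trace_on A W \<ge> 0)}"

definition transitivity_property :: "(real^'n) set set \<Rightarrow> bool" where
  "transitivity_property GG \<longleftrightarrow>
     (\<forall>x y. \<exists>Ws. Ws \<noteq> [] \<and> set Ws \<subseteq> GG \<and> x \<in> hd Ws \<and> y \<in> last Ws \<and>
        (\<forall>i. Suc i < length Ws \<longrightarrow> dim (Ws ! i \<inter> Ws ! Suc i) > 0))"

definition orth_subgroup :: "(real^'n \<Rightarrow> real^'n) set \<Rightarrow> bool" where
  "orth_subgroup K \<longleftrightarrow> (\<forall>k\<in>K. orthogonal_transformation k) \<and> id \<in> K \<and>
     (\<forall>k\<in>K. \<forall>l\<in>K. k \<circ> l \<in> K) \<and> (\<forall>k\<in>K. inv k \<in> K)"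

definition transitive_on_sphere :: "(real^'n \<Rightarrow> real^'n) set \<Rightarrow> bool" where
  "transitive_on_sphere K \<longleftrightarrow> (\<forall>x y. norm x = 1 \<longrightarrow> norm y = 1 \<longrightarrow> (\<exists>k\<in>K. k x = y))"

definition invariant_under :: "(real^'n \<Rightarrow> real^'n) set \<Rightarrow> (real^'n) set set \<Rightarrow> bool" where
  "invariant_under K GG \<longleftrightarrow> (\<forall>k\<in>K. \<forall>W\<in>GG. k ` W \<in> GG)"

definition usc_on :: "'a::topological_space set \<Rightarrow> ('a \<Rightarrow> ereal) \<Rightarrow> bool" where
  "usc_on \<Omega> u \<longleftrightarrow> (\<forall>x\<in>\<Omega>. \<forall>c. u x < c \<longrightarrow> eventually (\<lambda>y. u y < c) (at x within \<Omega>))"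

definition C2_with_hessian :: "(real^'n \<Rightarrow> real) \<Rightarrow> real^'n \<Rightarrow> real^'n^'n \<Rightarrow> bool" where
  "C2_with_hessian \<phi> x H \<longleftrightarrow> (\<exists>r>0. \<exists>g Hf.
     (\<forall>y\<in>ball x r. (\<phi> has_derivative (\<lambda>h. g y \<bullet> h)) (at y) \<and>
                    (g has_derivative (\<lambda>h. Hf y *v h)) (at y)) \<and>
     continuous_on (ball x r) Hf \<and> H = Hf x)"

definition G_psh :: "(real^'n) set set \<Rightarrow> (real^'n) set \<Rightarrow> (real^'n \<Rightarrow> ereal) \<Rightarrow> bool" where
  "G_psh GG \<Omega> u \<longleftrightarrow> usc_on \<Omega> u \<and> (\<forall>x\<in>\<Omega>. u x \<noteq> \<infinity>) \<and>
     (\<forall>x\<in>\<Omega>. \<forall>\<phi> H. C2_with_hessian \<phi> x H \<and> eventually (\<lambda>y. u y \<le> ereal (\<phi> y)) (nhds x)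
        \<and> u x = ereal (\<phi> x) \<longrightarrow> H \<in> Fcone GG)"

definition Kp :: "nat \<Rightarrow> real \<Rightarrow> real" where
  "Kp p t = (if p = 2 then ln t else - (t powr (2 - real p)))"

definition Mmax :: "(real^'n \<Rightarrow> ereal) \<Rightarrow> real \<Rightarrow> ereal" where
  "Mmax u r = (SUP x\<in>cball 0 r. u x)"

definition flow :: "nat \<Rightarrow> (real^'n \<Rightarrow> ereal) \<Rightarrow> real \<Rightarrow> real^'n \<Rightarrow> ereal" where
  "flow p u r x = (if p \<noteq> 2 then ereal (r powr (real p - 2)) * u (r *\<^sub>R x)
                   else u (r *\<^sub>R x) - Mmax u r)"

definition L1loc_tendsto :: "(nat \<Rightarrow> real^'n \<Rightarrow> ereal) \<Rightarrow> (real^'n \<Rightarrow> ereal) \<Rightarrow> bool" where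
  "L1loc_tendsto f v \<longleftrightarrow> v \<in> borel_measurable lborel \<and>
     (\<forall>R>0. (AE x in lborel. x \<in> cball 0 R \<longrightarrow> \<bar>v x\<bar> \<noteq> \<infinity>) \<and>
        (\<integral>\<^sup>+x\<in>cball 0 R. ennreal \<bar>real_of_ereal (v x)\<bar> \<partial>lborel) < \<infinity> \<and>
        eventually (\<lambda>j. (\<lambda>x. f j x * ereal (indicator (cball 0 R) x)) \<in> borel_measurable lborel \<and>
                        (AE x in lborel. x \<in> cball 0 R \<longrightarrow> \<bar>f j x\<bar> \<noteq> \<infinity>)) sequentially \<and>
        ((\<lambda>j. \<integral>\<^sup>+x\<in>cball 0 R. ennreal \<bar>real_of_ereal (f j x) - real_of_ereal (v x)\<bar> \<partial>lborel)
            \<longlonglongrightarrow> 0))"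

definition is_tangent :: "nat \<Rightarrow> (real^'n \<Rightarrow> ereal) \<Rightarrow> (real^'n \<Rightarrow> ereal) \<Rightarrow> bool" where
  "is_tangent p u v \<longleftrightarrow> (\<exists>r::nat \<Rightarrow> real. (\<forall>j. r j > 0) \<and> r \<longlonglongrightarrow> 0 \<and>
      L1loc_tendsto (\<lambda>j. flow p u (r j)) v)"

definition has_density :: "nat \<Rightarrow> (real^'n \<Rightarrow> ereal) \<Rightarrow> real \<Rightarrow> bool" where
  "has_density p u \<Theta> \<longleftrightarrow> (\<forall>\<epsilon>>0. \<exists>\<delta>>0. \<forall>r s. 0 < r \<and> r < s \<and> s < \<delta> \<longrightarrow>
      \<bar>(Mmax u r - Mmax u s) / ereal (Kp p r - Kp p s) - ereal \<Theta>\<bar> < ereal \<epsilon>)"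

end

theory Submission
  imports Defs
begin

text \<open>Let \<open>V(x) = \<Theta> K\<^sub>p(|x|)\<close>. Comparison on annuli, where \<open>K\<^sub>p(|x|)\<close> is harmonic along the planes through
  \<open>x\<close>, makes \<open>M(u,r)\<close> a convex function of \<open>K\<^sub>p(r)\<close>; hence the density exists and the flow
  \<open>u\<^sub>r\<close> is asymptotically bounded above by \<open>V\<close>, with near equality somewhere on the unit sphere.
  Along any sequence \<open>r\<^sub>j \<rightarrow> 0\<close> the upper relaxed limit of \<open>u\<^sub>r\<close> is thus at most \<open>V\<close> and touches it;
  the strong maximum principle spreads the contact over each plane of \<open>GG\<close> that contains a contact
  point, and the transitivity property then over the whole space. Since \<open>GG\<close>-plurisubharmonic
  functions are subharmonic, a weak Harnack inequality, proved by comparison with caloric functions,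
  turns contact at nearby points into convergence \<open>u\<^sub>r \<rightarrow> V\<close> in the mean, for the whole flow. No
  compactness theorem for subharmonic functions is needed.\<close>

section \<open>Traces over orthonormal bases\<close>

text \<open>Membership in \<open>G_psh\<close> speaks only about test functions, so every estimate
  is a comparison with an explicit function whose Hessian has positive trace over one plane of
  \<open>GG\<close>, or over the whole space. The group serves to pass from the former to the
  latter: symmetrising a Hessian shows that nonnegative traces over the planes force a nonnegative
  Laplacian, and only this yields integral estimates. Two obstacles shape the argument. Contact with
  V is asymptotic: it is seen at nearby points and for infinitely many indices. Applying the whole
  propagation argument to a subsequence along which contact fails turns this into contact for all
  large indices, uniformly on annuli. The other obstacle is the origin, where V is singular if
  \<Theta> > 0: one Harnack ball of radius \<rho> reaching over the origin costs \<rho>^n times a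
  difference of values of K_p, and this is of order \<rho>^2 because p <= n.\<close>

definition orthonormal :: "'a::euclidean_space set \<Rightarrow> bool" where
  "orthonormal B \<longleftrightarrow> pairwise orthogonal B \<and> (\<forall>b\<in>B. norm b = 1)"

lemma orthonormal_inner:
  "orthonormal B \<Longrightarrow> b \<in> B \<Longrightarrow> c \<in> B \<Longrightarrow> b \<bullet> c = (if b = c then 1 else 0)"
  by (auto simp: orthonormal_def pairwise_def orthogonal_def dot_square_norm)

lemma orthonormal_independent: "orthonormal B \<Longrightarrow> independent B"
  by (rule pairwise_orthogonal_independent) (auto simp: orthonormal_def)

lemma orthonormal_finite: "orthonormal B \<Longrightarrow> finite B"
  by (blast dest: orthonormal_independent independent_imp_finite)

lemma orthonormal_expand:
  assumes "orthonormal B" "x \<in> span B"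
  shows "(\<Sum>b\<in>B. (x \<bullet> b) *\<^sub>R b) = x"
  using assms orthonormal_finite[OF assms(1)] by (intro orthonormal_basis_expand) (auto simp: orthonormal_def)

lemma orthonormal_card: "orthonormal B \<Longrightarrow> card B = dim (span B)"
  by (simp add: orthonormal_independent dim_eq_card_independent)

lemma orthonormal_basis_exists:
  assumes "subspace W"
  obtains B where "orthonormal B" "span B = W" "B \<subseteq> W"
  using orthonormal_basis_subspace[OF assms] unfolding orthonormal_def by metis

text \<open>Expand one factor b in the basis C, swap the sums, and recollect the vectors of B around
  each c. This makes the choice of a basis in \<open>trace_on\<close> harmless.\<close>

lemma orthonormal_trace_unique:
  fixes A :: "real^'n^'n"
  assumes B: "orthonormal B" and C: "orthonormal C" and eq: "span B = span C"
  shows "(\<Sum>b\<in>B. b \<bullet> (A *v b)) = (\<Sum>c\<in>C. c \<bullet> (A *v c))"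
proof -
  have "(\<Sum>b\<in>B. b \<bullet> (A *v b)) = (\<Sum>b\<in>B. \<Sum>c\<in>C. (b \<bullet> c) * (b \<bullet> (A *v c)))"
  proof (rule sum.cong[OF refl])
    fix b assume "b \<in> B"
    then have "b = (\<Sum>c\<in>C. (b \<bullet> c) *\<^sub>R c)"
      using orthonormal_expand[OF C, of b] eq by (metis span_base)
    then have "b \<bullet> (A *v b) = b \<bullet> (A *v (\<Sum>c\<in>C. (b \<bullet> c) *\<^sub>R c))" by simp
    also have "\<dots> = (\<Sum>c\<in>C. (b \<bullet> c) * (b \<bullet> (A *v c)))"
      by (simp add: linear_sum[OF matrix_vector_mul_linear] matrix_vector_mult_scaleR inner_sum_right)
    finally show "b \<bullet> (A *v b) = (\<Sum>c\<in>C. (b \<bullet> c) * (b \<bullet> (A *v c)))" .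
  qed
  also have "\<dots> = (\<Sum>c\<in>C. \<Sum>b\<in>B. (b \<bullet> c) * (b \<bullet> (A *v c)))"
    by (rule sum.swap)
  also have "\<dots> = (\<Sum>c\<in>C. (\<Sum>b\<in>B. (b \<bullet> c) *\<^sub>R b) \<bullet> (A *v c))"
    by (simp add: inner_sum_left)
  also have "\<dots> = (\<Sum>c\<in>C. c \<bullet> (A *v c))"
  proof (rule sum.cong[OF refl])
    fix c assume "c \<in> C"
    then have "(\<Sum>b\<in>B. (b \<bullet> c) *\<^sub>R b) = c"
      using orthonormal_expand[OF B, of c] eq by (simp add: span_base inner_commute)
    then show "(\<Sum>b\<in>B. (b \<bullet> c) *\<^sub>R b) \<bullet> (A *v c) = c \<bullet> (A *v c)" by simp
  qed
  finally show ?thesis .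
qed

lemma trace_on_orthonormal:
  assumes "orthonormal B"
  shows "trace_on A (span B) = (\<Sum>b\<in>B. b \<bullet> (A *v b))"
proof -
  define C where "C = (SOME C. C \<subseteq> span B \<and> pairwise orthogonal C \<and> (\<forall>b\<in>C. norm b = 1) \<and> span C = span B)"
  have "C \<subseteq> span B \<and> pairwise orthogonal C \<and> (\<forall>b\<in>C. norm b = 1) \<and> span C = span B"
    unfolding C_def by (rule someI[of _ B]) (use assms in \<open>auto simp: orthonormal_def span_base\<close>)
  then have "orthonormal C" "span C = span B" by (auto simp: orthonormal_def)
  then have "(\<Sum>b\<in>C. b \<bullet> (A *v b)) = (\<Sum>b\<in>B. b \<bullet> (A *v b))"
    using orthonormal_trace_unique assms by blast
  then show ?thesis unfolding trace_on_def C_def Let_def by simp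
qed

lemma trace_on_add: "subspace W \<Longrightarrow> trace_on (A + B) W = trace_on A W + trace_on B W"
  by (rule orthonormal_basis_exists[of W])
     (auto simp: trace_on_orthonormal matrix_vector_mult_add_rdistrib inner_add_right sum.distrib)

lemma trace_on_scaleR: "subspace W \<Longrightarrow> trace_on (c *\<^sub>R A) W = c * trace_on A W"
  by (rule orthonormal_basis_exists[of W])
     (auto simp: trace_on_orthonormal scaleR_matrix_vector_assoc[symmetric] sum_distrib_left)

lemma trace_on_mat1:
  "subspace W \<Longrightarrow> trace_on (mat 1 :: real^'n^'n) W = real (dim W)"
proof (rule orthonormal_basis_exists[of W])
  fix B assume "subspace W" "orthonormal B" "span B = W"
  then show ?thesis
    using trace_on_orthonormal[of B "mat 1"] orthonormal_card[of B]
    by (simp add: orthonormal_inner)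
qed

definition rank1 :: "real^'n \<Rightarrow> real^'n^'n" where
  "rank1 v = (\<chi> i j. v $ i * v $ j)"

lemma rank1_mult [simp]: "rank1 v *v h = (v \<bullet> h) *\<^sub>R v"
  by (simp add: rank1_def vec_eq_iff matrix_vector_mult_def inner_vec_def sum_distrib_left mult_ac)

lemma trace_on_rank1:
  assumes "subspace W" "v \<in> W"
  shows "trace_on (rank1 v) W = v \<bullet> v"
proof (rule orthonormal_basis_exists[OF assms(1)])
  fix B assume B: "orthonormal B" "span B = W" 
  have "trace_on (rank1 v) W = (\<Sum>b\<in>B. (v \<bullet> b) *\<^sub>R b) \<bullet> v"
    using trace_on_orthonormal[OF B(1)] B(2) by (auto simp: inner_sum_left)
  also have "\<dots> = v \<bullet> v" using orthonormal_expand[OF B(1), of v] B assms(2) by auto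
  finally show ?thesis .
qed

lemma trace_on_UNIV: "trace_on (A :: real^'n^'n) UNIV = trace A"
proof -
  have o: "orthonormal (Basis :: (real^'n) set)"
    by (auto simp: orthonormal_def pairwise_def orthogonal_def inner_Basis)
  have "trace_on A UNIV = (\<Sum>b\<in>Basis. b \<bullet> (A *v b))"
    using trace_on_orthonormal[OF o, of A] by simp
  also have "\<dots> = (\<Sum>i\<in>UNIV. axis i 1 \<bullet> (A *v axis i 1))"
    by (rule sum.reindex_cong[of "\<lambda>i. axis i 1"])
       (auto simp: Basis_vec_def inj_on_def axis_eq_axis)
  also have "\<dots> = trace A"
    by (simp add: trace_def inner_axis' matrix_vector_mul_component inner_axis)
  finally show ?thesis .
qed

text \<open>For orthonormal B this is the projection matrix of \<open>span B\<close>. It is built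
  from a basis, so no choice operator has to be unfolded.\<close>

definition oprojm :: "(real^'n) set \<Rightarrow> real^'n^'n" where
  "oprojm B = (\<Sum>b\<in>B. rank1 b)"

lemma sum_matrix_vector_mult: "(\<Sum>i\<in>I. A i) *v x = (\<Sum>i\<in>I. A i *v (x::real^'n))"
  by (induction I rule: infinite_finite_induct) (auto simp: matrix_vector_mult_add_rdistrib)

lemma oprojm_mult: "oprojm B *v x = (\<Sum>b\<in>B. (b \<bullet> x) *\<^sub>R b)"
  by (simp add: oprojm_def sum_matrix_vector_mult)

definition orth_projector :: "real^'n^'n \<Rightarrow> bool" where
  "orth_projector P \<longleftrightarrow> (\<forall>x y. (P *v x) \<bullet> y = x \<bullet> (P *v y)) \<and> (\<forall>x. P *v (P *v x) = P *v x)"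

lemma orth_projector_mat1: "orth_projector (mat 1)"
  by (simp add: orth_projector_def)

lemma subspace_projector:
  assumes "subspace W"
  obtains P :: "real^'n^'n" where "orth_projector P" "\<And>x. P *v x \<in> W" "\<And>x. x \<in> W \<Longrightarrow> P *v x = x"
    "trace_on P W = real (dim W)"
proof (rule orthonormal_basis_exists[OF assms])
  fix B assume B: "orthonormal B" "span B = W" "B \<subseteq> W"
  let ?P = "oprojm B"
  have inW: "?P *v x \<in> W" for x
    unfolding oprojm_mult B(2)[symmetric] by (intro span_sum span_mul span_base)
  have idW: "?P *v x = x" if "x \<in> W" for x
    using orthonormal_expand[OF B(1), of x] that B(2) by (simp add: oprojm_mult inner_commute)
  have "(?P *v x) \<bullet> y = x \<bullet> (?P *v y)" for x y
    by (simp add: oprojm_mult inner_sum_left inner_sum_right inner_commute[of x] mult.commute)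
  then have o: "orth_projector ?P" using inW idW by (simp add: orth_projector_def)
  have "trace_on ?P W = (\<Sum>b\<in>B. b \<bullet> (?P *v b))"
    using trace_on_orthonormal[OF B(1), of ?P] B(2) by simp
  also have "\<dots> = (\<Sum>b\<in>B. 1)"
    using B by (intro sum.cong) (auto simp: idW subset_eq orthonormal_inner)
  also have "\<dots> = real (dim W)" using orthonormal_card[OF B(1)] B(2) by simp
  finally show thesis using that[of ?P] o inW idW by blast
qed

section \<open>Symmetrisation over the group: from traces over planes to the full trace\<close>

lemma transpose_mult_adjoint: "(transpose A *v x) \<bullet> y = x \<bullet> ((A::real^'n^'n) *v y)"
  by (simp add: dot_lmul_matrix[symmetric] vector_transpose_matrix inner_commute)

lemma norm_transpose: "norm (transpose (A::real^'n^'n)) = norm A"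
proof -
  have "(norm (transpose A))\<^sup>2 = (norm A)\<^sup>2"
    by (simp add: power2_norm_eq_inner inner_vec_def transpose_def) (rule sum.swap)
  then show ?thesis by (simp add: power2_eq_iff_nonneg)
qed

text \<open>The norm of a matrix is the Frobenius norm, taken row by row. Multiplication by
  \<open>transpose Q\<close> on the right applies Q to each row; the left case follows by
  transposing.\<close>

lemma norm_mult_orthogonal:
  fixes Q X :: "real^'n^'n"
  assumes Q: "\<And>x. norm (Q *v x) = norm x"
  shows "norm (X ** transpose Q) = norm X" "norm (Q ** X) = norm X"
proof -
  have row: "(Y ** transpose Q) $ i = Q *v (Y $ i)" for Y :: "real^'n^'n" and i
    by (simp add: vec_eq_iff matrix_matrix_mult_def matrix_vector_mult_def transpose_def mult.commute)
  have 1: "norm (Y ** transpose Q) = norm Y" for Y :: "real^'n^'n"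
  proof -
    have n: "norm Z = L2_set (\<lambda>i. norm (Z $ i)) UNIV" for Z :: "real^'n^'n" by (rule norm_vec_def)
    show ?thesis by (simp only: n row Q)
  qed
  show "norm (X ** transpose Q) = norm X" by (rule 1)
  have "norm (Q ** X) = norm (transpose (Q ** X))" by (simp add: norm_transpose)
  also have "\<dots> = norm X" by (simp add: matrix_transpose_mul 1 norm_transpose)
  finally show "norm (Q ** X) = norm X" .
qed

text \<open>The point of least Frobenius norm in the closed convex hull of the conjugates of \<open>H\<close> is
  fixed by conjugation with the transitive group, so it is a multiple of the identity. This
  replaces averaging over a Haar measure, which the group need not carry.\<close>
lemma Fcone_trace_nonneg:
  fixes GG :: "(real^'n) set set"
  assumes G: "GG \<subseteq> grassmannian p" "GG \<noteq> {}" and p: "p > 0"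
    and K: "orth_subgroup K" "transitive_on_sphere K" "invariant_under K GG"
    and H: "H \<in> Fcone GG"
  shows "trace H \<ge> 0"
proof -
  define cj :: "(real^'n \<Rightarrow> real^'n) \<Rightarrow> real^'n^'n \<Rightarrow> real^'n^'n"
    where "cj k X = transpose (matrix k) ** X ** matrix k" for k X
  define S where "S = (\<lambda>k. cj k H) ` K"
  define C where "C = closure (convex hull S)"
  have lin: "linear k" and nrm: "norm (k x) = norm x" and inn: "k x \<bullet> k y = x \<bullet> y"
    if "k \<in> K" for k x y
    using K(1) that by (auto simp: orth_subgroup_def orthogonal_transformation_def orthogonal_transformation_norm)
  have mk: "matrix k *v x = k x" if "k \<in> K" for k x
    using lin[OF that] by (simp add: matrix_works)
  \<comment> \<open>\<open>cj k X\<close> represents the bilinear form of X pulled back by k, so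
    identities between conjugates are checked on forms.\<close>
  have cj_form: "x \<bullet> (cj k X *v y) = k x \<bullet> (X *v k y)" if "k \<in> K" for k X x y
  proof -
    have "x \<bullet> (cj k X *v y) = x \<bullet> (transpose (matrix k) *v (X *v (matrix k *v y)))"
      by (simp add: cj_def matrix_vector_mul_assoc matrix_mul_assoc)
    also have "\<dots> = (X *v k y) \<bullet> k x"
      using transpose_mult_adjoint[of "matrix k" "X *v (matrix k *v y)" x] mk[OF that]
      by (simp add: inner_commute)
    finally show ?thesis by (simp add: inner_commute)
  qed
  have mateq: "X = Y" if "\<And>x y. x \<bullet> (X *v y) = x \<bullet> (Y *v y)" for X Y :: "real^'n^'n"
    using that by (metis matrix_eq vector_eq_rdot inner_commute)
  have cj_comp: "cj k (cj l X) = cj (l \<circ> k) X" if "k \<in> K" "l \<in> K" for k l X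
  proof (rule mateq)
    have "l \<circ> k \<in> K" using K(1) that by (auto simp: orth_subgroup_def)
    then show "x \<bullet> (cj k (cj l X) *v y) = x \<bullet> (cj (l \<circ> k) X *v y)" for x y
      using that by (simp add: cj_form)
  qed
  have cj_norm: "norm (cj k X) = norm X" if "k \<in> K" for k X
  proof -
    have 1: "norm (matrix k *v x) = norm x" for x using mk nrm that by simp
    have inv: "inv k \<in> K" using K(1) that by (auto simp: orth_subgroup_def)
    have b: "bij k" using K(1) that orthogonal_transformation_bij by (auto simp: orth_subgroup_def)
    have "transpose (matrix k) = matrix (inv k)"
    proof (rule mateq)
      fix x y
      have "x \<bullet> (transpose (matrix k) *v y) = k x \<bullet> y"
        using transpose_mult_adjoint[of "matrix k" y x] mk[OF that] by (simp add: inner_commute)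
      also have "\<dots> = k x \<bullet> k (inv k y)" using b by (simp add: bij_is_surj surj_f_inv_f)
      also have "\<dots> = x \<bullet> (matrix (inv k) *v y)" using inn[OF that] mk[OF inv] by simp
      finally show "x \<bullet> (transpose (matrix k) *v y) = x \<bullet> (matrix (inv k) *v y)" .
    qed
    then have 2: "norm (transpose (matrix k) *v x) = norm x" for x using mk nrm inv by simp
    show ?thesis unfolding cj_def
      using norm_mult_orthogonal(1)[OF 2] norm_mult_orthogonal(2)[OF 2] by (simp add: transpose_transpose)
  qed
  have cj_lin: "linear (cj k)" for k
    unfolding cj_def
    by (rule linearI)
       (auto simp: matrix_matrix_mult_def vec_eq_iff sum.distrib sum_distrib_left distrib_left
          distrib_right mult_ac)
  have "id \<in> K" using K(1) by (simp add: orth_subgroup_def)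
  then have Sne: "S \<noteq> {}" by (auto simp: S_def)
  have cjS: "cj k ` S \<subseteq> S" if "k \<in> K" for k
    using that K(1) by (auto simp: S_def cj_comp orth_subgroup_def)
  have cjC: "cj k X \<in> C" if "k \<in> K" "X \<in> C" for k X
  proof -
    have "cj k ` C \<subseteq> closure (cj k ` (convex hull S))"
      unfolding C_def by (rule closure_linear_image_subset[OF cj_lin])
    also have "\<dots> \<subseteq> closure (convex hull S)"
      using cjS[OF that(1)] by (intro closure_mono) (simp add: convex_hull_linear_image[OF cj_lin] hull_mono)
    finally show ?thesis using that by (auto simp: C_def)
  qed
  have Cc: "closed C" "convex C" "C \<noteq> {}" using Sne by (auto simp: C_def)
  define P where "P = closest_point C 0"
  have PC: "P \<in> C" using Cc unfolding P_def by (intro closest_point_in_set) auto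
  have Pmin: "norm P \<le> norm X" if "X \<in> C" for X
    using closest_point_le[OF Cc(1) that, of 0] by (simp add: P_def)
  \<comment> \<open>Conjugation by k preserves C and the norm, so it sends the point of C nearest to
    0 to such a point again, and that point is unique.\<close>
  have Pinv: "cj k P = P" if "k \<in> K" for k
    using closest_point_unique[OF Cc(2,1) cjC[OF that PC], of 0] cj_norm[OF that] Pmin
    by (simp add: P_def)
  obtain W where W: "W \<in> GG" using G(2) by auto
  have subW: "subspace U" "dim U = p" if "U \<in> GG" for U
    using G(1) that by (auto simp: grassmannian_def)
  \<comment> \<open>A closed convex condition on a linear functional passes from the orbit of H to
    C. Below, the condition is a single value for the full trace and a half line for the trace over
    W.\<close>
  have quad: "X \<in> C \<Longrightarrow> (\<And>k. k \<in> K \<Longrightarrow> L (cj k H) \<in> T) \<Longrightarrow> linear L \<Longrightarrow> closed T \<Longrightarrow> convex T \<Longrightarrow> L X \<in> T"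
    for L :: "real^'n^'n \<Rightarrow> real" and T X
  proof -
    assume X: "X \<in> C" and LS: "\<And>k. k \<in> K \<Longrightarrow> L (cj k H) \<in> T" and L: "linear L" and T: "closed T" "convex T"
    have "convex hull S \<subseteq> L -` T"
      using LS T(2) L by (intro hull_minimal convex_linear_vimage) (auto simp: S_def)
    moreover have "closed (L -` T)" using T(1) L by (intro continuous_closed_vimage linear_continuous_at) (auto simp: linear_conv_bounded_linear)
    ultimately have "C \<subseteq> L -` T" unfolding C_def by (rule closure_minimal)
    then show "L X \<in> T" using X by auto
  qed
  have lin_tr: "linear (\<lambda>X. trace_on X U)" if "subspace U" for U :: "(real^'n) set"
    using that by (intro linearI) (auto simp: trace_on_add trace_on_scaleR)
  have tr_cj: "trace_on (cj k X) U = trace_on X (k ` U)" if "k \<in> K" "subspace U" for k X U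
  proof (rule orthonormal_basis_exists[OF that(2)])
    fix B assume B: "orthonormal B" "span B = U"
    have ik: "inj k" using nrm[OF that(1)] lin[OF that(1)]
      by (metis norm_eq_zero linear_injective_0)
    have kB: "orthonormal (k ` B)" "span (k ` B) = k ` U"
      using B nrm[OF that(1)] inn[OF that(1)] lin[OF that(1)] ik
      by (auto simp: orthonormal_def pairwise_def orthogonal_def span_linear_image[OF lin[OF that(1)]] inj_eq)
    have "trace_on X (k ` U) = (\<Sum>b\<in>k ` B. b \<bullet> (X *v b))"
      using trace_on_orthonormal[OF kB(1)] kB(2) by simp
    also have "\<dots> = (\<Sum>b\<in>B. k b \<bullet> (X *v k b))"
      using ik by (intro sum.reindex_cong[of k]) (auto simp: inj_on_def)
    also have "\<dots> = trace_on (cj k X) U"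
      using trace_on_orthonormal[OF B(1)] B(2) cj_form[OF that(1)] by auto
    finally show ?thesis by simp
  qed
  have kU: "k ` UNIV = UNIV" if "k \<in> K" for k
    using K(1) that orthogonal_transformation_surj by (auto simp: orth_subgroup_def)
  have trP: "trace_on P UNIV \<in> {trace_on H UNIV}"
    by (rule quad[OF PC _ lin_tr]) (auto simp: tr_cj kU)
  have trW: "trace_on P W \<in> {0..}"
  proof (rule quad[OF PC _ lin_tr])
    fix k assume k: "k \<in> K"
    then have "k ` W \<in> GG" using K(3) W by (auto simp: invariant_under_def)
    then show "trace_on (cj k H) W \<in> {0..}" using H k W subW by (auto simp: tr_cj Fcone_def)
  qed (use W subW in auto)
  obtain x0 :: "real^'n" where x0: "norm x0 = 1" using vector_choose_size[of 1] by auto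
  \<comment> \<open>An invariant form is constant on the unit sphere by transitivity of K. Its trace
    over a subspace is then the dimension times this constant, so the sign over one p-plane decides
    the sign over the whole space.\<close>
  have diag: "x \<bullet> (P *v x) = x0 \<bullet> (P *v x0)" if nx: "norm x = 1" for x
  proof -
    obtain k where k: "k \<in> K" "k x = x0" using K(2) nx x0 unfolding transitive_on_sphere_def by blast
    then show ?thesis using cj_form[of k x P x] Pinv[of k] by simp
  qed
  have scal: "trace_on P U = real (dim U) * (x0 \<bullet> (P *v x0))" if "subspace U" for U
  proof (rule orthonormal_basis_exists[OF that])
    fix B assume B: "orthonormal B" "span B = U"
    have "trace_on P U = (\<Sum>b\<in>B. x0 \<bullet> (P *v x0))"
      using trace_on_orthonormal[OF B(1)] B diag by (auto simp: orthonormal_def)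
    then show ?thesis using orthonormal_card[OF B(1)] B(2) by simp
  qed
  have "x0 \<bullet> (P *v x0) \<ge> 0" using trW scal[of W] subW[OF W] p by (simp add: zero_le_mult_iff)
  then have "trace_on P UNIV \<ge> 0" by (simp add: scal)
  then show ?thesis using trP by (simp add: trace_on_UNIV)
qed

section \<open>Test functions\<close>

lemma C2_add:
  assumes "C2_with_hessian f x A" "C2_with_hessian g x B"
  shows "C2_with_hessian (\<lambda>y. f y + g y) x (A + B)"
proof -
  obtain r f1 f2 where f: "r > 0" "\<And>y. y \<in> ball x r \<Longrightarrow> (f has_derivative (\<lambda>h. f1 y \<bullet> h)) (at y)"
    "\<And>y. y \<in> ball x r \<Longrightarrow> (f1 has_derivative (\<lambda>h. f2 y *v h)) (at y)"
    "continuous_on (ball x r) f2" "A = f2 x"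
    using assms(1) unfolding C2_with_hessian_def by blast
  obtain s g1 g2 where g: "s > 0" "\<And>y. y \<in> ball x s \<Longrightarrow> (g has_derivative (\<lambda>h. g1 y \<bullet> h)) (at y)"
    "\<And>y. y \<in> ball x s \<Longrightarrow> (g1 has_derivative (\<lambda>h. g2 y *v h)) (at y)"
    "continuous_on (ball x s) g2" "B = g2 x"
    using assms(2) unfolding C2_with_hessian_def by blast
  have "continuous_on (ball x (min r s)) f2" "continuous_on (ball x (min r s)) g2"
    using f(4) g(4) by (auto elim: continuous_on_subset)
  then show ?thesis
    unfolding C2_with_hessian_def
    by (intro exI[of _ "min r s"] conjI exI[of _ "\<lambda>y. f1 y + g1 y"] exI[of _ "\<lambda>y. f2 y + g2 y"])
       (use f g in \<open>auto intro!: derivative_eq_intros continuous_intros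
          simp: inner_add_left matrix_vector_mult_add_rdistrib\<close>)
qed

text \<open>Each derivative contributes a factor r. With r = 1 the same lemma yields multiples and
  reflections \<open>d - f\<close> of test functions.\<close>

lemma C2_rescale:
  assumes "C2_with_hessian f (r *\<^sub>R x) A"
  shows "C2_with_hessian (\<lambda>y. c * f (r *\<^sub>R y) + d) x ((c * r\<^sup>2) *\<^sub>R A)"
proof -
  obtain s f1 f2 where f: "s > 0"
    "\<And>y. y \<in> ball (r *\<^sub>R x) s \<Longrightarrow> (f has_derivative (\<lambda>h. f1 y \<bullet> h)) (at y)"
    "\<And>y. y \<in> ball (r *\<^sub>R x) s \<Longrightarrow> (f1 has_derivative (\<lambda>h. f2 y *v h)) (at y)"
    "continuous_on (ball (r *\<^sub>R x) s) f2" "A = f2 (r *\<^sub>R x)"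
    using assms unfolding C2_with_hessian_def by blast
  \<comment> \<open>The added 1 keeps the radius meaningful for r = 0.\<close>
  define t where "t = s / (\<bar>r\<bar> + 1)"
  have t: "t > 0" using f(1) by (simp add: t_def)
  have sub: "r *\<^sub>R y \<in> ball (r *\<^sub>R x) s" if "y \<in> ball x t" for y
  proof -
    have "\<bar>r\<bar> * dist x y \<le> \<bar>r\<bar> * t" using that by (intro mult_left_mono) auto
    also have "\<dots> < s" using f(1) by (simp add: t_def field_simps)
    finally show ?thesis by (simp add: dist_norm flip: scaleR_diff_right)
  qed
  have rd: "((\<lambda>y. r *\<^sub>R y) has_derivative (\<lambda>h. r *\<^sub>R h)) (at y)" for y :: "real^'n"
    by (auto intro!: derivative_eq_intros)
  have d1: "((\<lambda>y. c * f (r *\<^sub>R y) + d) has_derivative (\<lambda>h. ((c * r) *\<^sub>R f1 (r *\<^sub>R y)) \<bullet> h)) (at y)"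
    if "y \<in> ball x t" for y
    using has_derivative_compose[OF rd f(2)[OF sub[OF that]]]
    by (auto intro!: derivative_eq_intros)
  have d2: "((\<lambda>y. (c * r) *\<^sub>R f1 (r *\<^sub>R y)) has_derivative (\<lambda>h. ((c * r\<^sup>2) *\<^sub>R f2 (r *\<^sub>R y)) *v h)) (at y)"
    if "y \<in> ball x t" for y
    using has_derivative_compose[OF rd f(3)[OF sub[OF that]]]
    by (auto intro!: derivative_eq_intros
        simp: scaleR_matrix_vector_assoc[symmetric] power2_eq_square matrix_vector_mult_scaleR)
  have "continuous_on (ball x t) (\<lambda>y. (c * r\<^sup>2) *\<^sub>R f2 (r *\<^sub>R y))"
    using sub by (intro continuous_intros continuous_on_compose2[OF f(4)]) auto
  then show ?thesis
    unfolding C2_with_hessian_def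
    by (intro exI[of _ t] conjI exI[of _ "\<lambda>y. (c * r) *\<^sub>R f1 (r *\<^sub>R y)"]
          exI[of _ "\<lambda>y. (c * r\<^sup>2) *\<^sub>R f2 (r *\<^sub>R y)"] ballI t d1 d2) (simp_all add: f(5))
qed

lemma C2_cmult: "C2_with_hessian f x A \<Longrightarrow> C2_with_hessian (\<lambda>y. c * f y) x (c *\<^sub>R A)"
  using C2_rescale[of f 1 x A c 0] by simp

lemma C2_minus_const: "C2_with_hessian f x A \<Longrightarrow> C2_with_hessian (\<lambda>y. d - f y) x (- A)"
  using C2_rescale[of f 1 x A "-1" d] by simp

lemma C2_const: "C2_with_hessian (\<lambda>y. c) x 0"
  unfolding C2_with_hessian_def
  by (intro exI[of _ 1] conjI exI[of _ "\<lambda>_. 0"]) (auto intro!: has_derivative_eq_rhs[OF has_derivative_const] simp: fun_eq_iff)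

lemma C2_sum:
  "finite I \<Longrightarrow> (\<And>i. i \<in> I \<Longrightarrow> C2_with_hessian (f i) x (A i)) \<Longrightarrow>
    C2_with_hessian (\<lambda>y. \<Sum>i\<in>I. f i y) x (\<Sum>i\<in>I. A i)"
  by (induction I rule: finite_induct) (auto intro: C2_add C2_const)

lemma continuous_on_rank1: "continuous_on S f \<Longrightarrow> continuous_on S (\<lambda>x. rank1 (f x))"
  unfolding rank1_def by (intro continuous_on_vec_lambda continuous_intros)

definition qform :: "real^'n^'n \<Rightarrow> real^'n \<Rightarrow> real" where
  "qform P y = (P *v y) \<bullet> (P *v y)"

lemma qform_mat1: "qform (mat 1) y = y \<bullet> y"
  by (simp add: qform_def)

lemma qform_nonneg: "qform P y \<ge> 0" by (simp add: qform_def)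

lemma continuous_on_qform [continuous_intros]:
  "continuous_on S f \<Longrightarrow> continuous_on S (\<lambda>x. qform P (f x))"
  unfolding qform_def by (intro continuous_intros bounded_linear.continuous_on[OF matrix_vector_mul_bounded_linear])

text \<open>Every test function of the proof is a sum of functions of a squared distance
  \<open>|P (y - z)|\<^sup>2\<close>, where \<open>P\<close> is the identity or a projection onto one of the \<open>p\<close>-planes.\<close>
lemma C2_qform:
  fixes P :: "real^'n^'n"
  assumes P: "orth_projector P" and I: "open I" "qform P (x - z) \<in> I"
    and f: "\<And>s. s \<in> I \<Longrightarrow> (f has_real_derivative f1 s) (at s)"
    and f1: "\<And>s. s \<in> I \<Longrightarrow> (f1 has_real_derivative f2 s) (at s)"
    and f2: "continuous_on I f2"
  shows "C2_with_hessian (\<lambda>y. f (qform P (y - z))) x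
    ((4 * f2 (qform P (x - z))) *\<^sub>R rank1 (P *v (x - z)) + (2 * f1 (qform P (x - z))) *\<^sub>R P)"
proof -
  let ?q = "\<lambda>y. qform P (y - z)"
  have "continuous_on UNIV ?q" by (intro continuous_intros)
  then have "open (?q -` I)" using I(1) by (simp add: open_vimage)
  then obtain r where r: "r > 0" "ball x r \<subseteq> ?q -` I"
    using I(2) by (metis openE vimageI)
  then have r: "r > 0" "\<And>y. y \<in> ball x r \<Longrightarrow> ?q y \<in> I" by auto
  have dP: "((\<lambda>y. P *v (y - z)) has_derivative (\<lambda>h. P *v h)) (at y)" for y
    by (rule derivative_eq_intros has_derivative_compose[of "\<lambda>y. y - z" _ y UNIV "\<lambda>x. P *v x"]
        bounded_linear_imp_has_derivative | simp)+
  \<comment> \<open>Self-adjointness and idempotence make 2P(y - z) the gradient of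
    \<open>qform P (y - z)\<close>.\<close>
  have PP: "(P *v a) \<bullet> (P *v h) = (P *v a) \<bullet> h" for a h
    using P unfolding orth_projector_def by metis
  have dq: "(?q has_derivative (\<lambda>h. 2 * ((P *v (y - z)) \<bullet> h))) (at y)" for y
    unfolding qform_def
    by (rule has_derivative_eq_rhs[OF has_derivative_inner[OF dP dP]])
       (use PP[of "y - z"] inner_commute[of "P *v (y - z)"] in \<open>auto simp: fun_eq_iff\<close>)
  have d1: "((\<lambda>y. f (?q y)) has_derivative (\<lambda>h. ((2 * f1 (?q y)) *\<^sub>R (P *v (y - z))) \<bullet> h)) (at y)"
    if "y \<in> ball x r" for y
    using has_derivative_compose[OF dq[of y] f[OF r(2)[OF that], unfolded has_field_derivative_def]]
    by (simp add: mult_ac)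
  have d2: "((\<lambda>y. (2 * f1 (?q y)) *\<^sub>R (P *v (y - z))) has_derivative
      (\<lambda>h. ((4 * f2 (?q y)) *\<^sub>R rank1 (P *v (y - z)) + (2 * f1 (?q y)) *\<^sub>R P) *v h)) (at y)"
    if "y \<in> ball x r" for y
  proof -
    have "((\<lambda>y. f1 (?q y)) has_derivative (\<lambda>h. f2 (?q y) * (2 * ((P *v (y - z)) \<bullet> h)))) (at y)"
      using has_derivative_compose[OF dq[of y] f1[OF r(2)[OF that], unfolded has_field_derivative_def]] by simp
    from has_derivative_scaleR[OF has_derivative_mult_right[OF this, of 2] dP]
    show ?thesis
      by (rule has_derivative_eq_rhs) (auto simp: fun_eq_iff matrix_vector_mult_add_rdistrib
          scaleR_matrix_vector_assoc[symmetric] algebra_simps)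
  qed
  have "continuous_on (ball x r)
      (\<lambda>y. (4 * f2 (?q y)) *\<^sub>R rank1 (P *v (y - z)) + (2 * f1 (?q y)) *\<^sub>R P)"
  proof -
    have cf1: "continuous_on I f1"
      by (rule DERIV_continuous_on[of _ _ f2]) (blast intro: f1 has_field_derivative_at_within)
    have "continuous_on (ball x r) (\<lambda>y. P *v (y - z))"
      by (intro continuous_intros bounded_linear.continuous_on[OF matrix_vector_mul_bounded_linear])
    then show ?thesis
      by (intro continuous_intros continuous_on_rank1 continuous_on_compose2[OF f2, of _ ?q]
          continuous_on_compose2[OF cf1, of _ ?q] image_subsetI r(2))
  qed
  then show ?thesis
    unfolding C2_with_hessian_def
    by (intro exI[of _ r] conjI exI[of _ "\<lambda>y. (2 * f1 (?q y)) *\<^sub>R (P *v (y - z))"]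
        exI[of _ "\<lambda>y. (4 * f2 (?q y)) *\<^sub>R rank1 (P *v (y - z)) + (2 * f1 (?q y)) *\<^sub>R P"]
        ballI r(1) d1 d2) simp_all
qed

section \<open>Upper semicontinuous functions\<close>

lemma usc_onD: "usc_on S u \<Longrightarrow> x \<in> S \<Longrightarrow> u x < c \<Longrightarrow> \<forall>\<^sub>F y in at x within S. u y < c"
  by (auto simp: usc_on_def)

lemma usc_on_subset: "usc_on S u \<Longrightarrow> T \<subseteq> S \<Longrightarrow> usc_on T u"
  by (meson filter_leD at_le usc_on_def in_mono)

lemma usc_on_openin: "usc_on S u \<longleftrightarrow> (\<forall>c. openin (top_of_set S) {x\<in>S. u x < c})"
proof safe
  fix c assume u: "usc_on S u"
  show "openin (top_of_set S) {x\<in>S. u x < c}"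
  proof (subst openin_subopen, safe)
    fix x assume x: "x \<in> S" "u x < c"
    from usc_onD[OF u x] obtain T where "open T" "x \<in> T" "\<forall>y\<in>T. y \<noteq> x \<longrightarrow> y \<in> S \<longrightarrow> u y < c"
      unfolding eventually_at_topological by auto
    then show "\<exists>T. openin (top_of_set S) T \<and> x \<in> T \<and> T \<subseteq> {x\<in>S. u x < c}"
      using x by (intro exI[of _ "S \<inter> T"]) (auto simp: openin_open)
  qed
next
  assume o: "\<forall>c. openin (top_of_set S) {x\<in>S. u x < c}"
  show "usc_on S u" unfolding usc_on_def
  proof safe
    fix x c assume "x \<in> S" "u x < c"
    moreover obtain T where "open T" "{x\<in>S. u x < c} = S \<inter> T" using o by (auto simp: openin_open)
    ultimately show "\<forall>\<^sub>F y in at x within S. u y < c"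
      unfolding eventually_at_topological by (intro exI[of _ T]) auto
  qed
qed

text \<open>If every x had a point m x with a larger value, the open sets where u < u (m x) would
  cover S. In a finite subcover the largest of the values u (m x) would be smaller than another one
  of them.\<close>

lemma usc_on_attains_max:
  assumes S: "compact S" "S \<noteq> {}" and u: "usc_on S u"
  shows "\<exists>x\<in>S. \<forall>y\<in>S. u y \<le> (u x :: ereal)"
proof (rule ccontr)
  assume "\<not> ?thesis"
  then have "\<exists>y\<in>S. u x < u y" if "x \<in> S" for x using that by (meson not_le)
  then obtain m where m: "\<And>x. x \<in> S \<Longrightarrow> m x \<in> S" "\<And>x. x \<in> S \<Longrightarrow> u x < u (m x)" by metis
  have "\<forall>x\<in>S. \<exists>T. open T \<and> {y\<in>S. u y < u (m x)} = S \<inter> T"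
    using u by (auto simp: usc_on_openin openin_open)
  then obtain T where T: "\<And>x. x \<in> S \<Longrightarrow> open (T x)" "\<And>x. x \<in> S \<Longrightarrow> {y\<in>S. u y < u (m x)} = S \<inter> T x"
    by metis
  have "S \<subseteq> (\<Union>x\<in>S. T x)" using T(2) m by blast
  then obtain C where C: "C \<subseteq> S" "finite C" "S \<subseteq> (\<Union>x\<in>C. T x)"
    using compactE_image[OF S(1), of S T] T(1) by blast
  then have "C \<noteq> {}" using S(2) by auto
  have "Max ((\<lambda>y. u (m y)) ` C) \<in> (\<lambda>y. u (m y)) ` C" using C(2) \<open>C \<noteq> {}\<close> by (intro Max_in) auto
  then obtain x where x: "x \<in> C" "u (m x) = Max ((\<lambda>y. u (m y)) ` C)" by auto
  then have x: "x \<in> C" "\<And>y. y \<in> C \<Longrightarrow> u (m y) \<le> u (m x)" using C(2) by auto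
  have "m x \<in> S" using C(1) x(1) m(1) by auto
  then obtain y where y: "y \<in> C" "m x \<in> T y" using C(3) by auto
  then have "u (m x) < u (m y)" using T(2)[of y] C(1) \<open>m x \<in> S\<close> by auto
  then show False using x(2)[OF y(1)] by simp
qed

lemma usc_on_add_continuous:
  assumes u: "usc_on S u" "\<And>x. x \<in> S \<Longrightarrow> u x \<noteq> \<infinity>" and g: "continuous_on S g"
  shows "usc_on S (\<lambda>x. u x + ereal (g x))"
  unfolding usc_on_def
proof safe
  fix x c assume x: "x \<in> S" "u x + ereal (g x) < c"
  then have "u x < c - ereal (g x)" by (simp add: ereal_less_minus_iff)
  \<comment> \<open>A real number d strictly above u x separates u from the continuous part, also
    where u is -infinity.\<close>
  then obtain d where d: "u x < ereal d" "ereal d < c - ereal (g x)" using ereal_dense2 by blast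
  then have "ereal (d + g x) < c" by (cases c) auto
  then obtain e where e: "e > 0" "ereal (d + g x + e) < c"
  proof (cases c)
    case (real r)
    then show ?thesis using that[of "(r - (d + g x)) / 2"] \<open>ereal (d + g x) < c\<close> by (auto simp: field_simps)
  qed (use that[of 1] in auto)
  have 1: "\<forall>\<^sub>F y in at x within S. u y < ereal d" using usc_onD[OF u(1) x(1) d(1)] .
  have "(g \<longlongrightarrow> g x) (at x within S)" using g x(1) by (auto simp: continuous_on_def)
  then have 2: "\<forall>\<^sub>F y in at x within S. g y < g x + e"
    using e(1) by (auto intro: order_tendstoD)
  show "\<forall>\<^sub>F y in at x within S. u y + ereal (g y) < c"
    using 1 2
  proof eventually_elim
    case (elim y)
    then have "u y + ereal (g y) \<le> ereal d + ereal (g x + e)"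
      by (intro add_mono) auto
    also have "\<dots> < c" using e by (simp add: add_ac)
    finally show ?case .
  qed
qed

section \<open>Comparison\<close>

lemma G_pshD:
  assumes "G_psh GG \<Omega> u" "x \<in> \<Omega>" "C2_with_hessian \<phi> x H"
    "\<forall>\<^sub>F y in nhds x. u y \<le> ereal (\<phi> y)" "u x = ereal (\<phi> x)"
  shows "H \<in> Fcone GG"
  using assms unfolding G_psh_def by auto

text \<open>At a maximum of u + g a constant minus g touches u from above, and its Hessian is -H.
  Every comparison below rests on this.\<close>

lemma G_psh_touch:
  assumes u: "G_psh GG \<Omega> u" and x: "x \<in> interior S" "S \<subseteq> \<Omega>" "u x \<noteq> -\<infinity>"
    and max: "\<And>y. y \<in> S \<Longrightarrow> u y + ereal (g y) \<le> u x + ereal (g x)"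
    and g: "C2_with_hessian g x H"
  shows "- H \<in> Fcone GG"
proof -
  have xS: "x \<in> S" using x interior_subset by auto
  then have "u x \<noteq> \<infinity>" using u x(2) by (auto simp: G_psh_def)
  then obtain a where a: "u x = ereal a" using x(3) by (cases "u x") auto
  have "\<forall>\<^sub>F y in nhds x. y \<in> S"
    using x(1) interior_subset[of S] unfolding eventually_nhds by (intro exI[of _ "interior S"]) auto
  then have "\<forall>\<^sub>F y in nhds x. u y \<le> ereal ((a + g x) - g y)"
  proof eventually_elim
    case (elim y)
    then show ?case using max[OF elim] a by (cases "u y") auto
  qed
  moreover have "u x = ereal ((a + g x) - g x)" using a by simp
  moreover have "C2_with_hessian (\<lambda>y. (a + g x) - g y) x (- H)" using g by (rule C2_minus_const)
  ultimately show ?thesis using G_pshD[OF u, of x] xS x(2) by blast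
qed

text \<open>The maximum of u + g exists by upper semicontinuity. In the interior, at a finite value
  of u, it would put -H into the cone, against the positive trace of H over one single
  plane.\<close>

lemma G_psh_comparison:
  assumes u: "G_psh GG \<Omega> u" and S: "compact S" "S \<subseteq> \<Omega>" and g: "continuous_on S g"
    and GG: "\<And>W. W \<in> GG \<Longrightarrow> subspace W"
    and strict: "\<And>x. x \<in> interior S \<Longrightarrow> \<exists>H. C2_with_hessian g x H \<and> (\<exists>W\<in>GG. trace_on H W > 0)"
    and bd: "\<And>x. x \<in> S - interior S \<Longrightarrow> u x + ereal (g x) \<le> c"
    and x: "x \<in> S"
  shows "u x + ereal (g x) \<le> c"
proof -
  have fin: "u y \<noteq> \<infinity>" if "y \<in> S" for y using u S(2) that by (auto simp: G_psh_def)
  have "usc_on S u" using u S(2) usc_on_subset by (auto simp: G_psh_def)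
  then have "usc_on S (\<lambda>x. u x + ereal (g x))" using fin g by (intro usc_on_add_continuous) auto
  then obtain m where m: "m \<in> S" "\<And>y. y \<in> S \<Longrightarrow> u y + ereal (g y) \<le> u m + ereal (g m)"
    using usc_on_attains_max[OF S(1)] x by blast
  have "u m + ereal (g m) \<le> c"
  proof (cases "m \<in> interior S")
    case True
    have "u m = -\<infinity>"
    proof (rule ccontr)
      assume "u m \<noteq> -\<infinity>"
      obtain H W where H: "C2_with_hessian g m H" "W \<in> GG" "trace_on H W > 0" using strict[OF True] by blast
      have "- H \<in> Fcone GG" by (rule G_psh_touch[OF u True S(2) \<open>u m \<noteq> -\<infinity>\<close> m(2) H(1)])
      then have "trace_on (- H) W \<ge> 0" using H(2) by (auto simp: Fcone_def)
      then show False using trace_on_scaleR[OF GG[OF H(2)], of "-1" H] H(3) by simp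
    qed
    then show ?thesis by simp
  qed (use bd m(1) in auto)
  then show ?thesis using m(2)[OF x] by order
qed

lemma Fcone_scaleR:
  "H \<in> Fcone GG \<Longrightarrow> c \<ge> 0 \<Longrightarrow> (\<And>W. W \<in> GG \<Longrightarrow> subspace W) \<Longrightarrow> c *\<^sub>R H \<in> Fcone GG"
  by (auto simp: Fcone_def symmetric_matrix_def trace_on_scaleR transpose_def vec_eq_iff)

lemma G_psh_rescale:
  assumes u: "G_psh GG \<Omega> u" and r: "r > 0" "a > 0" and GG: "\<And>W. W \<in> GG \<Longrightarrow> subspace W"
  shows "G_psh GG ((\<lambda>x. r *\<^sub>R x) -` \<Omega>) (\<lambda>x. ereal a * u (r *\<^sub>R x) + ereal b)"
  unfolding G_psh_def
proof (intro conjI ballI allI impI)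
  let ?D = "(\<lambda>x. r *\<^sub>R x) -` \<Omega>"
  have usc: "usc_on \<Omega> u" and fin: "\<And>x. x \<in> \<Omega> \<Longrightarrow> u x \<noteq> \<infinity>" using u by (auto simp: G_psh_def)
  have eq: "ereal a * t + ereal b < c \<longleftrightarrow> t < (c - ereal b) / ereal a" if "t \<noteq> \<infinity>" for t c
    using that r(2) by (cases t; cases c) (auto simp: field_simps)
  \<comment> \<open>The affine change of values is undone first, so that semicontinuity of u itself
    applies.\<close>
  show "usc_on ?D (\<lambda>x. ereal a * u (r *\<^sub>R x) + ereal b)"
    unfolding usc_on_def
  proof safe
    fix x c assume x: "r *\<^sub>R x \<in> \<Omega>" "ereal a * u (r *\<^sub>R x) + ereal b < c"
    then have "\<forall>\<^sub>F y in at (r *\<^sub>R x) within \<Omega>. u y < (c - ereal b) / ereal a"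
      using eq fin usc_onD[OF usc] by auto
    moreover have "filterlim (\<lambda>y. r *\<^sub>R y) (at (r *\<^sub>R x) within \<Omega>) (at x within ?D)"
      using r(1) by (auto simp: filterlim_at eventually_at_filter intro!: tendsto_intros)
    ultimately have "\<forall>\<^sub>F y in at x within ?D. u (r *\<^sub>R y) < (c - ereal b) / ereal a"
      by (rule eventually_compose_filterlim)
    moreover have "\<forall>\<^sub>F y in at x within ?D. y \<in> ?D" by (simp add: eventually_at_filter)
    ultimately show "\<forall>\<^sub>F y in at x within ?D. ereal a * u (r *\<^sub>R y) + ereal b < c"
      by eventually_elim (use eq fin in auto)
  qed
  show "ereal a * u (r *\<^sub>R x) + ereal b \<noteq> \<infinity>" if "x \<in> ?D" for x
    using fin[of "r *\<^sub>R x"] that r(2) by (cases "u (r *\<^sub>R x)") auto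
  fix x \<phi> H
  assume x: "x \<in> ?D" and A: "C2_with_hessian \<phi> x H \<and>
      (\<forall>\<^sub>F y in nhds x. ereal a * u (r *\<^sub>R y) + ereal b \<le> ereal (\<phi> y)) \<and>
      ereal a * u (r *\<^sub>R x) + ereal b = ereal (\<phi> x)"
  \<comment> \<open>The inequality for \<phi> solved for u and transported to the point r x. The two
    Hessians differ by a positive factor, under which the cone is stable.\<close>
  define \<psi> where "\<psi> = (\<lambda>y. (1/a) * \<phi> ((1/r) *\<^sub>R y) + (- b/a))"
  define H' where "H' = ((1/a) * (1/r)\<^sup>2) *\<^sub>R H"
  have "C2_with_hessian \<phi> ((1/r) *\<^sub>R (r *\<^sub>R x)) H" using A r by simp
  then have c2: "C2_with_hessian \<psi> (r *\<^sub>R x) H'" unfolding \<psi>_def H'_def by (rule C2_rescale)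
  have "filterlim (\<lambda>y. (1/r) *\<^sub>R y) (nhds ((1/r) *\<^sub>R (r *\<^sub>R x))) (nhds (r *\<^sub>R x))"
    by (intro tendsto_intros filterlim_ident)
  then have fl: "filterlim (\<lambda>y. (1/r) *\<^sub>R y) (nhds x) (nhds (r *\<^sub>R x))" using r by simp
  have "\<forall>\<^sub>F y in nhds x. ereal a * u (r *\<^sub>R y) + ereal b \<le> ereal (\<phi> y)" using A by blast
  from eventually_compose_filterlim[OF this fl]
  have "\<forall>\<^sub>F y in nhds (r *\<^sub>R x). ereal a * u (r *\<^sub>R ((1/r) *\<^sub>R y)) + ereal b \<le> ereal (\<phi> ((1/r) *\<^sub>R y))" .
  then have le: "\<forall>\<^sub>F y in nhds (r *\<^sub>R x). u y \<le> ereal (\<psi> y)"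
  proof eventually_elim
    case (elim y)
    then have "ereal a * u y + ereal b \<le> ereal (\<phi> ((1/r) *\<^sub>R y))" using r by simp
    then show ?case using r unfolding \<psi>_def by (cases "u y") (auto simp: field_simps)
  qed
  have "u (r *\<^sub>R x) = ereal (\<psi> (r *\<^sub>R x))"
    using A r unfolding \<psi>_def by (cases "u (r *\<^sub>R x)") (auto simp: field_simps)
  then have "H' \<in> Fcone GG" using G_pshD[OF u _ c2 le] x by auto
  moreover have "H = (a * r\<^sup>2) *\<^sub>R H'" using r by (simp add: H'_def power2_eq_square)
  ultimately show "H \<in> Fcone GG"
    using r GG by (auto intro!: Fcone_scaleR)
qed

section \<open>The heat kernel\<close>

text \<open>The heat kernel in the time t and the squared distance s, without the factor (4
  pi)^(-n/2); the resulting mass \<open>gauss0\<close> is divided out later. Writing t^(-n/2)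
  through \<open>ln\<close> puts everything into one exponential.\<close>

definition heat :: "nat \<Rightarrow> real \<Rightarrow> real \<Rightarrow> real" where
  "heat n t s = exp (- (real n / 2) * ln t - s / (4 * t))"

lemma heat_pos: "heat n t s > 0" by (simp add: heat_def)

lemma heat_deriv_time:
  "t > 0 \<Longrightarrow> ((\<lambda>t. heat n t s) has_real_derivative (s / (4 * t\<^sup>2) - real n / (2 * t)) * heat n t s) (at t)"
  unfolding heat_def
  by (auto intro!: derivative_eq_intros simp: field_simps power2_eq_square)

text \<open>The factor a lets the lemma be applied twice, the second time to the first
  derivative.\<close>

lemma heat_deriv_space:
  "t \<noteq> 0 \<Longrightarrow> ((\<lambda>s. a * heat n t s) has_real_derivative (- a / (4 * t)) * heat n t s) (at s)"
  unfolding heat_def by (auto intro!: derivative_eq_intros simp: field_simps)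

lemma C2_heat:
  fixes x z :: "real^'n"
  assumes t: "t > 0"
  shows "C2_with_hessian (\<lambda>y. heat n t (qform (mat 1) (y - z))) x
    ((4 * (1 / (4*t)\<^sup>2 * heat n t (qform (mat 1) (x - z)))) *\<^sub>R rank1 (mat 1 *v (x - z))
      + (2 * ((- 1 / (4*t)) * heat n t (qform (mat 1) (x - z)))) *\<^sub>R mat 1)"
proof (rule C2_qform[where I = UNIV])
  show "((\<lambda>s. heat n t s) has_real_derivative (- 1 / (4*t)) * heat n t s) (at s)" for s
    using heat_deriv_space[of t 1 n s] t by simp
  show "((\<lambda>s. (- 1 / (4*t)) * heat n t s) has_real_derivative 1 / (4*t)\<^sup>2 * heat n t s) (at s)" for s
    using heat_deriv_space[of t "- 1 / (4*t)" n s] t by (simp add: power2_eq_square field_simps)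
  show "continuous_on UNIV (\<lambda>s. 1 / (4*t)\<^sup>2 * heat n t s)"
    unfolding heat_def using t by (intro continuous_intros) auto
qed (auto intro: orth_projector_mat1)

lemma trace_scaleR: "trace (c *\<^sub>R A) = c * trace (A :: real^'n^'n)"
  by (simp add: trace_def sum_distrib_left)

lemma trace_rank1: "trace (rank1 v) = v \<bullet> v"
  by (simp add: trace_def rank1_def inner_vec_def)

text \<open>For fixed s the kernel increases in time up to t = s/(2n), and T is this peak time for
  the distance L. The inequality reduces to ln x <= x - 1 at x = T/t.\<close>

lemma heat_mono_time:
  assumes t: "0 < t" "t \<le> T" and s: "L\<^sup>2 \<le> s" and T: "2 * real n * T = L\<^sup>2"
  shows "heat n t s \<le> heat n T (L\<^sup>2)"
proof -
  have "ln (T/t) \<le> T/t - 1" using t by (intro ln_le_minus_one) auto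
  then have "real n / 2 * ln (T/t) \<le> real n / 2 * (T/t - 1)" by (intro mult_left_mono) auto
  also have "\<dots> = (2 * real n * T) / 4 * (1/t - 1/T)" using t by (simp add: field_simps)
  also have "\<dots> \<le> s / 4 * (1/t - 1/T)"
    using t s unfolding T by (intro mult_right_mono divide_right_mono) (auto simp: frac_le)
  finally have "- (real n / 2) * ln t - s / (4 * t) \<le> - (real n / 2) * ln T - s / (4 * T)"
    using t by (simp add: ln_div algebra_simps diff_divide_distrib)
  also have "\<dots> \<le> - (real n / 2) * ln T - L\<^sup>2 / (4 * T)"
    using s t by (intro diff_left_mono divide_right_mono) auto
  finally show ?thesis by (simp add: heat_def)
qed

text \<open>Lebesgue measure is a product measure and the integrand a product, so integrability of a
  one-dimensional normal density suffices.\<close>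

lemma nn_integral_gauss_finite:
  assumes "b > 0"
  shows "(\<integral>\<^sup>+z. ennreal (exp (- b * (norm z)\<^sup>2)) \<partial>(lborel :: 'a::euclidean_space measure)) < \<infinity>"
proof -
  interpret product_sigma_finite "\<lambda>_::'a. lborel :: real measure" ..
  define \<sigma> where "\<sigma> = sqrt (1 / (2*b))"
  have \<sigma>: "\<sigma> > 0" "2 * \<sigma>\<^sup>2 = 1/b" using assms by (auto simp: \<sigma>_def)
  have "integrable lborel (\<lambda>t. sqrt (2 * pi * \<sigma>\<^sup>2) * normal_density 0 \<sigma> t)"
    using \<sigma> by (intro integrable_mult_right) auto
  moreover have "sqrt (2 * pi * \<sigma>\<^sup>2) * normal_density 0 \<sigma> t = exp (- b * t\<^sup>2)" for t
  proof -
    have "t\<^sup>2 / (2 * \<sigma>\<^sup>2) = b * t\<^sup>2" unfolding \<sigma>(2) by simp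
    then show ?thesis using \<sigma>(1) by (simp add: normal_density_def)
  qed
  ultimately have int1: "integrable lborel (\<lambda>t::real. exp (- b * t\<^sup>2))" by simp
  define J where "J = (\<integral>\<^sup>+t. ennreal (exp (- b * t\<^sup>2)) \<partial>(lborel :: real measure))"
  have J: "J < \<infinity>" using int1 unfolding J_def by (simp add: real_integrable_def less_top)
  have nrm: "(norm (\<Sum>i\<in>Basis. f i *\<^sub>R i))\<^sup>2 = (\<Sum>i\<in>Basis. (f i)\<^sup>2)" for f :: "'a \<Rightarrow> real"
    by (subst power2_norm_eq_inner, subst euclidean_inner) (simp add: power2_eq_square)
  have "(\<integral>\<^sup>+z. ennreal (exp (- b * (norm z)\<^sup>2)) \<partial>(lborel :: 'a measure)) =
      (\<integral>\<^sup>+f. ennreal (exp (- b * (norm (\<Sum>i\<in>Basis. f i *\<^sub>R i :: 'a))\<^sup>2)) \<partial>(\<Pi>\<^sub>M i\<in>(Basis::'a set). lborel))"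
    by (subst lborel_eq) (rule nn_integral_distr; measurable)
  also have "\<dots> = (\<integral>\<^sup>+f. (\<Prod>i\<in>Basis. ennreal (exp (- b * (f i)\<^sup>2))) \<partial>(\<Pi>\<^sub>M i\<in>(Basis::'a set). lborel))"
    unfolding nrm by (simp add: sum_distrib_left exp_sum prod_ennreal sum_negf[symmetric])
  also have "\<dots> = (\<Prod>i\<in>(Basis::'a set). J)"
    unfolding J_def by (rule product_nn_integral_prod) auto
  also have "\<dots> < \<infinity>" using J by (simp add: power_less_top_ennreal)
  finally show ?thesis .
qed

text \<open>This and \<open>gauss1\<close> are the zeroth and the first absolute moment of
  exp(-|z|^2/4). Their values are never computed: only finiteness of both and positivity of this one
  matter.\<close>

definition gauss0 :: "'a::euclidean_space itself \<Rightarrow> real" where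
  "gauss0 _ = enn2real (\<integral>\<^sup>+z. ennreal (exp (- (norm z)\<^sup>2 / 4)) \<partial>(lborel :: 'a measure))"

definition gauss1 :: "'a::euclidean_space itself \<Rightarrow> real" where
  "gauss1 _ = enn2real (\<integral>\<^sup>+z. ennreal (norm z * exp (- (norm z)\<^sup>2 / 4)) \<partial>(lborel :: 'a measure))"

lemma ennreal_gauss0:
  "(\<integral>\<^sup>+z. ennreal (exp (- (norm z)\<^sup>2 / 4)) \<partial>(lborel :: 'a::euclidean_space measure)) = ennreal (gauss0 TYPE('a))"
  using nn_integral_gauss_finite[of "1/4", where 'a='a] by (simp add: gauss0_def)

lemma gauss0_pos: "gauss0 TYPE('a::euclidean_space) > 0"
proof -
  have "(\<integral>\<^sup>+z. ennreal (exp (- (norm z)\<^sup>2 / 4)) \<partial>(lborel :: 'a measure)) \<noteq> 0"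
    by (subst nn_integral_0_iff) (auto simp: emeasure_lborel_UNIV)
  then show ?thesis unfolding ennreal_gauss0 by (simp add: ennreal_eq_0_iff)
qed

lemma ennreal_gauss1:
  "(\<integral>\<^sup>+z. ennreal (norm z * exp (- (norm z)\<^sup>2 / 4)) \<partial>(lborel :: 'a::euclidean_space measure)) = ennreal (gauss1 TYPE('a))"
proof -
  have "norm z * exp (- (norm z)\<^sup>2 / 4) \<le> 2 * exp (- (1/8) * (norm z)\<^sup>2)" for z :: 'a
  proof -
    have "(norm z / 2 - 1)\<^sup>2 \<ge> 0" by simp
    then have "norm z \<le> 2 * (1 + (norm z)\<^sup>2 / 8)" by (simp add: power2_eq_square algebra_simps)
    also have "\<dots> \<le> 2 * exp ((norm z)\<^sup>2 / 8)" by (intro mult_left_mono exp_ge_add_one_self) auto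
    finally have "norm z * exp (- (norm z)\<^sup>2 / 4) \<le> 2 * exp ((norm z)\<^sup>2 / 8) * exp (- (norm z)\<^sup>2 / 4)"
      by (intro mult_right_mono) auto
    also have "\<dots> = 2 * exp (- (1/8) * (norm z)\<^sup>2)"
      by (simp add: mult.assoc flip: exp_add)
    finally show ?thesis .
  qed
  then have "(\<integral>\<^sup>+z. ennreal (norm z * exp (- (norm z)\<^sup>2 / 4)) \<partial>(lborel :: 'a measure))
    \<le> (\<integral>\<^sup>+z. ennreal (2 * exp (- (1/8) * (norm z)\<^sup>2)) \<partial>(lborel :: 'a measure))"
    by (intro nn_integral_mono ennreal_leI)
  also have "\<dots> = (\<integral>\<^sup>+z. ennreal 2 * ennreal (exp (- (1/8) * (norm z)\<^sup>2)) \<partial>(lborel :: 'a measure))"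
    by (intro nn_integral_cong ennreal_mult) auto
  also have "\<dots> < \<infinity>"
    using nn_integral_gauss_finite[of "1/8", where 'a='a] by (subst nn_integral_cmult) (auto simp: ennreal_mult_less_top)
  finally show ?thesis by (simp add: gauss1_def)
qed

lemma nn_integral_lborel_affine:
  fixes x :: "'a::euclidean_space"
  assumes [measurable]: "g \<in> borel_measurable borel" and c: "c > 0"
  shows "(\<integral>\<^sup>+y. g y \<partial>lborel) = ennreal (c ^ DIM('a)) * (\<integral>\<^sup>+z. g (x + c *\<^sub>R z) \<partial>lborel)"
  using c by (subst lborel_affine[of c x])
    (auto simp: nn_integral_density nn_integral_distr nn_integral_cmult)

text \<open>The substitution y = x + sqrt t z turns the kernel into a fixed Gaussian, and the
  Lipschitz bound on f costs L sqrt t |z| there.\<close>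

lemma nn_integral_heat:
  fixes x :: "real^'n"
  assumes f: "\<And>y. f y \<ge> 0" "\<And>y. f y \<le> f x + L * dist x y" "L \<ge> 0" "f \<in> borel_measurable borel" and t: "t > 0"
  shows "(\<integral>\<^sup>+y. ennreal (f y * heat CARD('n) t (qform (mat 1) (x - y))) \<partial>lborel)
    \<le> ennreal (f x * gauss0 TYPE(real^'n) + L * sqrt t * gauss1 TYPE(real^'n))"
proof -
  note f(4)[measurable]
  let ?n = "CARD('n)" and ?c = "sqrt t"
  have c: "?c > 0" using t by simp
  have hm[measurable]: "(\<lambda>y. heat ?n t (qform (mat 1) (x - y))) \<in> borel_measurable borel"
    unfolding heat_def qform_mat1 by measurable
  \<comment> \<open>The Jacobian t^(n/2) cancels the power of t in the kernel.\<close>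
  have hs: "?c ^ ?n * heat ?n t (qform (mat 1) (x - (x + ?c *\<^sub>R z))) = exp (- (norm z)\<^sup>2 / 4)" for z :: "real^'n"
  proof -
    have "exp (- (real ?n / 2) * ln t) = exp (real ?n * (- ln ?c))" using t by (simp add: ln_sqrt)
    also have "\<dots> = (inverse ?c) ^ ?n" using c by (simp add: exp_of_nat_mult exp_minus power_inverse del: real_sqrt_inverse)
    finally have "?c ^ ?n * exp (- (real ?n / 2) * ln t) = 1" using c by (simp flip: power_mult_distrib)
    moreover have "qform (mat 1) (x - (x + ?c *\<^sub>R z)) / (4 * t) = (norm z)\<^sup>2 / 4"
      using t by (simp add: qform_mat1 power2_norm_eq_inner[symmetric] power_mult_distrib)
    moreover have "?c ^ ?n * heat ?n t s = (?c ^ ?n * exp (- (real ?n / 2) * ln t)) * exp (- (s / (4 * t)))" for s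
      by (simp only: heat_def diff_conv_add_uminus exp_add mult.assoc)
    ultimately show ?thesis by (simp only: mult_1_left minus_divide_left[symmetric])
  qed
  have "(\<integral>\<^sup>+y. ennreal (f y * heat ?n t (qform (mat 1) (x - y))) \<partial>lborel) =
     (\<integral>\<^sup>+z. ennreal (?c ^ ?n) * ennreal (f (x + ?c *\<^sub>R z) * heat ?n t (qform (mat 1) (x - (x + ?c *\<^sub>R z)))) \<partial>lborel)"
  proof -
    define F where "F = (\<lambda>y. ennreal (f y * heat ?n t (qform (mat 1) (x - y))))"
    have [measurable]: "F \<in> borel_measurable borel" unfolding F_def by measurable
    have "(\<integral>\<^sup>+y. F y \<partial>lborel) = ennreal (?c ^ DIM(real^'n)) * (\<integral>\<^sup>+z. F (x + ?c *\<^sub>R z) \<partial>lborel)"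
      by (rule nn_integral_lborel_affine[OF _ c]) measurable
    also have "\<dots> = (\<integral>\<^sup>+z. ennreal (?c ^ ?n) * F (x + ?c *\<^sub>R z) \<partial>lborel)"
      by (subst nn_integral_cmult) auto
    finally show ?thesis by (simp add: F_def)
  qed
  also have "\<dots> \<le> (\<integral>\<^sup>+z. ennreal (f x) * ennreal (exp (- (norm z)\<^sup>2 / 4)) +
      ennreal (L * ?c) * ennreal (norm z * exp (- (norm z)\<^sup>2 / 4)) \<partial>(lborel :: (real^'n) measure))"
  proof (rule nn_integral_mono)
    fix z :: "real^'n"
    have "ennreal (?c ^ ?n) * ennreal (f (x + ?c *\<^sub>R z) * heat ?n t (qform (mat 1) (x - (x + ?c *\<^sub>R z))))
      = ennreal (f (x + ?c *\<^sub>R z) * (?c ^ ?n * heat ?n t (qform (mat 1) (x - (x + ?c *\<^sub>R z)))))"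
      using c f(1) by (simp add: mult_ac flip: ennreal_mult')
    also have "\<dots> = ennreal (f (x + ?c *\<^sub>R z) * exp (- (norm z)\<^sup>2 / 4))" by (simp only: hs)
    also have "\<dots> \<le> ennreal ((f x + L * (?c * norm z)) * exp (- (norm z)\<^sup>2 / 4))"
      using f(2)[of "x + ?c *\<^sub>R z"] c by (intro ennreal_leI mult_right_mono) (auto simp: dist_norm)
    also have "\<dots> = ennreal (f x) * ennreal (exp (- (norm z)\<^sup>2 / 4)) +
      ennreal (L * ?c) * ennreal (norm z * exp (- (norm z)\<^sup>2 / 4))"
      using f(1)[of x] f(3) c by (simp add: distrib_right mult_ac flip: ennreal_mult' ennreal_plus)
    finally show "ennreal (?c ^ ?n) * ennreal (f (x + ?c *\<^sub>R z) * heat ?n t (qform (mat 1) (x - (x + ?c *\<^sub>R z)))) \<le>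
      ennreal (f x) * ennreal (exp (- (norm z)\<^sup>2 / 4)) + ennreal (L * ?c) * ennreal (norm z * exp (- (norm z)\<^sup>2 / 4))" .
  qed
  also have "\<dots> = ennreal (f x) * ennreal (gauss0 TYPE(real^'n)) + ennreal (L * ?c) * ennreal (gauss1 TYPE(real^'n))"
    by (subst nn_integral_add) (auto simp: nn_integral_cmult simp flip: ennreal_gauss0 ennreal_gauss1)
  also have "\<dots> = ennreal (f x * gauss0 TYPE(real^'n) + L * sqrt t * gauss1 TYPE(real^'n))"
    using f(1)[of x] f(3) c gauss0_pos[where 'a="real^'n"]
    by (simp add: gauss1_def flip: ennreal_mult' ennreal_plus)
  finally show ?thesis .
qed

lemma pred_cball [measurable]: "Measurable.pred borel (\<lambda>x. x \<in> cball a r)"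
  and pred_ball [measurable]: "Measurable.pred borel (\<lambda>x. x \<in> ball a r)"
  by (simp_all add: pred_def del: mem_ball mem_cball)

text \<open>Point masses at the centres of a \<delta>-cover replace the density: the part of E in
  the ball about z is collected at z, and the induction continues with the rest of E. Comparison
  functions then are finite sums of kernels, and no derivative has to be taken under an
  integral.\<close>

lemma discretize_density:
  fixes E :: "'a::euclidean_space set"
  assumes "finite Z" "E \<in> sets borel" "E \<subseteq> (\<Union>z\<in>Z. ball z \<delta>)" "\<And>y. f y \<ge> (0::real)"
    "f \<in> borel_measurable borel" "(\<integral>\<^sup>+y\<in>E. ennreal (f y) \<partial>lborel) < \<infinity>"
  shows "\<exists>m. (\<forall>z. m z \<ge> 0) \<and> ennreal (\<Sum>z\<in>Z. m z) = (\<integral>\<^sup>+y\<in>E. ennreal (f y) \<partial>lborel) \<and>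
     (\<forall>g h. h \<in> borel_measurable borel \<longrightarrow> (\<forall>z. g z \<ge> 0) \<longrightarrow>
       (\<forall>z\<in>Z. \<forall>y\<in>E. dist z y < \<delta> \<longrightarrow> g z \<le> h y) \<longrightarrow>
       ennreal (\<Sum>z\<in>Z. m z * g z) \<le> (\<integral>\<^sup>+y\<in>E. ennreal (f y * h y) \<partial>lborel))"
  using assms
proof (induction Z arbitrary: E rule: finite_induct)
  case empty
  then show ?case by auto
next
  case (insert z Z)
  note [measurable] = insert.prems(1,4)
  have f0: "f y \<ge> 0" for y using insert.prems(3) by simp
  let ?A = "E \<inter> ball z \<delta>" and ?B = "E - ball z \<delta>"
  have split: "(\<integral>\<^sup>+y\<in>E. k y \<partial>lborel) = (\<integral>\<^sup>+y\<in>?A. k y \<partial>lborel) + (\<integral>\<^sup>+y\<in>?B. k y \<partial>lborel)"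
    if [measurable]: "k \<in> borel_measurable borel" for k :: "'a \<Rightarrow> ennreal"
  proof -
    have "(\<integral>\<^sup>+y\<in>E. k y \<partial>lborel) = (\<integral>\<^sup>+y. k y * indicator ?A y + k y * indicator ?B y \<partial>lborel)"
      by (auto intro!: nn_integral_cong split: split_indicator)
    also have "\<dots> = (\<integral>\<^sup>+y\<in>?A. k y \<partial>lborel) + (\<integral>\<^sup>+y\<in>?B. k y \<partial>lborel)"
      by (rule nn_integral_add) measurable
    finally show ?thesis .
  qed
  have fs: "(\<integral>\<^sup>+y\<in>E. ennreal (f y) \<partial>lborel) = (\<integral>\<^sup>+y\<in>?A. ennreal (f y) \<partial>lborel) + (\<integral>\<^sup>+y\<in>?B. ennreal (f y) \<partial>lborel)"
    by (rule split) measurable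
  then have fin: "(\<integral>\<^sup>+y\<in>?A. ennreal (f y) \<partial>lborel) < \<infinity>" "(\<integral>\<^sup>+y\<in>?B. ennreal (f y) \<partial>lborel) < \<infinity>"
    using insert.prems(5) by (auto simp: less_top)
  have "?B \<in> sets borel" "?B \<subseteq> (\<Union>z\<in>Z. ball z \<delta>)" using insert.prems(1,2) by auto
  from insert.IH[OF this insert.prems(3,4) fin(2)] obtain m where
    m0: "\<forall>z. m z \<ge> 0" and m2: "ennreal (\<Sum>z\<in>Z. m z) = (\<integral>\<^sup>+y\<in>?B. ennreal (f y) \<partial>lborel)"
    and m3: "\<forall>g h. h \<in> borel_measurable borel \<longrightarrow> (\<forall>z. g z \<ge> 0) \<longrightarrow>
       (\<forall>z\<in>Z. \<forall>y\<in>?B. dist z y < \<delta> \<longrightarrow> g z \<le> h y) \<longrightarrow>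
       ennreal (\<Sum>z\<in>Z. m z * g z) \<le> (\<integral>\<^sup>+y\<in>?B. ennreal (f y * h y) \<partial>lborel)"
    by blast
  have m: "m z \<ge> 0" for z using m0 by simp
  define m0 where "m0 = enn2real (\<integral>\<^sup>+y\<in>?A. ennreal (f y) \<partial>lborel)"
  have m0: "ennreal m0 = (\<integral>\<^sup>+y\<in>?A. ennreal (f y) \<partial>lborel)" "m0 \<ge> 0" using fin(1) by (auto simp: m0_def)
  define m' where "m' = m(z := m0)"
  have eq: "(\<Sum>y\<in>insert z Z. m' y * g y) = m0 * g z + (\<Sum>y\<in>Z. m y * g y)" for g :: "'a \<Rightarrow> real"
    using insert.hyps by (auto simp: m'_def intro!: sum.cong)
  have eq1: "(\<Sum>y\<in>insert z Z. m' y) = m0 + (\<Sum>y\<in>Z. m y)" using eq[of "\<lambda>_. 1"] by simp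
  show ?case
  proof (intro exI[of _ m'] conjI allI impI)
    show "m' y \<ge> 0" for y using m m0 by (simp add: m'_def)
    show "ennreal (\<Sum>z\<in>insert z Z. m' z) = (\<integral>\<^sup>+y\<in>E. ennreal (f y) \<partial>lborel)"
      unfolding eq1 fs using m m0 m2 by (simp add: sum_nonneg)
    fix g h :: "'a \<Rightarrow> real" assume [measurable]: "h \<in> borel_measurable borel" and g: "\<forall>z. g z \<ge> 0"
      and le: "\<forall>z\<in>insert z Z. \<forall>y\<in>E. dist z y < \<delta> \<longrightarrow> g z \<le> h y"
    have "ennreal (m0 * g z) = (\<integral>\<^sup>+y\<in>?A. ennreal (f y) \<partial>lborel) * ennreal (g z)"
      using m0 g by (simp add: ennreal_mult)
    also have "\<dots> = (\<integral>\<^sup>+y. ennreal (f y) * indicator ?A y * ennreal (g z) \<partial>lborel)"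
      by (rule nn_integral_multc[symmetric]) measurable
    also have "\<dots> \<le> (\<integral>\<^sup>+y\<in>?A. ennreal (f y * h y) \<partial>lborel)"
      using le g f0
      by (intro nn_integral_mono) (auto split: split_indicator intro!: ennreal_leI mult_left_mono simp flip: ennreal_mult)
    finally have 1: "ennreal (m0 * g z) \<le> (\<integral>\<^sup>+y\<in>?A. ennreal (f y * h y) \<partial>lborel)" .
    have 2: "ennreal (\<Sum>z\<in>Z. m z * g z) \<le> (\<integral>\<^sup>+y\<in>?B. ennreal (f y * h y) \<partial>lborel)"
      using m3 le g by simp
    have "ennreal (\<Sum>z\<in>insert z Z. m' z * g z) = ennreal (m0 * g z) + ennreal (\<Sum>z\<in>Z. m z * g z)"
      unfolding eq using m0 g m by (intro ennreal_plus) (auto intro!: sum_nonneg)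
    also have "\<dots> \<le> (\<integral>\<^sup>+y\<in>?A. ennreal (f y * h y) \<partial>lborel) + (\<integral>\<^sup>+y\<in>?B. ennreal (f y * h y) \<partial>lborel)"
      using 1 2 by (rule add_mono)
    also have "\<dots> = (\<integral>\<^sup>+y\<in>E. ennreal (f y * h y) \<partial>lborel)"
      by (rule split[symmetric]) measurable
    finally show "ennreal (\<Sum>z\<in>insert z Z. m' z * g z) \<le> (\<integral>\<^sup>+y\<in>E. ennreal (f y * h y) \<partial>lborel)" .
  qed
qed

section \<open>A weak Harnack inequality\<close>

text \<open>The caloric function built from point masses is compared with the stationary
  supersolution \<open>c - u\<close>; subtracting \<open>\<kappa>\<close> makes it nonpositive on the lateral boundary.\<close>
lemma heat_comparison:
  fixes x0 :: "real^'n"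
  assumes u: "G_psh GG \<Omega> u" and tr: "\<And>H. H \<in> Fcone GG \<Longrightarrow> trace H \<ge> 0"
    and S: "cball x0 \<rho> \<subseteq> \<Omega>" "\<rho> > 0" and uc: "\<And>x. x \<in> cball x0 \<rho> \<Longrightarrow> u x \<le> ereal c"
    and Z: "finite Z" "\<And>z. m z \<ge> 0" and t: "0 < \<tau>" "\<tau> < T" and \<eta>: "\<eta> \<ge> 0"
    and init: "\<And>x. x \<in> cball x0 \<rho> \<Longrightarrow>
      u x + ereal (\<Sum>z\<in>Z. m z * heat CARD('n) \<tau> (qform (mat 1) (x - z))) \<le> ereal (c + \<eta>)"
    and \<kappa>: "\<kappa> \<ge> 0" and lateral: "\<And>x z t. dist x0 x = \<rho> \<Longrightarrow> z \<in> Z \<Longrightarrow> \<tau> \<le> t \<Longrightarrow> t \<le> T \<Longrightarrow>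
      heat CARD('n) t (qform (mat 1) (x - z)) \<le> \<kappa>"
  shows "u x0 + ereal (\<Sum>z\<in>Z. m z * (heat CARD('n) T (qform (mat 1) (x0 - z)) - \<kappa>)) \<le> ereal (c + \<eta>)"
proof (cases "u x0 = -\<infinity>")
  case False
  define h where "h t x z = heat CARD('n) t (qform (mat 1) (x - z))" for t and x z :: "real^'n"
  let ?B = "cball x0 \<rho>"
  have fin: "u x \<noteq> \<infinity>" if "x \<in> ?B" for x using uc[OF that] by auto
  then obtain a where a: "u x0 = ereal a" using False S(2) by (cases "u x0") auto
  \<comment> \<open>The term -\<epsilon>(t - \<tau>) makes the time derivative of g equal to its
    Laplacian minus \<epsilon>; afterwards \<epsilon> tends to 0.\<close>
  have strict: "u x0 + ereal ((\<Sum>z\<in>Z. m z * (h T x0 z - \<kappa>)) - \<epsilon> * (T - \<tau>)) \<le> ereal (c + \<eta>)" if \<epsilon>: "\<epsilon> > 0" for \<epsilon>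
  proof -
    define g where "g = (\<lambda>(t, x). (\<Sum>z\<in>Z. m z * (h t x z - \<kappa>)) - \<epsilon> * (t - \<tau>))"
    define Q where "Q = {\<tau>..T} \<times> ?B"
    have Q: "compact Q" by (simp add: Q_def compact_Times)
    have "usc_on ?B u" using u S(1) usc_on_subset by (auto simp: G_psh_def)
    then have "openin (top_of_set ?B) {x \<in> ?B. u x < d}" for d by (simp add: usc_on_openin)
    then have "openin (top_of_set Q) (Q \<inter> snd -` {x \<in> ?B. u x < d})" for d
      by (rule continuous_openin_preimage[rotated 2]) (auto simp: Q_def intro!: continuous_intros)
    moreover have "Q \<inter> snd -` {x \<in> ?B. u x < d} = {q \<in> Q. u (snd q) < d}" for d by (auto simp: Q_def)
    ultimately have "usc_on Q (\<lambda>q. u (snd q))" by (simp add: usc_on_openin)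
    moreover have "continuous_on Q g"
      unfolding g_def h_def heat_def Q_def case_prod_beta using t(1) by (intro continuous_intros) auto
    ultimately have "usc_on Q (\<lambda>q. u (snd q) + ereal (g q))"
      using fin by (intro usc_on_add_continuous) (auto simp: Q_def)
    moreover have "(\<tau>, x0) \<in> Q" using t S(2) by (auto simp: Q_def)
    ultimately obtain q where q: "q \<in> Q" "\<forall>q'\<in>Q. u (snd q') + ereal (g q') \<le> u (snd q) + ereal (g q)"
      using usc_on_attains_max[OF Q] by blast
    obtain s x where sx: "q = (s, x)" "\<tau> \<le> s" "s \<le> T" "x \<in> ?B" using q(1) by (cases q) (auto simp: Q_def)
    have max: "u y + ereal (g (t, y)) \<le> u x + ereal (g (s, x))" if "\<tau> \<le> t" "t \<le> T" "y \<in> ?B" for t y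
      using q(2)[rule_format, of "(t, y)"] that sx(1) by (simp add: Q_def)
    have "u x + ereal (g (s, x)) \<le> ereal (c + \<eta>)"
    proof (cases "u x = -\<infinity>")
      case ux: False
      then obtain b where b: "u x = ereal b" using fin[OF sx(4)] by (cases "u x") auto
      have gle: "g (s, x) \<le> (\<Sum>z\<in>Z. m z * (h s x z - \<kappa>))" using \<epsilon> sx(2) by (simp add: g_def)
      \<comment> \<open>Lateral boundary, initial time, and all other points; the final time T
        inside the ball belongs to the third case.\<close>
      consider "dist x0 x = \<rho>" | "s = \<tau>" | "dist x0 x < \<rho>" "\<tau> < s" using sx by force
      then show ?thesis
      proof cases
        case 1
        have "(\<Sum>z\<in>Z. m z * (h s x z - \<kappa>)) \<le> 0"
          using lateral[OF 1 _ sx(2,3)] Z by (intro sum_nonpos mult_nonneg_nonpos) (auto simp: h_def)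
        then show ?thesis using gle uc[OF sx(4)] b \<eta> by simp
      next
        case 2
        have "(\<Sum>z\<in>Z. m z * (h s x z - \<kappa>)) \<le> (\<Sum>z\<in>Z. m z * h \<tau> x z)"
          using Z \<kappa> 2 by (intro sum_mono mult_left_mono) auto
        then show ?thesis using gle init[OF sx(4)] b by (simp add: h_def)
      next
        case 3
        have s0: "s > 0" using 3 t by simp
        define lap where "lap z = (qform (mat 1) (x - z) / (4 * s\<^sup>2) - real CARD('n) / (2 * s)) * h s x z" for z
        define D where "D = (\<Sum>z\<in>Z. m z * lap z)"
        have "((\<lambda>t. g (t, x)) has_real_derivative (\<Sum>z\<in>Z. m z * (lap z - 0)) - \<epsilon> * (1 - 0)) (at s)"
          unfolding g_def case_prod_conv h_def lap_def
          by (intro derivative_intros DERIV_sum DERIV_cmult DERIV_diff DERIV_ident heat_deriv_time s0 DERIV_const)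
        then have dt: "((\<lambda>t. g (t, x)) has_real_derivative D - \<epsilon>) (at s)" by (simp add: D_def)
        obtain Hz where Hz: "\<And>z. C2_with_hessian (\<lambda>y. h s y z) x (Hz z)" "\<And>z. trace (Hz z) = lap z"
        proof -
          have "\<exists>H. C2_with_hessian (\<lambda>y. h s y z) x H \<and> trace H = lap z" for z
            unfolding h_def
            by (rule exI, rule conjI[OF C2_heat[OF s0]])
               (simp only: trace_add trace_scaleR trace_rank1 trace_I matrix_vector_mul_lid,
                simp add: lap_def h_def qform_mat1 power2_eq_square field_simps)
          then show ?thesis using that by metis
        qed
        define H where "H = (\<Sum>z\<in>Z. m z *\<^sub>R Hz z)"
        have "trace (\<Sum>z\<in>Z. m z *\<^sub>R Hz z) = (\<Sum>z\<in>Z. m z * lap z)"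
          using Z(1) by (induction Z rule: finite_induct) (auto simp: trace_add trace_scaleR Hz trace_def[of 0])
        then have trH: "trace H = D" by (simp add: H_def D_def)
        have "C2_with_hessian (\<lambda>y. (\<Sum>z\<in>Z. m z * h s y z) + (- (\<Sum>z\<in>Z. m z * \<kappa>) - \<epsilon> * (s - \<tau>))) x (H + 0)"
          unfolding H_def using Z(1) Hz(1) by (intro C2_add C2_sum C2_cmult C2_const) auto
        moreover have "(\<lambda>y. (\<Sum>z\<in>Z. m z * h s y z) + (- (\<Sum>z\<in>Z. m z * \<kappa>) - \<epsilon> * (s - \<tau>))) = (\<lambda>y. g (s, y))"
          by (auto simp: g_def right_diff_distrib sum_subtractf fun_eq_iff)
        ultimately have c2: "C2_with_hessian (\<lambda>y. g (s, y)) x H" by simp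
        \<comment> \<open>At the fixed time s the maximum in space makes a constant minus g a test
          function for u. Hence the Laplacian D of g is at most 0.\<close>
        have "- H \<in> Fcone GG"
          by (rule G_psh_touch[OF u _ S(1) ux max c2]) (use 3 sx in auto)
        then have "trace ((-1) *\<^sub>R H) \<ge> 0" using tr by fastforce
        then have "D \<le> 0" unfolding trace_scaleR trH by simp
        then have "D - \<epsilon> < 0" using \<epsilon> by simp
        from DERIV_neg_dec_left[OF dt this]
        obtain d where d: "d > 0" "\<And>k. k > 0 \<Longrightarrow> k < d \<Longrightarrow> g (s, x) < g (s - k, x)" by blast
        \<comment> \<open>A step back in time increases g, while u does not depend on time: this
          contradicts maximality. Only earlier times are used, so s = T is covered.\<close>
        define k where "k = min (d / 2) (s - \<tau>)"
        have "k > 0" "k < d" "k \<le> s - \<tau>" using d(1) 3 by (auto simp: k_def)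
        then have "g (s, x) < g (s - k, x)" "g (s - k, x) \<le> g (s, x)"
          using d(2)[of k] max[of "s - k" x] sx(3,4) b by auto
        then show ?thesis by simp
      qed
    qed simp
    then have "u x0 + ereal (g (T, x0)) \<le> ereal (c + \<eta>)" using max[of T x0] t S(2) by (auto intro: order_trans)
    then show ?thesis by (simp add: g_def)
  qed
  have "a + (\<Sum>z\<in>Z. m z * (h T x0 z - \<kappa>)) \<le> (c + \<eta>) + e" if "e > 0" for e
    using strict[of "e / (T - \<tau>)"] a that t by simp
  then have "a + (\<Sum>z\<in>Z. m z * (h T x0 z - \<kappa>)) \<le> c + \<eta>" by (rule field_le_epsilon)
  then show ?thesis using a by (simp add: h_def)
qed simp

text \<open>The product of the kernel mass, of 9/(4n), the inverse of the relative kernel gain 4n/9,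
  and of 1/(\<kappa> \<rho>^n), where \<kappa> is the kernel at time 9\<rho>^2/(32n) and distance
  3\<rho>/4.\<close>

definition harnack_const :: "'n::finite itself \<Rightarrow> real" where
  "harnack_const _ = gauss0 TYPE(real^'n) * (9 / (4 * real CARD('n))) *
     exp (real CARD('n) / 2 * (ln (9 / (32 * real CARD('n))) + 1))"

lemma harnack_const_pos: "harnack_const TYPE('n::finite) > 0"
  using gauss0_pos[where 'a="real^'n"] by (simp add: harnack_const_def)

text \<open>Release f on the quarter ball as heat. By the Lipschitz bound the initial temperature is
  at most f, hence at most c - u, up to a small error. Comparison keeps the temperature, less the
  lateral bound \<kappa>, below c - u, and at time T the centre has received a fixed multiple of the
  total mass.\<close>

lemma weak_harnack_lipschitz:
  fixes x0 :: "real^'n"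
  assumes u: "G_psh GG \<Omega> u" and tr: "\<And>H. H \<in> Fcone GG \<Longrightarrow> trace H \<ge> 0"
    and S: "cball x0 \<rho> \<subseteq> \<Omega>" "\<rho> > 0"
    and f: "\<And>x. f x \<ge> 0" "\<And>x y. f y \<le> f x + L * dist x y" "L \<ge> 0" "f \<in> borel_measurable borel"
    and fu: "\<And>x. x \<in> cball x0 \<rho> \<Longrightarrow> u x + ereal (f x) \<le> ereal c" and a: "u x0 = ereal a"
  shows "(\<integral>\<^sup>+y\<in>cball x0 (\<rho>/4). ennreal (f y) \<partial>lborel) \<le> ennreal (harnack_const TYPE('n) * \<rho> ^ CARD('n) * (c - a))"
proof -
  note f(4)[measurable]
  let ?n = "CARD('n)" and ?G = "gauss0 TYPE(real^'n)" and ?D = "cball x0 (\<rho>/4)"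
  \<comment> \<open>L0 = 3\<rho>/4 is the distance from the quarter ball to the sphere of radius
    \<rho>, and T = L0^2/(2n) is the peak time of the kernel at this distance. So \<kappa> bounds
    the kernel on the lateral boundary up to time T.\<close>
  define T where "T = 9 * \<rho>\<^sup>2 / (32 * real ?n)"
  define L0 where "L0 = 3 * \<rho> / 4"
  define \<kappa> where "\<kappa> = heat ?n T (L0\<^sup>2)"
  have n: "real ?n > 0" by simp
  have T: "T > 0" "2 * real ?n * T = L0\<^sup>2" using S(2) by (auto simp: T_def L0_def power2_eq_square field_simps)
  have \<kappa>: "\<kappa> > 0" by (simp add: \<kappa>_def heat_pos)
  have G: "?G > 0" by (rule gauss0_pos)
  have "(\<integral>\<^sup>+y\<in>?D. ennreal (f y) \<partial>lborel) \<le> (\<integral>\<^sup>+y\<in>?D. ennreal (f x0 + L * \<rho>) \<partial>lborel)"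
  proof (intro nn_integral_mono)
    fix y show "ennreal (f y) * indicator ?D y \<le> ennreal (f x0 + L * \<rho>) * indicator ?D y"
      using f(2)[of y x0] f(3) S(2) mult_left_mono[of "dist x0 y" \<rho> L]
      by (auto split: split_indicator intro!: ennreal_leI)
  qed
  also have "\<dots> < \<infinity>"
    using emeasure_lborel_cball_finite[of x0 "\<rho>/4"]
    by (subst nn_integral_cmult_indicator) (auto simp: ennreal_mult_less_top)
  finally have Ifin: "(\<integral>\<^sup>+y\<in>?D. ennreal (f y) \<partial>lborel) < \<infinity>" .
  define I where "I = enn2real (\<integral>\<^sup>+y\<in>?D. ennreal (f y) \<partial>lborel)"
  have I: "ennreal I = (\<integral>\<^sup>+y\<in>?D. ennreal (f y) \<partial>lborel)" "I \<ge> 0" using Ifin by (auto simp: I_def)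
  \<comment> \<open>Squared distances are at most \<rho>^2/16 here, against 9\<rho>^2/16 for L0, so
    the exponents differ by at least (\<rho>^2/2)/(4T) = 4n/9.\<close>
  have heatT: "heat ?n T (qform (mat 1) (x0 - z)) - \<kappa> \<ge> \<kappa> * (4 * real ?n / 9)" if "z \<in> ?D" for z
  proof -
    let ?s = "qform (mat 1) (x0 - z)"
    have "(norm (x0 - z))\<^sup>2 \<le> (\<rho>/4)\<^sup>2" using that by (intro power_mono) (auto simp: dist_norm)
    then have s: "?s \<le> \<rho>\<^sup>2 / 16" by (simp add: qform_mat1 power2_norm_eq_inner power_divide)
    have "4 * real ?n / 9 = (\<rho>\<^sup>2 / 2) / (4 * T)" using S(2) by (simp add: T_def field_simps)
    also have "\<dots> \<le> (L0\<^sup>2 - ?s) / (4 * T)"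
      using s T(1) by (intro divide_right_mono) (auto simp: L0_def power2_eq_square)
    also have "1 + \<dots> \<le> exp ((L0\<^sup>2 - ?s) / (4 * T))" by (rule exp_ge_add_one_self)
    finally have "\<kappa> * (1 + 4 * real ?n / 9) \<le> \<kappa> * exp ((L0\<^sup>2 - ?s) / (4 * T))"
      using \<kappa> by (intro mult_left_mono) auto
    also have "\<dots> = heat ?n T ?s"
      unfolding \<kappa>_def heat_def exp_add[symmetric] by (simp add: diff_divide_distrib)
    finally show ?thesis by (simp add: algebra_simps)
  qed
  have main: "a + I / ?G * (\<kappa> * (4 * real ?n / 9)) \<le> c + \<eta>" if \<eta>: "\<eta> > 0" for \<eta>
  proof -
    obtain \<tau> where \<tau>: "0 < \<tau>" "\<tau> < T" "L * sqrt \<tau> * gauss1 TYPE(real^'n) \<le> ?G * \<eta> / 2"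
    proof -
      have "((\<lambda>t. L * sqrt t * gauss1 TYPE(real^'n)) \<longlongrightarrow> L * sqrt 0 * gauss1 TYPE(real^'n)) (at_right 0)"
        by (intro tendsto_intros)
      then have "\<forall>\<^sub>F t in at_right 0. L * sqrt t * gauss1 TYPE(real^'n) < ?G * \<eta> / 2"
        using G \<eta> by (intro order_tendstoD) auto
      moreover have "\<forall>\<^sub>F t in at_right 0. 0 < t \<and> t < T"
        using T(1) by (simp add: eventually_at_right_less eventually_conj_iff eventually_at_right_real eventually_at_right)
           blast
      ultimately have "\<forall>\<^sub>F t in at_right 0. 0 < t \<and> t < T \<and> L * sqrt t * gauss1 TYPE(real^'n) \<le> ?G * \<eta> / 2"
        by eventually_elim auto
      then show ?thesis using that eventually_happens'[OF trivial_limit_at_right_real] by blast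
    qed
    \<comment> \<open>Half of the error \<eta> goes to the Lipschitz term through \<tau>, half to
      the discretisation through \<omega>. The 1 in I + 1 covers I = 0.\<close>
    define \<omega> where "\<omega> = ?G * \<eta> / (2 * (I + 1))"
    have \<omega>: "\<omega> > 0" "\<omega> * I \<le> ?G * \<eta> / 2" using G \<eta> I(2) by (auto simp: \<omega>_def field_simps)
    define k where "k w = heat ?n \<tau> (qform (mat 1) w)" for w :: "real^'n"
    have k0: "k w \<ge> 0" for w using heat_pos[of ?n \<tau>] by (simp add: k_def less_imp_le)
    have kc: "continuous_on UNIV k" unfolding k_def heat_def using \<tau>(1) by (intro continuous_intros) auto
    have [measurable]: "k \<in> borel_measurable borel" using kc by (rule borel_measurable_continuous_onI)
    have "uniformly_continuous_on (cball 0 (2*\<rho>)) k"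
      using kc by (intro compact_uniformly_continuous) (auto elim: continuous_on_subset)
    then obtain \<delta> where \<delta>: "\<delta> > 0" "\<And>v w. v \<in> cball 0 (2*\<rho>) \<Longrightarrow> w \<in> cball 0 (2*\<rho>) \<Longrightarrow> dist v w < \<delta> \<Longrightarrow> dist (k v) (k w) < \<omega>"
      using \<omega>(1) unfolding uniformly_continuous_on_def by metis
    have "?D \<subseteq> (\<Union>z\<in>?D. ball z \<delta>)" using \<delta>(1) by auto
    then obtain Z where Z: "Z \<subseteq> ?D" "finite Z" "?D \<subseteq> (\<Union>z\<in>Z. ball z \<delta>)"
      using compactE_image[of ?D ?D "\<lambda>z. ball z \<delta>"] by auto
    obtain m where m: "\<forall>z. m z \<ge> 0" "ennreal (\<Sum>z\<in>Z. m z) = ennreal I"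
      "\<forall>g h. h \<in> borel_measurable borel \<longrightarrow> (\<forall>z. g z \<ge> 0) \<longrightarrow>
       (\<forall>z\<in>Z. \<forall>y\<in>?D. dist z y < \<delta> \<longrightarrow> g z \<le> h y) \<longrightarrow>
       ennreal (\<Sum>z\<in>Z. m z * g z) \<le> (\<integral>\<^sup>+y\<in>?D. ennreal (f y * h y) \<partial>lborel)"
      using discretize_density[OF Z(2) _ Z(3) f(1) f(4) Ifin] unfolding I(1) by auto
    have mI: "(\<Sum>z\<in>Z. m z) = I" using m(1,2) I(2) by (simp add: sum_nonneg)
    have init: "(\<Sum>z\<in>Z. m z * k (x - z)) \<le> ?G * (f x + \<eta>)" if x: "x \<in> cball x0 \<rho>" for x
    proof -
      have "ennreal (\<Sum>z\<in>Z. m z * k (x - z)) \<le> (\<integral>\<^sup>+y\<in>?D. ennreal (f y * (k (x - y) + \<omega>)) \<partial>lborel)"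
      proof (rule m(3)[rule_format])
        fix z y assume zy: "z \<in> Z" "y \<in> ?D" "dist z y < \<delta>"
        have "dist x z \<le> dist x0 x + dist x0 z" "dist x y \<le> dist x0 x + dist x0 y" by (metis dist_commute dist_triangle)+
        then have "x - z \<in> cball 0 (2*\<rho>)" "x - y \<in> cball 0 (2*\<rho>)"
          using zy x Z(1) S(2) by (auto simp: dist_norm[symmetric] subset_eq)
        moreover have "dist (x - z) (x - y) < \<delta>" using zy(3) by (simp add: dist_norm norm_minus_commute)
        ultimately show "k (x - z) \<le> k (x - y) + \<omega>" using \<delta>(2)[of "x - z" "x - y"] by (simp add: dist_real_def)
      qed (use k0 in auto)
      also have "\<dots> \<le> (\<integral>\<^sup>+y. ennreal (f y * k (x - y)) + ennreal \<omega> * (ennreal (f y) * indicator ?D y) \<partial>lborel)"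
        using f(1) k0 \<omega>(1)
        by (intro nn_integral_mono) (auto split: split_indicator simp: distrib_left mult_ac simp flip: ennreal_mult ennreal_plus)
      also have "\<dots> = (\<integral>\<^sup>+y. ennreal (f y * k (x - y)) \<partial>lborel) + ennreal \<omega> * ennreal I"
      proof -
        have [measurable]: "(\<lambda>y. ennreal (f y) * indicator ?D y) \<in> borel_measurable borel" by measurable
        show ?thesis unfolding I(1) by (subst nn_integral_add) (simp_all add: nn_integral_cmult)
      qed
      also have "\<dots> \<le> ennreal (f x * ?G + L * sqrt \<tau> * gauss1 TYPE(real^'n)) + ennreal \<omega> * ennreal I"
        unfolding k_def by (intro add_right_mono nn_integral_heat f \<tau>(1))
      also have "\<dots> = ennreal (f x * ?G + L * sqrt \<tau> * gauss1 TYPE(real^'n) + \<omega> * I)"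
        using f(1)[of x] f(3) \<tau>(1) G \<omega>(1) I(2)
        by (simp add: gauss1_def flip: ennreal_mult' ennreal_plus)
      finally have "(\<Sum>z\<in>Z. m z * k (x - z)) \<le> f x * ?G + L * sqrt \<tau> * gauss1 TYPE(real^'n) + \<omega> * I"
        using f(1)[of x] f(3) \<tau>(1) G \<omega>(1) I(2) by (subst (asm) ennreal_le_iff) (auto simp: gauss1_def)
      also have "\<dots> \<le> ?G * (f x + \<eta>)" using \<tau>(3) \<omega>(2) by (simp add: algebra_simps)
      finally show ?thesis .
    qed
    \<comment> \<open>Dividing the masses by \<open>gauss0\<close> normalises the kernel.\<close>
    have "u x0 + ereal (\<Sum>z\<in>Z. (m z / ?G) * (heat ?n T (qform (mat 1) (x0 - z)) - \<kappa>)) \<le> ereal (c + \<eta>)"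
    proof (rule heat_comparison[OF u tr S _ Z(2) _ \<tau>(1,2)])
      fix x assume x: "x \<in> cball x0 \<rho>"
      show "u x \<le> ereal c" using fu[OF x] f(1)[of x] by (cases "u x") auto
      have "(\<Sum>z\<in>Z. (m z / ?G) * heat ?n \<tau> (qform (mat 1) (x - z))) = (\<Sum>z\<in>Z. m z * k (x - z)) / ?G"
        by (simp add: k_def sum_divide_distrib)
      also have "\<dots> \<le> f x + \<eta>" using init[OF x] G by (simp add: pos_divide_le_eq mult.commute)
      finally show "u x + ereal (\<Sum>z\<in>Z. (m z / ?G) * heat ?n \<tau> (qform (mat 1) (x - z))) \<le> ereal (c + \<eta>)"
        using fu[OF x] by (cases "u x") auto
    next
      fix x z t assume A: "dist x0 x = \<rho>" "z \<in> Z" "\<tau> \<le> t" "t \<le> T"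
      have "dist x0 z \<le> \<rho>/4" using A(2) Z(1) by auto
      then have "L0 \<le> dist x z" using dist_triangle[of x0 x z] A(1) by (simp add: L0_def dist_commute)
      then have "L0\<^sup>2 \<le> (norm (x - z))\<^sup>2" using S(2) by (intro power_mono) (auto simp: L0_def dist_norm)
      then show "heat ?n t (qform (mat 1) (x - z)) \<le> \<kappa>"
        unfolding \<kappa>_def using A \<tau>(1) T(2)
        by (intro heat_mono_time) (auto simp: qform_mat1 power2_norm_eq_inner)
    qed (use \<kappa> \<eta> G m(1) in auto)
    moreover have "I / ?G * (\<kappa> * (4 * real ?n / 9)) \<le> (\<Sum>z\<in>Z. (m z / ?G) * (heat ?n T (qform (mat 1) (x0 - z)) - \<kappa>))"
    proof -
      have "I / ?G * (\<kappa> * (4 * real ?n / 9)) = (\<Sum>z\<in>Z. (m z / ?G) * (\<kappa> * (4 * real ?n / 9)))"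
        by (simp only: mI[symmetric] sum_divide_distrib sum_distrib_right)
      also have "\<dots> \<le> (\<Sum>z\<in>Z. (m z / ?G) * (heat ?n T (qform (mat 1) (x0 - z)) - \<kappa>))"
        using heatT Z(1) m(1) G by (intro sum_mono mult_left_mono) auto
      finally show ?thesis .
    qed
    ultimately show ?thesis using a by simp
  qed
  have "a + I / ?G * (\<kappa> * (4 * real ?n / 9)) \<le> c" by (rule field_le_epsilon) (use main in auto)
  then have "I \<le> ?G * (9 / (4 * real ?n)) * (1 / \<kappa>) * (c - a)" using G \<kappa> by (simp add: field_simps)
  also have "1 / \<kappa> = exp (real ?n / 2 * (ln (9 / (32 * real ?n)) + 1)) * \<rho> ^ ?n"
  proof -
    have "ln T = ln (9 / (32 * real ?n)) + 2 * ln \<rho>"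
      using S(2) n by (simp add: T_def ln_mult ln_div ln_realpow)
    moreover have "L0\<^sup>2 / (4 * T) = real ?n / 2" using S(2) n by (simp add: T_def L0_def power2_eq_square field_simps)
    ultimately have "1 / \<kappa> = exp (real ?n / 2 * (ln (9 / (32 * real ?n)) + 1) + real ?n * ln \<rho>)"
      by (simp add: \<kappa>_def heat_def exp_minus[symmetric] inverse_eq_divide[symmetric] algebra_simps)
    also have "\<dots> = exp (real ?n / 2 * (ln (9 / (32 * real ?n)) + 1)) * \<rho> ^ ?n"
      using S(2) by (simp add: exp_add exp_of_nat_mult)
    finally show ?thesis .
  qed
  finally have "I \<le> harnack_const TYPE('n) * \<rho> ^ ?n * (c - a)" by (simp add: harnack_const_def mult_ac)
  then show ?thesis unfolding I(1)[symmetric] by (rule ennreal_leI)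
qed

text \<open>The function c - u is lower semicontinuous, so the inf-convolutions f k of its
  truncations at k approach it from below. They are k-Lipschitz, and Fatou's lemma carries the bound
  to the limit.\<close>

theorem weak_harnack:
  fixes x0 :: "real^'n"
  assumes u: "G_psh GG \<Omega> u" and tr: "\<And>H. H \<in> Fcone GG \<Longrightarrow> trace H \<ge> 0"
    and S: "cball x0 \<rho> \<subseteq> \<Omega>" "\<rho> > 0"
    and uc: "\<And>x. x \<in> cball x0 \<rho> \<Longrightarrow> u x \<le> ereal c" and a: "u x0 = ereal a"
  shows "(\<integral>\<^sup>+y\<in>cball x0 (\<rho>/4). e2ennreal (ereal c - u y) \<partial>lborel)
    \<le> ennreal (harnack_const TYPE('n) * \<rho> ^ CARD('n) * (c - a))"
proof -
  let ?B = "cball x0 \<rho>" and ?D = "cball x0 (\<rho>/4)"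
  \<comment> \<open>Truncation at k keeps the value real where u is -infinity.\<close>
  define v where "v k y = real_of_ereal (min (ereal c - u y) (ereal (real k)))" for k :: nat and y
  define f where "f k x = (INF y\<in>?B. v k y + real k * dist x y)" for k x
  have cu: "ereal c - u y \<ge> 0" if "y \<in> ?B" for y using uc[OF that] by (cases "u y") auto
  have v: "ereal (v k y) = min (ereal c - u y) (ereal (real k))" "v k y \<ge> 0" if "y \<in> ?B" for k y
    using cu[OF that] by (cases "ereal c - u y"; simp add: v_def min_def)+
  have B: "x0 \<in> ?B" using S(2) by simp
  have bdd: "bdd_below ((\<lambda>y. v k y + real k * dist x y) ` ?B)" for k x
    using v(2) by (intro bdd_belowI2[of _ 0]) auto
  have f0: "f k x \<ge> 0" for k x unfolding f_def using B v(2) by (intro cINF_greatest) auto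
  have fle: "f k x \<le> v k y + real k * dist x y" if "y \<in> ?B" for k x y
    unfolding f_def by (rule cINF_lower[OF bdd that])
  have flip: "f k y \<le> f k x + real k * dist x y" for k x y
  proof -
    have "f k y - real k * dist x y \<le> f k x"
      unfolding f_def[of k x]
    proof (rule cINF_greatest)
      fix w assume "w \<in> ?B"
      from fle[OF this, of k y] have "f k y \<le> v k w + real k * dist y w" .
      also have "\<dots> \<le> v k w + real k * (dist x y + dist x w)"
        using dist_triangle[of y w x] by (intro add_left_mono mult_left_mono) (auto simp: dist_commute)
      finally show "f k y - real k * dist x y \<le> v k w + real k * dist x w" by (simp add: algebra_simps)
    qed (use B in auto)
    then show ?thesis by simp
  qed
  have fc: "f k \<in> borel_measurable borel" for k
  proof (rule borel_measurable_continuous_onI)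
    show "continuous_on UNIV (f k)"
    proof (rule lipschitz_on_continuous_on[of "real k"], rule lipschitz_onI)
      fix x y show "dist (f k x) (f k y) \<le> real k * dist x y"
        using flip[of k x y] flip[of k y x] by (auto simp: dist_real_def dist_commute abs_le_iff)
    qed simp
  qed
  have fu: "u x + ereal (f k x) \<le> ereal c" if "x \<in> ?B" for k x
  proof -
    have "ereal (f k x) \<le> ereal (v k x)" using fle[OF that, of k x] by simp
    also have "\<dots> \<le> ereal c - u x" using v(1)[OF that] by simp
    finally show ?thesis by (cases "u x") auto
  qed
  \<comment> \<open>Within \<delta> of x the truncated function is at least r'; farther away the
    penalty k |x - y| is, once k \<delta> >= r'.\<close>
  have lim: "e2ennreal (ereal c - u x) \<le> liminf (\<lambda>k. ennreal (f k x))" if x: "x \<in> ?B" for x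
  proof (rule le_Liminf_iff[THEN iffD2], safe)
    fix d assume d: "d < e2ennreal (ereal c - u x)"
    then obtain r where r: "d = ennreal r" "r \<ge> 0" by (cases d) auto
    have "ereal r < ereal c - u x"
      using d r cu[OF x] by (metis e2ennreal_ereal e2ennreal_mono not_le)
    then obtain r' where r': "r < r'" "ereal r' < ereal c - u x" using ereal_dense2 by (metis ereal_less(2) less_ereal.simps(1))
    then have "u x < ereal (c - r')" by (cases "u x") auto
    moreover have "usc_on ?B u" using u S(1) usc_on_subset by (auto simp: G_psh_def)
    ultimately have "\<forall>\<^sub>F y in at x within ?B. u y < ereal (c - r')" using usc_onD x by blast
    then obtain \<delta> where \<delta>: "\<delta> > 0" "\<And>y. y \<in> ?B \<Longrightarrow> dist y x < \<delta> \<Longrightarrow> u y < ereal (c - r')"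
      using \<open>u x < ereal (c - r')\<close> unfolding eventually_at by (metis dist_self)
    obtain k0 :: nat where k0: "real k0 \<ge> r' / \<delta>" "real k0 \<ge> r'"
      using real_arch_simple[of "max (r'/\<delta>) r'"] by auto
    have "d < ennreal (f k x)" if k: "k \<ge> k0" for k
    proof -
      have kk: "real k \<ge> r' / \<delta>" "real k \<ge> r'" using k0 k by (auto intro: order_trans)
      have "r' \<le> f k x" unfolding f_def
      proof (rule cINF_greatest)
        fix y assume y: "y \<in> ?B"
        show "r' \<le> v k y + real k * dist x y"
        proof (cases "dist y x < \<delta>")
          case True
          have "ereal r' \<le> ereal c - u y" using \<delta>(2)[OF y True] by (cases "u y") auto
          then have "ereal r' \<le> ereal (v k y)" unfolding v(1)[OF y] using kk by simp
          then show ?thesis by (simp add: add_increasing2)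
        next
          case False
          have "r' \<le> real k * \<delta>" using kk(1) \<delta>(1) by (simp add: field_simps)
          also have "\<dots> \<le> real k * dist x y" using False by (intro mult_left_mono) (auto simp: dist_commute)
          finally show ?thesis using v(2)[OF y, of k] by simp
        qed
      qed (use B in auto)
      then show ?thesis using r r'(1) by (auto intro!: ennreal_lessI)
    qed
    then show "\<forall>\<^sub>F k in sequentially. d < ennreal (f k x)" by (auto simp: eventually_sequentially)
  qed
  have "(\<integral>\<^sup>+y\<in>?D. e2ennreal (ereal c - u y) \<partial>lborel) \<le> (\<integral>\<^sup>+y. liminf (\<lambda>k. ennreal (f k y) * indicator ?D y) \<partial>lborel)"
    using S(2) lim by (intro nn_integral_mono) (auto split: split_indicator)
  also have "\<dots> \<le> liminf (\<lambda>k. \<integral>\<^sup>+y\<in>?D. ennreal (f k y) \<partial>lborel)"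
  proof (rule nn_integral_liminf)
    fix k
    note fc[of k, measurable]
    show "(\<lambda>y. ennreal (f k y) * indicator ?D y) \<in> borel_measurable lborel" by measurable
  qed
  also have "\<dots> \<le> liminf (\<lambda>k::nat. ennreal (harnack_const TYPE('n) * \<rho> ^ CARD('n) * (c - a)))"
    by (intro Liminf_mono always_eventually allI weak_harnack_lipschitz[OF u tr S f0 flip _ fc fu a]) auto
  also have "\<dots> = ennreal (harnack_const TYPE('n) * \<rho> ^ CARD('n) * (c - a))"
    by (simp add: Liminf_const)
  finally show ?thesis .
qed

section \<open>The Riesz kernel\<close>

text \<open>K_p as a function of the squared distance: \<open>Kq p (t^2)\<close> is
  \<open>Kp p t\<close> for t > 0. This is the form that \<open>C2_qform\<close> takes.\<close>

definition Kq :: "nat \<Rightarrow> real \<Rightarrow> real" where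
  "Kq p s = (if p = 2 then ln s / 2 else - (s powr ((2 - real p) / 2)))"

text \<open>The constant in Kq'(s) = Kc s^(-p/2), which treats the logarithm and the powers
  alike.\<close>

definition Kc :: "nat \<Rightarrow> real" where
  "Kc p = (if p = 2 then 1 / 2 else (real p - 2) / 2)"

lemma Kq_qform: "x \<noteq> 0 \<Longrightarrow> Kq p (qform (mat 1) x) = Kp p (norm x)"
proof -
  assume x: "x \<noteq> 0"
  have "(norm x)\<^sup>2 powr ((2 - real p) / 2) = norm x powr (2 - real p)"
  proof -
    have "2 * ((2 - real p) / 2) = 2 - real p" by simp
    then have "(norm x powr 2) powr ((2 - real p) / 2) = norm x powr (2 - real p)" by (simp only: powr_powr)
    then show ?thesis using x by simp
  qed
  then show ?thesis using x by (simp add: Kq_def Kp_def qform_mat1 power2_norm_eq_inner[symmetric] ln_realpow)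
qed

lemma Kq_deriv:
  assumes "s > 0"
  shows "(Kq p has_real_derivative Kc p * s powr (- real p / 2)) (at s)"
proof (cases "p = 2")
  case True
  have "((\<lambda>s. ln s / 2) has_real_derivative 1 / (2 * s)) (at s)"
    using assms by (auto intro!: derivative_eq_intros)
  moreover have "s powr (- real p / 2) = 1 / s" using True assms by (simp add: powr_neg_one)
  ultimately show ?thesis using True by (simp add: Kq_def[abs_def] Kc_def)
next
  case False
  have "((\<lambda>s. - (s powr ((2 - real p) / 2))) has_real_derivative - ((2 - real p) / 2 * s powr ((2 - real p) / 2 - 1))) (at s)"
    using assms by (intro derivative_intros has_real_derivative_powr)
  moreover have "(2 - real p) / 2 - 1 = - real p / 2" by (simp add: field_simps)
  moreover have "- ((2 - real p) / 2 * w) = Kc p * w" for w using False by (simp add: Kc_def field_simps)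
  moreover have "Kq p = (\<lambda>s. - (s powr ((2 - real p) / 2)))" using False by (auto simp: Kq_def)
  ultimately show ?thesis by (simp only:)
qed

lemma Kq_deriv2:
  assumes "s > 0"
  shows "((\<lambda>s. Kc p * s powr (- real p / 2)) has_real_derivative Kc p * (- real p / 2 * s powr (- real p / 2 - 1))) (at s)"
  using assms by (intro DERIV_cmult has_real_derivative_powr)

lemma Kp_strict_mono:
  assumes "2 \<le> p" "0 < r" "r < s"
  shows "Kp p r < Kp p s"
proof (cases "p = 2")
  case False
  then show ?thesis using assms by (simp add: Kp_def powr_less_mono2_neg)
qed (use assms in \<open>simp add: Kp_def\<close>)

lemma Kp_mono: "2 \<le> p \<Longrightarrow> 0 < r \<Longrightarrow> r \<le> s \<Longrightarrow> Kp p r \<le> Kp p s"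
  using Kp_strict_mono[of p r s] by (cases "r = s") auto

lemma continuous_on_Kp: "continuous_on {0<..} (Kp p)"
  unfolding Kp_def by (cases "p = 2") (auto intro!: continuous_intros)

definition flowc :: "nat \<Rightarrow> real \<Rightarrow> real" where
  "flowc p r = (if p \<noteq> 2 then r powr (real p - 2) else 1)"

lemma flowc_pos: "r > 0 \<Longrightarrow> flowc p r > 0"
  by (simp add: flowc_def)

text \<open>Stated for differences because for p = 2 a change of scale adds ln r instead of
  multiplying.\<close>

lemma Kp_scale:
  assumes "0 < r" "0 < s" "0 < t"
  shows "flowc p r * (Kp p (r * s) - Kp p (r * t)) = Kp p s - Kp p t"
proof (cases "p = 2")
  case False
  have "r powr (real p - 2) * r powr (2 - real p) = 1"
    using assms(1) by (simp flip: powr_add)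
  then show ?thesis using assms False
    by (simp add: Kp_def flowc_def powr_mult right_diff_distrib flip: mult.assoc)
qed (use assms in \<open>simp add: Kp_def flowc_def ln_mult\<close>)

lemma C2_qform_trace:
  fixes P :: "real^'n^'n"
  assumes P: "orth_projector P" and I: "open I" "qform P (x - z) \<in> I"
    and f: "\<And>s. s \<in> I \<Longrightarrow> (f has_real_derivative fd s) (at s)"
    and fd: "\<And>s. s \<in> I \<Longrightarrow> (fd has_real_derivative fdd s) (at s)"
    and fdd: "continuous_on I fdd"
    and W: "subspace W" "P *v (x - z) \<in> W" "trace_on P W = q"
  obtains H where "C2_with_hessian (\<lambda>y. f (qform P (y - z))) x H"
    "trace_on H W = 4 * fdd (qform P (x - z)) * qform P (x - z) + 2 * fd (qform P (x - z)) * q"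
proof (rule that)
  show "C2_with_hessian (\<lambda>y. f (qform P (y - z))) x
    ((4 * fdd (qform P (x - z))) *\<^sub>R rank1 (P *v (x - z)) + (2 * fd (qform P (x - z))) *\<^sub>R P)"
    by (rule C2_qform[OF P I f fd fdd])
  show "trace_on ((4 * fdd (qform P (x - z))) *\<^sub>R rank1 (P *v (x - z)) + (2 * fd (qform P (x - z))) *\<^sub>R P) W
    = 4 * fdd (qform P (x - z)) * qform P (x - z) + 2 * fd (qform P (x - z)) * q"
    using W by (simp add: trace_on_add trace_on_scaleR trace_on_rank1) (simp add: qform_def)
qed

text \<open>K_p is the fundamental solution in dimension p: with f' proportional to s^(-p/2) the
  trace 4 f'' s + 2 f' p vanishes. P = 1 serves planes W through x; the projection onto W serves
  every x with P x nonzero.\<close>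

lemma C2_Kq:
  fixes P :: "real^'n^'n"
  assumes "orth_projector P" "P *v x \<noteq> 0" "subspace W" "P *v x \<in> W" "trace_on P W = real p"
  obtains H where "C2_with_hessian (\<lambda>y. Kq p (qform P y)) x H" "trace_on H W = 0"
proof -
  let ?q = "qform P (x - 0)"
  have q: "?q > 0" using assms(2) by (simp add: qform_def)
  obtain H where H: "C2_with_hessian (\<lambda>y. Kq p (qform P (y - 0))) x H"
    "trace_on H W = 4 * (Kc p * (- real p / 2 * ?q powr (- real p / 2 - 1))) * ?q + 2 * (Kc p * ?q powr (- real p / 2)) * real p"
  proof (rule C2_qform_trace[where P = P and I = "{0<..}" and x = x and z = 0 and W = W and q = "real p"
        and f = "Kq p" and fd = "\<lambda>s. Kc p * s powr (- real p / 2)"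
        and fdd = "\<lambda>s. Kc p * (- real p / 2 * s powr (- real p / 2 - 1))"])
    show "continuous_on {0<..} (\<lambda>s. Kc p * (- real p / 2 * s powr (- real p / 2 - 1)))"
      by (intro continuous_intros) auto
  qed (use assms q Kq_deriv Kq_deriv2 in auto)
  have "?q powr (- real p / 2 - 1) * ?q = ?q powr (- real p / 2)"
    using q powr_add[of ?q "- real p / 2 - 1" 1] by simp
  then have "trace_on H W = 0" using H(2) by (simp add: mult.assoc)
  then show ?thesis using that[OF _ \<open>trace_on H W = 0\<close>] H(1) by simp
qed

lemma C2_qform_id:
  fixes P :: "real^'n^'n"
  assumes P: "orth_projector P" and W: "subspace W" "trace_on P W = q"
  obtains H where "C2_with_hessian (\<lambda>y. qform P y) x H" "trace_on H W = 2 * q"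
proof (rule that)
  have "C2_with_hessian (\<lambda>y. qform P (y - 0)) x ((4 * 0) *\<^sub>R rank1 (P *v (x - 0)) + (2 * 1) *\<^sub>R P)"
    by (rule C2_qform[OF P open_UNIV, of x 0 "\<lambda>s. s" "\<lambda>_. 1" "\<lambda>_. 0"])
       (auto intro: DERIV_ident DERIV_const)
  then show "C2_with_hessian (\<lambda>y. qform P y) x (2 *\<^sub>R P)" by simp
  show "trace_on (2 *\<^sub>R P) W = 2 * q" using W by (simp add: trace_on_scaleR)
qed

section \<open>The maximum over balls\<close>

lemma emeasure_open_nonzero:
  assumes "open S" "S \<noteq> {}"
  shows "emeasure lborel (S :: 'a::euclidean_space set) \<noteq> 0"
proof -
  obtain x e where e: "e > 0" "cball x e \<subseteq> S" using assms open_contains_cball by blast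
  then have "emeasure lborel (cball x e) \<le> emeasure lborel S"
    using assms(1) by (intro emeasure_mono) auto
  moreover have "emeasure lborel (cball x e) > 0" using e(1) by (simp add: emeasure_cball)
  ultimately show ?thesis by auto
qed

text \<open>The group survives only in \<open>trace_Fcone\<close>, which says that test functions
  touching from above have nonnegative Laplacian.\<close>

locale G_setting =
  fixes GG :: "(real^'n) set set" and p :: nat
  assumes p2: "2 \<le> p"
    and subspace_GG: "\<And>W. W \<in> GG \<Longrightarrow> subspace W"
    and dim_GG: "\<And>W. W \<in> GG \<Longrightarrow> dim W = p"
    and trace_Fcone: "\<And>H. H \<in> Fcone GG \<Longrightarrow> trace H \<ge> 0"
    and transitive_GG: "transitivity_property GG"
begin

lemma GG_cover: "\<exists>W\<in>GG. x \<in> W"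
proof -
  obtain Ws where "Ws \<noteq> []" "set Ws \<subseteq> GG" "x \<in> hd Ws"
    using transitive_GG unfolding transitivity_property_def by blast
  then show ?thesis by (metis hd_in_set subsetD)
qed

text \<open>The interior of the set where u is -infinity is relatively closed: a finite value near
  one of its limit points would, by the weak Harnack inequality, make the integral of c - u finite
  over a ball that meets this interior in a nonempty open set. Connectedness then decides.\<close>

lemma not_minus_infinity_dense:
  assumes u: "G_psh GG \<Omega> u" and \<Omega>: "open \<Omega>" "connected \<Omega>" and ne: "\<exists>x\<in>\<Omega>. u x \<noteq> -\<infinity>"
    and U: "open U" "U \<subseteq> \<Omega>" "U \<noteq> {}"
  shows "\<exists>y\<in>U. u y \<noteq> -\<infinity>"
proof (rule ccontr)
  assume no: "\<not> ?thesis"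
  define T where "T = interior {x\<in>\<Omega>. u x = -\<infinity>}"
  have T\<Omega>: "T \<subseteq> \<Omega>" and Tinf: "\<And>x. x \<in> T \<Longrightarrow> u x = -\<infinity>" using interior_subset unfolding T_def by blast+
  have oT: "open T" by (simp add: T_def)
  have "U \<subseteq> T" unfolding T_def using U no by (intro interior_maximal) auto
  then have "T \<noteq> {}" using U(3) by auto
  have "x \<in> T" if x: "x \<in> \<Omega>" "x \<in> closure T" for x
  proof -
    have "u x \<noteq> \<infinity>" using u x by (auto simp: G_psh_def)
    then obtain c where c: "u x < ereal c" by (metis ereal_infty_less(1) less_PInf_Ex_of_nat)
    have "usc_on \<Omega> u" using u by (simp add: G_psh_def)
    then have "openin (top_of_set \<Omega>) {y\<in>\<Omega>. u y < ereal c}" by (simp add: usc_on_openin)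
    then have "open {y\<in>\<Omega>. u y < ereal c}" using \<Omega>(1) openin_open_trans by blast
    then obtain d where d: "d > 0" "cball x d \<subseteq> {y\<in>\<Omega>. u y < ereal c}"
      using x c by (metis (mono_tags, lifting) mem_Collect_eq open_contains_cball)
    define \<rho> where "\<rho> = d / 2"
    have \<rho>: "\<rho> > 0" using d by (simp add: \<rho>_def)
    have "u y = -\<infinity>" if y: "y \<in> ball x (\<rho>/8)" for y
    proof (rule ccontr)
      assume "u y \<noteq> -\<infinity>"
      have sub: "cball y \<rho> \<subseteq> cball x d"
        using y \<rho> by (intro cball_subset_cball_iff[THEN iffD2]) (auto simp: \<rho>_def dist_commute)
      have uc: "z \<in> \<Omega>" "u z \<le> ereal c" if "z \<in> cball y \<rho>" for z
        using subsetD[OF d(2) subsetD[OF sub that]] by auto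
      have "y \<in> cball y \<rho>" using \<rho> by simp
      then have "u y \<le> ereal c" by (rule uc)
      then obtain a where a: "u y = ereal a" using \<open>u y \<noteq> -\<infinity>\<close> by (cases "u y") auto
      have "(\<integral>\<^sup>+z\<in>cball y (\<rho>/4). e2ennreal (ereal c - u z) \<partial>lborel)
          \<le> ennreal (harnack_const TYPE('n) * \<rho> ^ CARD('n) * (c - a))"
        by (rule weak_harnack[OF u trace_Fcone _ \<rho> _ a]) (use uc in blast)+
      also have "\<dots> < \<infinity>" by simp
      finally have fin: "(\<integral>\<^sup>+z\<in>cball y (\<rho>/4). e2ennreal (ereal c - u z) \<partial>lborel) < \<infinity>" .
      let ?O = "T \<inter> ball x (\<rho>/8)"
      have "?O \<noteq> {}" using x(2) \<rho> by (metis centre_in_ball closure_iff_nhds_not_empty divide_pos_pos open_ball zero_less_numeral order_refl Int_commute)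
      then have O: "open ?O" "?O \<noteq> {}" using oT by auto
      then have pos: "emeasure lborel ?O \<noteq> 0" by (rule emeasure_open_nonzero)
      have "\<infinity> * emeasure lborel ?O = (\<integral>\<^sup>+z\<in>?O. \<infinity> \<partial>lborel)"
        using O by (subst nn_integral_cmult_indicator) auto
      also have "\<dots> \<le> (\<integral>\<^sup>+z\<in>cball y (\<rho>/4). e2ennreal (ereal c - u z) \<partial>lborel)"
      proof (intro nn_integral_mono)
        fix z
        have "z \<in> cball y (\<rho>/4)" if "z \<in> ?O"
          using that y dist_triangle[of y z x] by (auto simp: dist_commute)
        then show "\<infinity> * indicator ?O z \<le> e2ennreal (ereal c - u z) * indicator (cball y (\<rho>/4)) z"
          using Tinf by (auto split: split_indicator)
      qed
      finally show False using fin pos by (simp add: ennreal_top_mult)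
    qed
    then have "ball x (\<rho>/8) \<subseteq> {x\<in>\<Omega>. u x = -\<infinity>}" using d(2) \<rho> by (force simp: \<rho>_def)
    then have "ball x (\<rho>/8) \<subseteq> T" unfolding T_def by (intro interior_maximal) auto
    then show "x \<in> T" using \<rho> by (auto simp: subset_eq)
  qed
  then have "T = \<Omega> \<inter> closure T" using T\<Omega> closure_subset by blast
  then have "closedin (top_of_set \<Omega>) T" by (metis closed_closure closedin_closed_Int)
  moreover have "openin (top_of_set \<Omega>) T" using oT T\<Omega> by (simp add: open_subset)
  ultimately have "T = \<Omega>" using \<Omega>(2) \<open>T \<noteq> {}\<close> unfolding connected_clopen by blast
  then show False using Tinf ne by auto
qed

text \<open>The maximum principle: \<epsilon>|y|^2 has trace 2p\<epsilon> over every plane of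
  \<open>GG\<close>, which makes the comparison strict.\<close>

lemma max_on_sphere:
  assumes u: "G_psh GG D u" and S: "cball 0 r \<subseteq> D" "r > 0"
  shows "\<exists>x. norm x = r \<and> u x = Mmax u r"
proof -
  let ?S = "sphere (0::real^'n) r"
  have usc: "usc_on ?S u" using u S(1) by (auto simp: G_psh_def intro!: usc_on_subset[of D u])
  obtain e :: "real^'n" where "norm e = r" using vector_choose_size[of r] S(2) by auto
  then have "?S \<noteq> {}" by auto
  then obtain x where x: "norm x = r" "\<And>y. norm y = r \<Longrightarrow> u y \<le> u x"
    using usc_on_attains_max[OF compact_sphere _ usc] by auto
  have "u y \<le> u x" if y: "y \<in> cball 0 r" for y
  proof (rule ereal_le_epsilon2)
    fix e :: real assume e: "e > 0"
    define \<epsilon> where "\<epsilon> = e / r\<^sup>2"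
    have \<epsilon>: "\<epsilon> > 0" "\<epsilon> * r\<^sup>2 = e" using e S(2) by (auto simp: \<epsilon>_def)
    have "u y + ereal (\<epsilon> * qform (mat 1) y) \<le> u x + ereal e"
    proof (rule G_psh_comparison[OF u compact_cball S(1) _ subspace_GG _ _ y])
      show "continuous_on (cball 0 r) (\<lambda>y. \<epsilon> * qform (mat 1) y)" by (intro continuous_intros)
      fix z :: "real^'n"
      obtain W where W: "W \<in> GG" "z \<in> W" using GG_cover by blast
      obtain H where H: "C2_with_hessian (\<lambda>y. qform (mat 1) y) z H" "trace_on H W = 2 * real p"
        using C2_qform_id[OF orth_projector_mat1 subspace_GG[OF W(1)], of "real p" z] W
          trace_on_mat1[OF subspace_GG[OF W(1)]] dim_GG[OF W(1)] by auto
      show "\<exists>H. C2_with_hessian (\<lambda>y. \<epsilon> * qform (mat 1) y) z H \<and> (\<exists>W\<in>GG. 0 < trace_on H W)"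
        using C2_cmult[OF H(1), of \<epsilon>] H(2) W(1) \<epsilon>(1) p2 trace_on_scaleR[OF subspace_GG[OF W(1)], of \<epsilon> H]
        by (intro exI[of _ "\<epsilon> *\<^sub>R H"] conjI bexI[of _ W]) auto
    next
      fix z :: "real^'n" assume "z \<in> cball 0 r - interior (cball 0 r)"
      then have "norm z = r" by auto
      then show "u z + ereal (\<epsilon> * qform (mat 1) z) \<le> u x + ereal e"
        using x(2)[of z] \<epsilon>(2) by (simp add: qform_mat1 power2_norm_eq_inner[symmetric] add_right_mono)
    qed
    moreover have "u y \<le> u y + ereal (\<epsilon> * qform (mat 1) y)"
      using mult_nonneg_nonneg[OF less_imp_le[OF \<epsilon>(1)] qform_nonneg[of "mat 1" y]] by (cases "u y") auto
    ultimately show "u y \<le> u x + ereal e" by order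
  qed
  then have "Mmax u r = u x" unfolding Mmax_def using x(1) by (intro antisym SUP_least SUP_upper) auto
  then show ?thesis using x(1) by auto
qed

text \<open>Through every z passes a plane of \<open>GG\<close>, and K_p(|y|) has trace zero over it
  at z. Adding \<epsilon>|y|^2 gives strictness, at a total price of \<epsilon> t^2 = e.\<close>

lemma annulus_comparison:
  assumes u: "G_psh GG D u" and S: "cball 0 t \<subseteq> D" "0 < r" "r < t"
    and b: "b \<ge> 0" and inner: "\<And>x. norm x = r \<Longrightarrow> u x \<le> ereal (a + b * Kp p r)"
    and outer: "\<And>x. norm x = t \<Longrightarrow> u x \<le> ereal (a + b * Kp p t)"
    and x: "r \<le> norm x" "norm x \<le> t"
  shows "u x \<le> ereal (a + b * Kp p (norm x))"
proof (rule ereal_le_epsilon2)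
  fix e :: real assume e: "e > 0"
  define \<epsilon> where "\<epsilon> = e / t\<^sup>2"
  have \<epsilon>: "\<epsilon> > 0" "\<epsilon> * t\<^sup>2 = e" using e S by (auto simp: \<epsilon>_def)
  let ?S = "cball (0::real^'n) t - ball 0 r"
  let ?g = "\<lambda>y::real^'n. (- b) * Kq p (qform (mat 1) y) + \<epsilon> * qform (mat 1) y"
  have S0: "y \<noteq> 0" if "y \<in> ?S" for y :: "real^'n" using that S by auto
  have geq: "?g y = - b * Kp p (norm y) + \<epsilon> * (norm y)\<^sup>2" if "y \<in> ?S" for y :: "real^'n"
    using Kq_qform[OF S0[OF that]] by (simp add: qform_mat1 power2_norm_eq_inner)
  have "u x + ereal (?g x) \<le> ereal (a + e)"
  proof (rule G_psh_comparison[OF u _ _ _ subspace_GG])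
    show "compact ?S" by (simp add: compact_diff)
    show "?S \<subseteq> D" using S(1) by auto
    show "continuous_on ?S ?g"
    proof (rule continuous_on_eq)
      show "continuous_on ?S (\<lambda>y. - b * Kp p (norm y) + \<epsilon> * (norm y)\<^sup>2)"
        using S0 by (intro continuous_intros continuous_on_compose2[OF continuous_on_Kp]) auto
    qed (use geq in auto)
    show "x \<in> ?S" using x by auto
  next
    fix z :: "real^'n" assume "z \<in> interior ?S"
    then have z: "z \<noteq> 0" using S0 interior_subset by blast
    obtain W where W: "W \<in> GG" "z \<in> W" using GG_cover by blast
    note sW = subspace_GG[OF W(1)]
    have tr: "trace_on (mat 1) W = real p" using trace_on_mat1[OF sW] dim_GG[OF W(1)] by simp
    obtain H where H: "C2_with_hessian (\<lambda>y. qform (mat 1) y) z H" "trace_on H W = 2 * real p"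
      using C2_qform_id[OF orth_projector_mat1 sW tr, of z] by blast
    obtain H' where H': "C2_with_hessian (\<lambda>y. Kq p (qform (mat 1) y)) z H'" "trace_on H' W = 0"
      using C2_Kq[OF orth_projector_mat1 _ sW _ tr, of z] W z by auto
    have "trace_on ((- b) *\<^sub>R H' + \<epsilon> *\<^sub>R H) W = 2 * \<epsilon> * real p"
      by (simp only: trace_on_add[OF sW] trace_on_scaleR[OF sW] H(2) H'(2))
    then show "\<exists>H. C2_with_hessian ?g z H \<and> (\<exists>W\<in>GG. 0 < trace_on H W)"
      using C2_add[OF C2_cmult[OF H'(1), of "- b"] C2_cmult[OF H(1), of \<epsilon>]] W(1) \<epsilon>(1) p2
      by (intro exI[of _ "(- b) *\<^sub>R H' + \<epsilon> *\<^sub>R H"] conjI bexI[of _ W]) simp_all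
  next
    fix z :: "real^'n" assume z: "z \<in> ?S - interior ?S"
    have "ball 0 t - cball 0 r \<subseteq> interior ?S" by (intro interior_maximal) auto
    then have "z \<notin> ball 0 t - cball 0 r" using z by blast
    then have "norm z = r \<or> norm z = t" using z by auto
    then have 1: "u z \<le> ereal (a + b * Kp p (norm z))" using inner outer by auto
    have "(norm z)\<^sup>2 \<le> t\<^sup>2" using z by (intro power_mono) auto
    then have "\<epsilon> * (norm z)\<^sup>2 \<le> e" using \<epsilon> by (metis mult_left_mono less_imp_le)
    then show "u z + ereal (?g z) \<le> ereal (a + e)"
      using 1 geq[of z] z by (cases "u z") auto
  qed
  moreover have "?g x = - b * Kp p (norm x) + \<epsilon> * (norm x)\<^sup>2" using geq x by auto
  moreover have "\<epsilon> * (norm x)\<^sup>2 \<ge> 0" using \<epsilon> by simp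
  ultimately show "u x \<le> ereal (a + b * Kp p (norm x)) + ereal e"
    by (cases "u x") auto
qed

end

section \<open>Propagation of contact along the planes\<close>

lemma projector_norm_le:
  assumes "orth_projector P"
  shows "norm (P *v x) \<le> norm x"
proof -
  have "(P *v x) \<bullet> (P *v x) = x \<bullet> (P *v x)" using assms unfolding orth_projector_def by metis
  also have "\<dots> \<le> norm x * norm (P *v x)" by (rule norm_cauchy_schwarz)
  finally have "norm (P *v x) * norm (P *v x) \<le> norm x * norm (P *v x)"
    by (simp add: power2_norm_eq_inner[symmetric] power2_eq_square)
  then show ?thesis by (cases "norm (P *v x) = 0") auto
qed

lemma qform_pythagoras:
  assumes "orth_projector P"
  shows "qform (mat 1) x - qform P x = (norm (x - P *v x))\<^sup>2"
proof -
  have "(P *v x) \<bullet> (P *v x) = x \<bullet> (P *v x)" using assms unfolding orth_projector_def by metis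
  then show ?thesis by (simp add: qform_def power2_norm_eq_inner inner_diff_left inner_diff_right inner_commute)
qed

lemma continuous_on_Kq: "continuous_on {0<..} (Kq p)"
  by (rule DERIV_continuous_on[of _ _ "\<lambda>s. Kc p * s powr (- real p / 2)"])
     (rule has_field_derivative_at_within, rule Kq_deriv, simp)

text \<open>What is retained of a sequence of rescalings: an upper bound up to vanishing errors, and
  near equality at unspecified points of the unit sphere. The abstract form allows passing to
  subsequences.\<close>

locale G_sequence = G_setting GG p
  for GG :: "(real^'n) set set" and p :: nat +
  fixes w :: "nat \<Rightarrow> real^'n \<Rightarrow> ereal" and \<Theta> :: real
  assumes Theta_nonneg: "\<Theta> \<ge> 0"
    and psh_w: "\<And>\<rho>. \<rho> > 0 \<Longrightarrow> \<forall>\<^sub>F j in sequentially. \<exists>D. G_psh GG D (w j) \<and> cball 0 \<rho> \<subseteq> D"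
    and upper_w: "\<And>\<rho> e. \<rho> > 0 \<Longrightarrow> e > 0 \<Longrightarrow> \<forall>\<^sub>F j in sequentially. \<forall>x\<in>cball 0 \<rho>. x \<noteq> 0 \<longrightarrow>
      w j x \<le> ereal (\<Theta> * Kp p (norm x) + e)"
    and touch_w: "\<And>e. e > 0 \<Longrightarrow> \<forall>\<^sub>F j in sequentially. \<exists>x. norm x = 1 \<and> ereal (\<Theta> * Kp p 1 - e) \<le> w j x"
begin

text \<open>\<open>attained x\<close> says that the upper relaxed limit of the sequence at \<open>x\<close> reaches the
  upper bound \<open>\<Theta> K\<^sub>p(|x|)\<close>.\<close>
definition attained :: "real^'n \<Rightarrow> bool" where
  "attained x \<longleftrightarrow> (\<forall>e>0. \<forall>\<rho>>0. \<exists>\<^sub>F j in sequentially. \<exists>y\<in>ball x \<rho>. ereal (\<Theta> * Kp p (norm x) - e) < w j y)"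

lemma not_attainedE:
  assumes "\<not> attained x"
  obtains e \<rho> where "e > 0" "\<rho> > 0"
    "\<forall>\<^sub>F j in sequentially. \<forall>y\<in>ball x \<rho>. w j y \<le> ereal (\<Theta> * Kp p (norm x) - e)"
  using assms that unfolding attained_def not_frequently not_le by (auto simp: not_frequently not_less)

lemma isCont_Kp_norm: "x \<noteq> 0 \<Longrightarrow> isCont (\<lambda>x. \<Theta> * Kp p (norm x)) (x::real^'n)"
proof -
  assume "x \<noteq> 0"
  then have "isCont (Kp p) (norm x)"
    using continuous_on_Kp[of p] by (simp add: continuous_on_eq_continuous_at)
  then show ?thesis by (intro continuous_intros isCont_o2[of _ norm]) auto
qed

text \<open>Hopf's barrier argument inside the plane \<open>W\<close>, with a large penalty \<open>C\<close> for the directions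
  normal to \<open>W\<close>; the penalty does not contribute to the trace over \<open>W\<close>.\<close>
lemma hopf_contact:
  assumes W: "W \<in> GG" "x1 \<in> W" "z \<in> W" and x1: "x1 \<noteq> 0" "z \<noteq> x1" "attained x1"
    and only: "\<And>x. x \<in> W \<Longrightarrow> x \<noteq> 0 \<Longrightarrow> dist z x \<le> dist z x1 \<Longrightarrow> attained x \<Longrightarrow> x = x1"
  shows False
proof -
  note sW = subspace_GG[OF W(1)]
  obtain P :: "real^'n^'n" where P: "orth_projector P" "\<And>x. P *v x \<in> W" "\<And>x. x \<in> W \<Longrightarrow> P *v x = x"
    "trace_on P W = real p"
    using subspace_projector[OF sW] dim_GG[OF W(1)] by metis
  define V where "V x = \<Theta> * Kp p (norm x)" for x :: "real^'n"
  \<comment> \<open>V has trace zero over W at the points of W. With P x in place of x this holds at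
    every point where P x is nonzero, and on W the two functions agree.\<close>
  define Vq where "Vq x = \<Theta> * Kq p (qform P x)" for x
  define r where "r = dist z x1"
  \<comment> \<open>Small enough to keep x and P x away from 0, and P x away from z.\<close>
  define \<rho> where "\<rho> = min (norm x1 / 2) (r / 2)"
  \<comment> \<open>On the small ball |P(x - z)|^2 >= r^2/4, so 2\<alpha> times it is at least 2p,
    while positivity of the barrier's trace asks for more than p.\<close>
  define \<alpha> where "\<alpha> = 4 * real p / r\<^sup>2"
  \<comment> \<open>The barrier is positive where |P(x - z)| < r, zero at x1, and at most 1.\<close>
  define Q where "Q x = exp (- \<alpha> * qform P (x - z)) - exp (- \<alpha> * r\<^sup>2)" for x
  define qn where "qn x = qform (mat 1) x - qform P x" for x
  have r: "r > 0" using x1 by (simp add: r_def)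
  have \<rho>: "\<rho> > 0" "\<rho> \<le> norm x1 / 2" "\<rho> \<le> r / 2" using r x1 by (auto simp: \<rho>_def)
  have \<alpha>: "\<alpha> > 0" using r p2 by (simp add: \<alpha>_def)
  have PN: "norm (P *v x) \<ge> norm x1 / 2" "norm (P *v (x - z)) \<ge> r / 2" "norm x \<ge> norm x1 / 2"
    if "x \<in> cball x1 \<rho>" for x
  proof -
    have 1: "norm (x1 - x) \<le> \<rho>" using that by (simp add: dist_norm)
    have "norm (x1 - P *v x) = norm (P *v (x1 - x))"
      using P(3)[OF W(2)] by (simp add: matrix_vector_mult_diff_distrib)
    also have "\<dots> \<le> \<rho>" using projector_norm_le[OF P(1), of "x1 - x"] 1 by simp
    finally have 2: "norm (x1 - P *v x) \<le> \<rho>" .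
    show "norm (P *v x) \<ge> norm x1 / 2" using 2 \<rho>(2) norm_triangle_ineq2[of x1 "P *v x"] by linarith
    have "P *v (x - z) = P *v x - z" using P(3)[OF W(3)] by (simp add: matrix_vector_mult_diff_distrib)
    then have "norm (z - x1) - norm (x1 - P *v x) \<le> norm (P *v (x - z))"
      using norm_triangle_ineq2[of "z - x1" "P *v x - x1"] by (simp add: norm_minus_commute)
    then show "norm (P *v (x - z)) \<ge> r / 2" using 2 \<rho>(3) by (simp add: r_def dist_norm)
    show "norm x \<ge> norm x1 / 2" using 1 \<rho>(2) norm_triangle_ineq2[of x1 x] by linarith
  qed
  have qpos: "qform P x > 0" if "x \<in> cball x1 \<rho>" for x
    using PN(1)[OF that] x1(1) by (auto simp: qform_def)
  have VqV: "Vq x = V (P *v x)" if "x \<in> cball x1 \<rho>" for x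
  proof -
    have "P *v x \<noteq> 0" using PN(1)[OF that] x1(1) by auto
    then show ?thesis using Kq_qform[of "P *v x" p] by (simp add: Vq_def V_def qform_def)
  qed
  have qn: "qn x = (norm (x - P *v x))\<^sup>2" for x by (simp add: qn_def qform_pythagoras[OF P(1)])
  have Q1: "Q x \<le> 1" for x
  proof -
    have "exp (- \<alpha> * qform P (x - z)) \<le> 1" using \<alpha> qform_nonneg[of P "x - z"] by simp
    then show ?thesis unfolding Q_def by (smt (verit) exp_gt_zero)
  qed
  have cVq: "continuous_on (cball x1 \<rho>) Vq"
    unfolding Vq_def using qpos by (intro continuous_intros continuous_on_compose2[OF continuous_on_Kq]) auto
  have cV: "continuous_on (cball x1 \<rho>) V"
    unfolding V_def using PN(3) x1(1) by (intro continuous_intros continuous_on_compose2[OF continuous_on_Kp]) force+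
  have cQ: "continuous_on S Q" for S unfolding Q_def by (intro continuous_intros)
  have cqn: "continuous_on S qn" for S unfolding qn_def by (intro continuous_intros)
  \<comment> \<open>The points of the small sphere that lie in W and have a nonnegative barrier. By
    hypothesis none is a contact point, so compactness gives a uniform margin e0 on a neighbourhood
    O' of A.\<close>
  define A where "A = sphere x1 \<rho> \<inter> (W \<inter> cball z r)"
  have A: "compact A" unfolding A_def using closed_subspace[OF sW]
    by (intro compact_Int_closed closed_Int) auto
  define below where "below x d e \<longleftrightarrow> (\<forall>\<^sub>F j in sequentially. \<forall>y\<in>ball x d \<inter> cball x1 \<rho>. w j y \<le> ereal (Vq y - e))" for x d e
  have "\<exists>d>0. \<exists>e>0. below x d e" if x: "x \<in> A" for x
  proof -
    have xN: "x \<in> cball x1 \<rho>" "x \<in> W" and "x \<noteq> x1" "dist z x \<le> r" using x \<rho>(1) by (auto simp: A_def)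
    moreover have "x \<noteq> 0" using PN(3)[OF xN(1)] x1(1) by auto
    ultimately have "\<not> attained x" using only[of x] by (auto simp: r_def)
    then obtain e d where e: "e > 0" "d > 0" "\<forall>\<^sub>F j in sequentially. \<forall>y\<in>ball x d. w j y \<le> ereal (V x - e)"
      unfolding V_def by (rule not_attainedE)
    obtain d' where d': "d' > 0" "\<And>y. y \<in> cball x1 \<rho> \<Longrightarrow> dist y x < d' \<Longrightarrow> dist (Vq y) (Vq x) < e / 2"
      using cVq xN(1) e(1) unfolding continuous_on_iff by (meson half_gt_zero)
    have "Vq x = V x" using VqV[OF xN(1)] P(3)[OF xN(2)] by simp
    then have Vqe: "V x - e \<le> Vq y - e / 2" if "y \<in> cball x1 \<rho>" "dist y x < d'" for y
      using d'(2)[OF that, unfolded dist_real_def abs_less_iff] \<open>Vq x = V x\<close> by linarith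
    from e(3) have "\<forall>\<^sub>F j in sequentially. \<forall>y\<in>ball x (min d d') \<inter> cball x1 \<rho>. w j y \<le> ereal (Vq y - e / 2)"
    proof eventually_elim
      case (elim j)
      show ?case
      proof
        fix y assume y: "y \<in> ball x (min d d') \<inter> cball x1 \<rho>"
        then have "w j y \<le> ereal (V x - e)" using elim by simp
        also have "\<dots> \<le> ereal (Vq y - e / 2)" using Vqe[of y] y by (simp add: dist_commute)
        finally show "w j y \<le> ereal (Vq y - e / 2)" .
      qed
    qed
    then have "below x (min d d') (e / 2)" by (simp add: below_def)
    then show ?thesis using e d' by (intro exI[of _ "min d d'"] conjI exI[of _ "e / 2"]) auto
  qed
  then obtain d e where de: "\<And>x. x \<in> A \<Longrightarrow> d x > 0" "\<And>x. x \<in> A \<Longrightarrow> e x > 0" "\<And>x. x \<in> A \<Longrightarrow> below x (d x) (e x)"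
    by metis
  note de3 = de(3)[unfolded below_def]
  have "A \<subseteq> (\<Union>x\<in>A. ball x (d x))" using de(1) by auto
  then obtain X where X: "X \<subseteq> A" "finite X" "A \<subseteq> (\<Union>x\<in>X. ball x (d x))"
    using compactE_image[OF A, of A "\<lambda>x. ball x (d x)"] by auto
  define O' where "O' = (\<Union>x\<in>X. ball x (d x))"
  define e0 where "e0 = Min (insert 1 (e ` X))"
  have e0: "e0 > 0" "\<And>x. x \<in> X \<Longrightarrow> e0 \<le> e x" using X(1,2) de(2) by (auto simp: e0_def)
  have "\<forall>\<^sub>F j in sequentially. \<forall>x\<in>X. \<forall>y\<in>ball x (d x) \<inter> cball x1 \<rho>. w j y \<le> ereal (Vq y - e x)"
    by (rule eventually_ball_finite[OF X(2)], rule ballI, rule de3) (use X(1) in blast)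
  then have evO: "\<forall>\<^sub>F j in sequentially. \<forall>y\<in>O' \<inter> cball x1 \<rho>. w j y \<le> ereal (Vq y - e0)"
  proof eventually_elim
    case (elim j)
    show ?case
    proof
      fix y assume "y \<in> O' \<inter> cball x1 \<rho>"
      then obtain x where x: "x \<in> X" "y \<in> ball x (d x) \<inter> cball x1 \<rho>" by (auto simp: O'_def)
      then have "w j y \<le> ereal (Vq y - e x)" using elim by blast
      also have "\<dots> \<le> ereal (Vq y - e0)" using e0(2)[OF x(1)] by simp
      finally show "w j y \<le> ereal (Vq y - e0)" .
    qed
  qed
  \<comment> \<open>As Q <= 1, the barrier uses up at most half of the margin e0.\<close>
  define \<delta> where "\<delta> = e0 / 2"
  have \<delta>: "\<delta> > 0" using e0 by (simp add: \<delta>_def)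
  define B where "B = sphere x1 \<rho> - O'"
  have B: "compact B" "B \<subseteq> cball x1 \<rho>" unfolding B_def O'_def by (auto intro!: compact_diff)
  define F where "F C x = V x - Vq x + \<delta> * Q x - C * qn x" for C x
  have cF: "continuous_on B (F C)" for C
    unfolding F_def using B(2)
    by (intro continuous_intros cQ cqn continuous_on_subset[OF cV] continuous_on_subset[OF cVq])
  \<comment> \<open>Violations for C tending to infinity accumulate at a point of W. There V = Vq,
    so the barrier is nonnegative and the point lies in A, which O' removes from B.\<close>
  have "\<exists>C. \<forall>x\<in>B. F (real C) x < 0"
  proof (rule ccontr)
    assume "\<not> ?thesis"
    then obtain x where x: "\<And>k. x k \<in> B" "\<And>k. F (real k) (x k) \<ge> 0" by (metis not_less)
    have "bounded (F 0 ` B)" by (intro compact_imp_bounded compact_continuous_image cF B(1))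
    then obtain M where M: "\<And>y. y \<in> B \<Longrightarrow> F 0 y \<le> M" by (auto simp: bounded_iff abs_le_iff)
    obtain l s where l: "l \<in> B" "strict_mono s" "(x \<circ> s) \<longlonglongrightarrow> l"
      using B(1) x(1) unfolding compact_def by blast
    have F0: "F (real k) y = F 0 y - real k * qn y" for k y by (simp add: F_def)
    have qn0: "qn y \<ge> 0" for y by (simp add: qn)
    have "(\<lambda>k. F 0 (x (s k))) \<longlonglongrightarrow> F 0 l" 
      using continuous_on_tendsto_compose[OF cF l(3,1)] x(1) by (simp add: o_def)
    moreover have "F 0 (x (s k)) \<ge> 0" for k
      using x(2)[of "s k"] F0[of "s k" "x (s k)"] qn0[of "x (s k)"] by (smt (verit) mult_nonneg_nonneg of_nat_0_le_iff)
    ultimately have F0l: "F 0 l \<ge> 0" by (intro LIMSEQ_le_const) auto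
    have "(\<lambda>k. qn (x (s k))) \<longlonglongrightarrow> qn l"
      using continuous_on_tendsto_compose[OF cqn[of B] l(3,1)] x(1) by (simp add: o_def)
    moreover have "(\<lambda>k. qn (x (s k))) \<longlonglongrightarrow> 0"
    proof (rule tendsto_sandwich[OF _ _ tendsto_const])
      show "\<forall>\<^sub>F k in sequentially. qn (x (s k)) \<le> M / real (s k)"
        using eventually_gt_at_top[of 0]
      proof eventually_elim
        case (elim k)
        then have "s k > 0" using l(2) by (metis not_gr_zero seq_suble leD)
        moreover have "real (s k) * qn (x (s k)) \<le> M"
          using x(2)[of "s k"] F0[of "s k" "x (s k)"] M[OF x(1), of "s k"] by simp
        ultimately show ?case by (simp add: field_simps)
      qed
      have "(\<lambda>k. M / real k) \<longlonglongrightarrow> 0" by (rule lim_const_over_n)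
      then show "(\<lambda>k. M / real (s k)) \<longlonglongrightarrow> 0" using LIMSEQ_subseq_LIMSEQ[OF _ l(2)] by (auto simp: o_def)
    qed (simp add: qn0)
    ultimately have "qn l = 0" using LIMSEQ_unique by blast
    then have Pl: "P *v l = l" by (simp add: qn)
    then have lW: "l \<in> W" using P(2) by metis
    have lN: "l \<in> cball x1 \<rho>" using l(1) B(2) by auto
    have "Q l \<ge> 0" using F0l VqV[OF lN] Pl \<delta> by (simp add: F_def zero_le_mult_iff)
    then have "qform P (l - z) \<le> r\<^sup>2" using \<alpha> by (simp add: Q_def)
    moreover have "qform P (l - z) = (dist z l)\<^sup>2"
      using Pl P(3)[OF W(3)] by (simp add: qform_def matrix_vector_mult_diff_distrib dist_norm power2_norm_eq_inner norm_minus_commute)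
    ultimately have "dist z l \<le> r" using r by (simp add: power2_le_iff_abs_le abs_le_square_iff[symmetric])
    then have "l \<in> A" using l(1) lW by (auto simp: A_def B_def)
    then show False using X(3) l(1) by (auto simp: B_def O'_def)
  qed
  then obtain C0 where C0: "\<And>x. x \<in> B \<Longrightarrow> F (real C0) x < 0" by blast
  define C where "C = real C0"
  obtain e1 where e1: "e1 > 0" "\<And>x. x \<in> B \<Longrightarrow> F C x \<le> - e1"
  proof (cases "B = {}")
    case True
    then show ?thesis using that[of 1] by auto
  next
    case False
    then obtain m where "m \<in> B" "\<And>x. x \<in> B \<Longrightarrow> F C x \<le> F C m"
      using continuous_attains_sup[OF B(1) _ cF] by metis
    then show ?thesis using that[of "- F C m"] C0[of m] by (auto simp: C_def)
  qed
  define \<eta> where "\<eta> = min (e0 / 2) (e1 / 2)"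
  have \<eta>: "\<eta> > 0" "\<eta> \<le> e0 / 2" "\<eta> \<le> e1 / 2" using e0 e1 by (auto simp: \<eta>_def)
  \<comment> \<open>This is -Vq + \<delta> Q - C qn, split into summands whose Hessians are
    known.\<close>
  define g where "g y = (- \<Theta>) * Kq p (qform P y) + (\<delta> * exp (- \<alpha> * qform P (y - z)) +
    (C * qform P y + ((- C) * qform (mat 1) y + (- \<delta> * exp (- \<alpha> * r\<^sup>2)))))" for y
  have gF: "g y = - Vq y + \<delta> * Q y - C * qn y" for y
    by (simp add: g_def Vq_def Q_def qn_def algebra_simps)
  have cg: "continuous_on (cball x1 \<rho>) g"
    unfolding gF by (intro continuous_intros cQ cqn cVq)
  have strict: "\<exists>H. C2_with_hessian g x H \<and> (\<exists>W\<in>GG. trace_on H W > 0)" if "x \<in> interior (cball x1 \<rho>)" for x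
  proof -
    have xN: "x \<in> cball x1 \<rho>" using that interior_subset by blast
    let ?q = "qform P (x - z)"
    obtain H1 where H1: "C2_with_hessian (\<lambda>y. Kq p (qform P y)) x H1" "trace_on H1 W = 0"
      using C2_Kq[OF P(1) _ sW P(2,4), of x] qpos[OF xN] by (auto simp: qform_def)
    obtain H2 where H2: "C2_with_hessian (\<lambda>y. exp (- \<alpha> * qform P (y - z))) x H2"
      "trace_on H2 W = 4 * (\<alpha>\<^sup>2 * exp (- \<alpha> * ?q)) * ?q + 2 * (- \<alpha> * exp (- \<alpha> * ?q)) * real p"
    proof (rule C2_qform_trace[where P = P and I = UNIV and x = x and z = z and W = W and q = "real p"
        and f = "\<lambda>s. exp (- \<alpha> * s)" and fd = "\<lambda>s. - \<alpha> * exp (- \<alpha> * s)" and fdd = "\<lambda>s. \<alpha>\<^sup>2 * exp (- \<alpha> * s)"])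
      show "((\<lambda>s. exp (- \<alpha> * s)) has_real_derivative - \<alpha> * exp (- \<alpha> * s)) (at s)" for s
        by (auto intro!: derivative_eq_intros)
      show "((\<lambda>s. - \<alpha> * exp (- \<alpha> * s)) has_real_derivative \<alpha>\<^sup>2 * exp (- \<alpha> * s)) (at s)" for s
        by (auto intro!: derivative_eq_intros simp: power2_eq_square)
    qed (use P sW in \<open>auto intro!: continuous_intros\<close>)
    obtain H3 where H3: "C2_with_hessian (\<lambda>y. qform P y) x H3" "trace_on H3 W = 2 * real p"
      using C2_qform_id[OF P(1) sW P(4)] by blast
    obtain H4 where H4: "C2_with_hessian (\<lambda>y. qform (mat 1) y) x H4" "trace_on H4 W = 2 * real p"
      using C2_qform_id[OF orth_projector_mat1 sW, of "real p" x] trace_on_mat1[OF sW] dim_GG[OF W(1)] by auto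
    define H where "H = (- \<Theta>) *\<^sub>R H1 + (\<delta> *\<^sub>R H2 + (C *\<^sub>R H3 + ((- C) *\<^sub>R H4 + 0)))"
    have "C2_with_hessian g x H"
      unfolding g_def[abs_def] H_def by (intro C2_add C2_cmult H1(1) H2(1) H3(1) H4(1) C2_const)
    moreover have "trace_on H W > 0"
    proof -
      have "(r / 2)\<^sup>2 \<le> (norm (P *v (x - z)))\<^sup>2" using PN(2)[OF xN] r by (intro power_mono) auto
      then have "r\<^sup>2 / 4 \<le> ?q" by (simp add: qform_def power2_norm_eq_inner power_divide)
      then have "2 * \<alpha> * (r\<^sup>2 / 4) \<le> 2 * \<alpha> * ?q" using \<alpha> by (intro mult_left_mono) auto
      moreover have "2 * \<alpha> * (r\<^sup>2 / 4) = 2 * real p" using r by (simp add: \<alpha>_def)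
      ultimately have "2 * \<alpha> * ?q - real p > 0" using p2 by simp
      moreover have "trace_on H2 W = 2 * \<alpha> * exp (- \<alpha> * ?q) * (2 * \<alpha> * ?q - real p)"
        unfolding H2(2) by (simp add: power2_eq_square algebra_simps)
      ultimately have "trace_on H2 W > 0" using \<alpha> by simp
      have "trace_on (0 :: real^'n^'n) W = 0" using trace_on_scaleR[OF sW, of 0 0] by simp
      \<comment> \<open>Over W the kernel contributes nothing, and C|Py|^2 and -C|y|^2 cancel; the
        barrier remains.\<close>
      then have "trace_on H W = \<delta> * trace_on H2 W"
        unfolding H_def trace_on_add[OF sW] trace_on_scaleR[OF sW] H1(2) H3(2) H4(2) by simp
      then show ?thesis using \<delta> \<open>trace_on H2 W > 0\<close> by simp
    qed
    ultimately show ?thesis using W(1) by blast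
  qed
  have gx1: "g x1 = - V x1"
  proof -
    have "x1 \<in> cball x1 \<rho>" using \<rho> by simp
    then have "Vq x1 = V x1" using VqV P(3)[OF W(2)] by simp
    moreover have "qn x1 = 0" using P(3)[OF W(2)] by (simp add: qn)
    moreover have "P *v (x1 - z) = x1 - z" using P(3) W by (simp add: matrix_vector_mult_diff_distrib)
    then have "Q x1 = 0" by (simp add: Q_def qform_def r_def dist_norm power2_norm_eq_inner norm_minus_commute[of z])
    ultimately show ?thesis by (simp add: gF)
  qed
  have "\<forall>\<^sub>F j in sequentially. \<forall>y\<in>cball x1 \<rho>. w j y + ereal (g y) \<le> ereal (- \<eta>)"
  proof -
    let ?R = "norm x1 + \<rho>"
    have R: "?R > 0" "cball x1 \<rho> \<subseteq> cball 0 ?R" using \<rho> by (auto simp: subset_cball add_nonneg_pos dist_norm) (smt (verit) norm_triangle_sub norm_minus_commute)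
    have "e1 / 2 > 0" using e1 by simp
    from psh_w[OF R(1)] upper_w[OF R(1) this] evO show ?thesis
    proof eventually_elim
      case (elim j)
      then obtain D where D: "G_psh GG D (w j)" "cball 0 ?R \<subseteq> D" by blast
      show ?case
      proof
        fix y assume y: "y \<in> cball x1 \<rho>"
        show "w j y + ereal (g y) \<le> ereal (- \<eta>)"
        proof (rule G_psh_comparison[OF D(1) compact_cball _ cg subspace_GG strict _ y])
          show "cball x1 \<rho> \<subseteq> D" using R D by auto
          fix x assume x: "x \<in> cball x1 \<rho> - interior (cball x1 \<rho>)"
          then have xN: "x \<in> cball x1 \<rho>" and xs: "x \<in> sphere x1 \<rho>" by auto
          have qn0: "C * qn x \<ge> 0" by (simp add: C_def qn)
          have \<delta>Q: "\<delta> * Q x \<le> \<delta>" using Q1[of x] \<delta> by (simp add: mult_le_cancel_left1)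
          show "w j x + ereal (g x) \<le> ereal (- \<eta>)"
          proof (cases "x \<in> O'")
            case True
            then have "w j x \<le> ereal (Vq x - e0)" using elim(3) xN by blast
            then have "w j x + ereal (g x) \<le> ereal (Vq x - e0) + ereal (g x)" by (rule add_right_mono)
            also have "\<dots> \<le> ereal (- \<eta>)" using qn0 \<delta>Q \<eta>(2) by (simp add: gF \<delta>_def)
            finally show ?thesis .
          next
            case False
            then have xB: "x \<in> B" using xs by (simp add: B_def)
            have "x \<noteq> 0" using PN(3)[OF xN] x1(1) by auto
            moreover have "x \<in> cball 0 ?R" using xN R(2) by blast
            ultimately have "w j x \<le> ereal (V x + e1 / 2)" using elim(2) by (simp add: V_def)
            then have "w j x + ereal (g x) \<le> ereal (V x + e1 / 2) + ereal (g x)" by (rule add_right_mono)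
            also have "\<dots> \<le> ereal (- \<eta>)" using e1(2)[OF xB] \<eta>(3) by (simp add: gF F_def)
            finally show ?thesis .
          qed
        qed
      qed
    qed
  qed
  \<comment> \<open>Since g x1 = -V x1 and x1 is a contact point, w + g exceeds -\<eta> near x1 for
    infinitely many indices, against the comparison just made.\<close>
  moreover have "\<exists>\<^sub>F j in sequentially. \<exists>y\<in>cball x1 \<rho>. w j y + ereal (g y) > ereal (- \<eta>)"
  proof -
    have "x1 \<in> cball x1 \<rho>" using \<rho> by simp
    then obtain d where d: "d > 0" "\<And>y. y \<in> cball x1 \<rho> \<Longrightarrow> dist y x1 < d \<Longrightarrow> dist (g y) (g x1) < \<eta> / 2"
      using cg \<eta>(1) unfolding continuous_on_iff by (meson half_gt_zero)
    have "\<eta> / 2 > 0" "min d \<rho> > 0" using \<eta> d \<rho> by auto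
    then have "\<exists>\<^sub>F j in sequentially. \<exists>y\<in>ball x1 (min d \<rho>). ereal (V x1 - \<eta> / 2) < w j y"
      using x1(3) unfolding attained_def V_def by blast
    then show ?thesis
    proof (rule frequently_elim1)
      fix j assume "\<exists>y\<in>ball x1 (min d \<rho>). ereal (V x1 - \<eta> / 2) < w j y"
      then obtain y where y: "y \<in> ball x1 (min d \<rho>)" "ereal (V x1 - \<eta> / 2) < w j y" by blast
      then have "y \<in> cball x1 \<rho>" "dist y x1 < d" by (auto simp: dist_commute)
      then have "g y > - V x1 - \<eta> / 2" using d(2)[of y, unfolded dist_real_def abs_less_iff gx1] by linarith
      then have "w j y + ereal (g y) > ereal (- \<eta>)" using y(2) by (cases "w j y") auto
      then show "\<exists>y\<in>cball x1 \<rho>. w j y + ereal (g y) > ereal (- \<eta>)" using \<open>y \<in> cball x1 \<rho>\<close> by blast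
    qed
  qed
  ultimately show False by (auto simp: frequently_def not_less elim: eventually_mono)
qed

text \<open>The bound \<Theta> K_p(|x|) is continuous away from 0, and small balls about nearby
  contact points lie in a ball about x.\<close>

lemma attained_closed:
  assumes x: "x \<noteq> 0" and lim: "\<And>d. d > 0 \<Longrightarrow> \<exists>y. dist y x < d \<and> attained y"
  shows "attained x"
  unfolding attained_def
proof safe
  fix e \<rho> :: real assume e: "e > 0" "\<rho> > 0"
  obtain d where d: "d > 0" "\<And>y. dist y x < d \<Longrightarrow> dist (\<Theta> * Kp p (norm y)) (\<Theta> * Kp p (norm x)) < e / 2"
    using isCont_Kp_norm[OF x] e(1) unfolding continuous_at_eps_delta by (metis half_gt_zero)
  obtain y where y: "dist y x < min d (\<rho> / 2)" "attained y" using lim[of "min d (\<rho>/2)"] d e by auto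
  have "\<exists>\<^sub>F j in sequentially. \<exists>v\<in>ball y (\<rho>/2). ereal (\<Theta> * Kp p (norm y) - e / 2) < w j v"
    using y(2) e unfolding attained_def by simp
  then show "\<exists>\<^sub>F j in sequentially. \<exists>v\<in>ball x \<rho>. ereal (\<Theta> * Kp p (norm x) - e) < w j v"
  proof (rule frequently_elim1)
    fix j assume "\<exists>v\<in>ball y (\<rho>/2). ereal (\<Theta> * Kp p (norm y) - e / 2) < w j v"
    then obtain v where v: "dist y v < \<rho> / 2" "ereal (\<Theta> * Kp p (norm y) - e / 2) < w j v" by auto
    have "\<Theta> * Kp p (norm x) - e < \<Theta> * Kp p (norm y) - e / 2" 
      using d(2)[of y, unfolded dist_real_def abs_less_iff] y(1) by linarith
    then have "ereal (\<Theta> * Kp p (norm x) - e) < w j v" using v(2) by (metis less_ereal.simps(1) order_less_trans)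
    moreover have "v \<in> ball x \<rho>" using v(1) y(1) dist_triangle[of x v y] by (simp add: dist_commute)
    ultimately show "\<exists>v\<in>ball x \<rho>. ereal (\<Theta> * Kp p (norm x) - e) < w j v" by blast
  qed
qed

text \<open>The contact set is relatively closed in W minus the origin, which is connected because p
  >= 2. If it were not open, a point y without contact, close to a contact point v, would have a
  nearest contact point x', where Hopf's argument applies.\<close>

lemma attained_plane:
  assumes W: "W \<in> GG" and x: "x \<in> W" "x \<noteq> 0" "attained x" and y: "y \<in> W" "y \<noteq> 0"
  shows "attained y"
proof -
  note sW = subspace_GG[OF W]
  let ?S = "W - {0}"
  let ?Z = "{v \<in> ?S. attained v}"
  have "aff_dim W = int p" using aff_dim_subspace[OF sW] dim_GG[OF W] by simp
  then have "\<not> collinear W" using p2 by (simp add: collinear_aff_dim)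
  then have conn: "connected ?S" using sW by (intro connected_convex_diff_countable subspace_imp_convex) auto
  have cl: "closedin (top_of_set ?S) ?Z"
    unfolding closedin_limpt
  proof safe
    fix v assume "v islimpt ?Z" "v \<in> W" "v \<noteq> 0"
    then show "attained v" by (intro attained_closed) (auto simp: islimpt_approachable)
  qed
  have op: "openin (top_of_set ?S) ?Z"
    unfolding openin_euclidean_subtopology_iff
  proof (intro conjI ballI)
    fix v assume "v \<in> ?Z"
    then have v: "v \<in> W" "v \<noteq> 0" "attained v" by auto
    show "\<exists>e>0. \<forall>y\<in>?S. dist y v < e \<longrightarrow> y \<in> ?Z"
    proof (intro exI[of _ "norm v / 4"] conjI ballI impI)
      fix y assume y: "y \<in> ?S" "dist y v < norm v / 4"
      show "y \<in> ?Z"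
      proof (rule ccontr)
        assume "y \<notin> ?Z"
        then have ny: "\<not> attained y" using y by auto
        \<comment> \<open>The radius |v|/2 keeps the origin out, and it is large enough for all
          points that are as close to y as the nearest contact point.\<close>
        let ?A = "{u \<in> W. attained u} \<inter> cball v (norm v / 2)"
        have nz: "u \<noteq> 0" if "u \<in> cball v (norm v / 2)" for u using that v(2) by auto
        have "closed ?A"
          unfolding closed_limpt
        proof safe
          fix u assume u: "u islimpt ?A"
          have "closed (W \<inter> cball v (norm v / 2))" using closed_subspace[OF sW] by auto
          moreover have "u islimpt (W \<inter> cball v (norm v / 2))" by (rule islimpt_subset[OF u]) auto
          ultimately show uu: "u \<in> W" "u \<in> cball v (norm v / 2)" unfolding closed_limpt by auto
          show "attained u" using u nz[OF uu(2)] by (intro attained_closed) (auto simp: islimpt_approachable)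
        qed
        moreover have "v \<in> ?A" using v by auto
        ultimately obtain x' where x': "x' \<in> ?A" "\<And>u. u \<in> ?A \<Longrightarrow> dist y x' \<le> dist y u"
          using distance_attains_inf[of ?A y] by blast
        define r where "r = dist y x'"
        have r: "r < norm v / 4" using x'(2)[OF \<open>v \<in> ?A\<close>] y(2) by (simp add: r_def)
        have "y \<noteq> x'" using ny x'(1) by auto
        \<comment> \<open>The ball centred at the midpoint with x' on its boundary lies in the ball
          about y through x' and meets the boundary of the latter only at x'. So it contains no
          other contact point.\<close>
        define z where "z = (1/2) *\<^sub>R (y + x')"
        have zx: "dist z x' = r / 2" "dist z y = r / 2"
        proof -
          have "z - x' = (1/2) *\<^sub>R (y - x')" "z - y = (1/2) *\<^sub>R (x' - y)"
            by (simp_all add: z_def vec_eq_iff field_simps)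
          then show "dist z x' = r / 2" "dist z y = r / 2" by (simp_all add: dist_norm r_def norm_minus_commute)
        qed
        show False
        proof (rule hopf_contact[OF W, of x' z])
          show "x' \<in> W" "x' \<noteq> 0" "attained x'" using x'(1) nz by auto
          show "z \<in> W" using sW y(1) x'(1) by (auto simp: z_def intro!: subspace_mul subspace_add)
          show "z \<noteq> x'" using zx(1) \<open>y \<noteq> x'\<close> by (auto simp: r_def)
          fix u assume u: "u \<in> W" "u \<noteq> 0" "dist z u \<le> dist z x'" "attained u"
          have yu: "dist y u \<le> r" using u(3) zx dist_triangle[of y u z] by (simp add: dist_commute)
          have "dist v u \<le> norm v / 2" using yu r y(2) dist_triangle[of v u y] by (simp add: dist_commute)
          then have "u \<in> ?A" using u by auto
          then have "dist y u = r" using x'(2)[of u] yu by (simp add: r_def)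
          \<comment> \<open>The parallelogram identity for u - z and z - y expresses the strict
            convexity of the ball.\<close>
          have "(norm (u - x'))\<^sup>2 = 2 * (norm (u - z))\<^sup>2 + 2 * (norm (z - y))\<^sup>2 - (norm (u - y))\<^sup>2"
          proof -
            have "u - x' = (u - z) - (z - y)" "u - y = (u - z) + (z - y)"
              by (simp_all add: z_def vec_eq_iff field_simps)
            moreover have "(norm (a - b))\<^sup>2 = 2 * (norm a)\<^sup>2 + 2 * (norm b)\<^sup>2 - (norm (a + b))\<^sup>2" for a b :: "real^'n"
              by (simp add: power2_norm_eq_inner inner_diff_left inner_diff_right inner_add_left inner_add_right inner_commute)
            ultimately show ?thesis by metis
          qed
          also have "\<dots> = 2 * (dist z u)\<^sup>2 + 2 * (dist z y)\<^sup>2 - (dist y u)\<^sup>2"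
            by (simp add: dist_norm norm_minus_commute)
          also have "\<dots> \<le> 2 * (r/2)\<^sup>2 + 2 * (r/2)\<^sup>2 - r\<^sup>2"
            unfolding zx(2) \<open>dist y u = r\<close> using u(3) unfolding zx(1)
            by (intro diff_right_mono add_right_mono mult_left_mono power_mono) auto
          also have "\<dots> = 0" by (simp add: power2_eq_square)
          finally show "u = x'" by simp
        qed
      qed
    qed (use v in auto)
  qed auto
  have "?Z = {} \<or> ?Z = ?S" using conn cl op unfolding connected_clopen by blast
  then show ?thesis using x y by blast
qed

text \<open>Otherwise compactness would give a common gap e0 below the bound on the whole unit
  sphere for all large indices, against \<open>touch_w\<close>.\<close>

lemma attained_sphere: "\<exists>x. norm x = 1 \<and> attained x"
proof -
  have "\<exists>\<^sub>F j in sequentially. \<exists>x. norm x = 1 \<and> ereal (\<Theta> * Kp p 1 - e) \<le> w j x" if "e > 0" for e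
    using touch_w[OF that] by (rule eventually_frequently[rotated]) auto
  show ?thesis
  proof (rule ccontr)
    assume no: "\<not> ?thesis"
    define below where "below x d e \<longleftrightarrow> (\<forall>\<^sub>F j in sequentially. \<forall>y\<in>ball x d. w j y \<le> ereal (\<Theta> * Kp p 1 - e))"
      for x :: "real^'n" and d e
    have "\<exists>d>0. \<exists>e>0. below x d e" if "x \<in> sphere 0 1" for x :: "real^'n"
    proof -
      have x: "\<not> attained x" "norm x = 1" using no that by auto
      show ?thesis
        by (rule not_attainedE[OF x(1)]) (use x(2) in \<open>auto simp: below_def\<close>)
    qed
    then obtain d e where de: "\<And>x::real^'n. x \<in> sphere 0 1 \<Longrightarrow> d x > 0" "\<And>x::real^'n. x \<in> sphere 0 1 \<Longrightarrow> e x > 0"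
      "\<And>x::real^'n. x \<in> sphere 0 1 \<Longrightarrow> below x (d x) (e x)"
      by metis
    note de3 = de(3)[unfolded below_def]
    have "sphere (0::real^'n) 1 \<subseteq> (\<Union>x\<in>sphere 0 1. ball x (d x))" using de(1) by auto
    then obtain X where X: "X \<subseteq> sphere 0 1" "finite X" "sphere (0::real^'n) 1 \<subseteq> (\<Union>x\<in>X. ball x (d x))"
      using compactE_image[OF compact_sphere[of "0::real^'n" 1], of "sphere 0 1" "\<lambda>x. ball x (d x)"] by auto
    define e0 where "e0 = Min (insert 1 (e ` X))"
    have e0: "e0 > 0" "\<And>x. x \<in> X \<Longrightarrow> e0 \<le> e x" using X(1,2) de(2) by (auto simp: e0_def)
    have "\<forall>\<^sub>F j in sequentially. \<forall>x\<in>X. \<forall>y\<in>ball x (d x). w j y \<le> ereal (\<Theta> * Kp p 1 - e x)"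
      by (rule eventually_ball_finite[OF X(2)], rule ballI, rule de3) (use X(1) in blast)
    moreover have "\<forall>\<^sub>F j in sequentially. \<exists>x. norm x = 1 \<and> ereal (\<Theta> * Kp p 1 - e0 / 2) \<le> w j x"
      using touch_w[of "e0 / 2"] e0 by simp
    ultimately have "\<forall>\<^sub>F j::nat in sequentially. False"
    proof eventually_elim
      case (elim j)
      then obtain y where y: "norm y = 1" "ereal (\<Theta> * Kp p 1 - e0 / 2) \<le> w j y" by blast
      then have "y \<in> sphere 0 1" by simp
      then obtain x where x: "x \<in> X" "y \<in> ball x (d x)" using X(3) by blast
      then have "w j y \<le> ereal (\<Theta> * Kp p 1 - e x)" using elim(1) by blast
      with y(2) have "ereal (\<Theta> * Kp p 1 - e0 / 2) \<le> ereal (\<Theta> * Kp p 1 - e x)" by order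
      then show False using e0(1) e0(2)[OF x(1)] by simp
    qed
    then show False by simp
  qed
qed

text \<open>Consecutive planes of a chain from a contact point to y share a nonzero vector, which
  hands the contact on to the next plane.\<close>

theorem attained_everywhere:
  assumes "y \<noteq> 0"
  shows "attained y"
proof -
  obtain x where x: "norm x = 1" "attained x" using attained_sphere by blast
  then have "x \<noteq> 0" by auto
  obtain Ws where Ws: "Ws \<noteq> []" "set Ws \<subseteq> GG" "x \<in> hd Ws" "y \<in> last Ws"
    "\<And>i. Suc i < length Ws \<Longrightarrow> dim (Ws ! i \<inter> Ws ! Suc i) > 0"
    using transitive_GG unfolding transitivity_property_def by metis
  have step: "\<exists>v\<in>Ws ! i. v \<noteq> 0 \<and> attained v" if "i < length Ws" for i
    using that
  proof (induction i)
    case 0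
    then show ?case using Ws(1,3) x \<open>x \<noteq> 0\<close> by (auto simp: hd_conv_nth)
  next
    case (Suc i)
    then obtain v where v: "v \<in> Ws ! i" "v \<noteq> 0" "attained v" by auto
    have "\<not> Ws ! i \<inter> Ws ! Suc i \<subseteq> {0}" using Ws(5)[OF Suc.prems] by (metis dim_eq_0 not_gr_zero)
    then obtain v' where v': "v' \<in> Ws ! i" "v' \<in> Ws ! Suc i" "v' \<noteq> 0" by blast
    have "Ws ! i \<in> GG" using Suc.prems Ws(2) by (simp add: subset_eq)
    then have "attained v'" using attained_plane v v' by blast
    then show ?case using v' by blast
  qed
  have l: "length Ws - 1 < length Ws" using Ws(1) by simp
  then obtain v where v: "v \<in> last Ws" "v \<noteq> 0" "attained v" using step[OF l] Ws(1) by (auto simp: last_conv_nth)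
  have "last Ws \<in> GG" using Ws(1,2) by auto
  then show ?thesis using attained_plane v Ws(4) assms by blast
qed

end

section \<open>Density and flow of a plurisubharmonic germ\<close>

locale psh_germ = G_setting GG p
  for GG :: "(real^'n) set set" and p :: nat +
  fixes \<Omega> :: "(real^'n) set" and u :: "real^'n \<Rightarrow> ereal" and R0 :: real
  assumes psh_u: "G_psh GG \<Omega> u" and open_dom: "open \<Omega>" and connected_dom: "connected \<Omega>"
    and nontrivial: "\<exists>x\<in>\<Omega>. u x \<noteq> -\<infinity>" and R0_pos: "R0 > 0" and R0_sub: "cball 0 R0 \<subseteq> \<Omega>"
begin

definition mm :: "real \<Rightarrow> real" where
  "mm r = real_of_ereal (Mmax u r)"

text \<open>The maximum is finite from above because it is attained, and from below because points
  with finite values are dense.\<close>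

lemma Mmax_attained:
  assumes r: "0 < r" "r \<le> R0"
  shows "Mmax u r = ereal (mm r)" "\<exists>x. norm x = r \<and> u x = ereal (mm r)"
proof -
  have sub: "cball 0 r \<subseteq> \<Omega>" using r R0_sub subset_cball by blast
  obtain x where x: "norm x = r" "u x = Mmax u r" using max_on_sphere[OF psh_u sub r(1)] by blast
  have "x \<in> cball 0 r" using x(1) by simp
  then have "u x \<noteq> \<infinity>" using psh_u sub by (auto simp: G_psh_def)
  have "ball 0 r \<subseteq> \<Omega>" using sub ball_subset_cball by blast
  then obtain y where y: "y \<in> ball 0 r" "u y \<noteq> -\<infinity>"
    using not_minus_infinity_dense[OF psh_u open_dom connected_dom nontrivial, of "ball 0 r"] r(1) by auto
  have "u y \<le> Mmax u r" unfolding Mmax_def using y(1) by (intro SUP_upper) auto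
  then have "Mmax u r \<noteq> -\<infinity>" using y(2) by auto
  then show "Mmax u r = ereal (mm r)" using \<open>u x \<noteq> \<infinity>\<close> x(2) by (auto simp: mm_def ereal_real)
  then show "\<exists>x. norm x = r \<and> u x = ereal (mm r)" using x by auto
qed

lemma u_le_mm:
  assumes "0 < r" "r \<le> R0" "norm x \<le> r"
  shows "u x \<le> ereal (mm r)"
  unfolding Mmax_attained(1)[OF assms(1,2), symmetric] Mmax_def using assms(3) by (intro SUP_upper) auto

lemma mm_mono:
  assumes "0 < r" "r \<le> s" "s \<le> R0"
  shows "mm r \<le> mm s"
proof -
  obtain x where "norm x = r" "u x = ereal (mm r)" using Mmax_attained(2)[of r] assms by auto
  then show ?thesis using u_le_mm[of s x] assms by simp
qed

section \<open>Convexity of the maximum in K_p, and the density\<close>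

definition slope :: "real \<Rightarrow> real \<Rightarrow> real" where
  "slope r s = (mm s - mm r) / (Kp p s - Kp p r)"

lemma slope_nonneg: "0 < r \<Longrightarrow> r < s \<Longrightarrow> s \<le> R0 \<Longrightarrow> slope r s \<ge> 0"
  using mm_mono[of r s] Kp_strict_mono[OF p2, of r s] by (simp add: slope_def)

lemma mm_diff: "0 < r \<Longrightarrow> r < s \<Longrightarrow> mm s - mm r = slope r s * (Kp p s - Kp p r)"
  using Kp_strict_mono[OF p2, of r s] by (simp add: slope_def)

text \<open>The three-slope form of convexity. On the annulus u is compared with the affine function
  of K_p that takes the values \<open>mm r\<close> and \<open>mm t\<close> at the ends; b is its
  slope.\<close>

lemma slope_mono:
  assumes "0 < r" "r < s" "s < t" "t \<le> R0"
  shows "slope r s \<le> slope s t"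
proof -
  have sub: "cball 0 t \<subseteq> \<Omega>" using assms R0_sub subset_cball by blast
  note K = Kp_strict_mono[OF p2, of r s] Kp_strict_mono[OF p2, of s t] Kp_strict_mono[OF p2, of r t]
  define b where "b = slope r t"
  have b: "b \<ge> 0" "mm t - mm r = b * (Kp p t - Kp p r)"
    using slope_nonneg mm_diff assms by (auto simp: b_def)
  obtain x where x: "norm x = s" "u x = ereal (mm s)" using Mmax_attained(2)[of s] assms by auto
  have "u x \<le> ereal ((mm r - b * Kp p r) + b * Kp p (norm x))"
  proof (rule annulus_comparison[OF psh_u sub assms(1) _ b(1)])
    show "u y \<le> ereal ((mm r - b * Kp p r) + b * Kp p r)" if "norm y = r" for y
      using u_le_mm[of r y] assms that by simp
    have "(mm r - b * Kp p r) + b * Kp p t = mm t" using b(2) by (simp add: algebra_simps)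
    then show "u y \<le> ereal ((mm r - b * Kp p r) + b * Kp p t)" if "norm y = t" for y
      using u_le_mm[of t y] assms that by simp
  qed (use x assms in auto)
  then have le: "mm s \<le> mm r + b * (Kp p s - Kp p r)" using x by (simp add: algebra_simps)
  then have "slope r s \<le> b" using K assms by (simp add: slope_def divide_le_eq algebra_simps)
  moreover have "b \<le> slope s t"
    using le b(2) K assms by (simp add: slope_def le_divide_eq algebra_simps)
  ultimately show ?thesis by simp
qed

text \<open>Slopes increase with the radii, so their limit at 0 is their infimum. Defined this way,
  \<Theta> lies below every slope, at every scale.\<close>

definition \<Theta> :: real where
  "\<Theta> = Inf {slope r s |r s. 0 < r \<and> r < s \<and> s \<le> R0}"

lemma slopes_ne: "{slope r s |r s. 0 < r \<and> r < s \<and> s \<le> R0} \<noteq> {}"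
proof -
  have "slope (R0 / 2) R0 \<in> {slope r s |r s. 0 < r \<and> r < s \<and> s \<le> R0}"
    by (rule CollectI, rule exI[of _ "R0 / 2"], rule exI[of _ R0]) (use R0_pos in auto)
  then show ?thesis by blast
qed

lemma Theta_le: "0 < r \<Longrightarrow> r < s \<Longrightarrow> s \<le> R0 \<Longrightarrow> \<Theta> \<le> slope r s"
  unfolding \<Theta>_def by (intro cInf_lower bdd_belowI[of _ 0]) (auto simp: slope_nonneg)

lemma Theta_ge_0: "\<Theta> \<ge> 0"
  unfolding \<Theta>_def using slopes_ne by (intro cInf_greatest) (auto simp: slope_nonneg)

text \<open>One slope near the infimum, taken over r0 and s0, dominates all slopes at radii below
  r0: monotonicity is applied twice, through the pair s and r0.\<close>

lemma slope_less:
  assumes "\<epsilon> > 0"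
  obtains \<delta> where "\<delta> > 0" "\<delta> \<le> R0" "\<And>r s. 0 < r \<Longrightarrow> r < s \<Longrightarrow> s < \<delta> \<Longrightarrow> slope r s < \<Theta> + \<epsilon>"
proof -
  have "\<exists>x\<in>{slope r s |r s. 0 < r \<and> r < s \<and> s \<le> R0}. x < \<Theta> + \<epsilon>"
    by (rule cInf_lessD[OF slopes_ne]) (use assms in \<open>simp add: \<Theta>_def\<close>)
  then obtain r0 s0 where rs: "0 < r0" "r0 < s0" "s0 \<le> R0" "slope r0 s0 < \<Theta> + \<epsilon>" by blast
  have "slope r s < \<Theta> + \<epsilon>" if "0 < r" "r < s" "s < r0" for r s
    using slope_mono[of r s r0] slope_mono[of s r0 s0] that rs by linarith
  then show ?thesis using that[of r0] rs by simp
qed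

lemma mm_approx:
  assumes "\<epsilon> > 0"
  obtains \<delta> where "\<delta> > 0" "\<delta> \<le> R0"
    "\<And>r s. 0 < r \<Longrightarrow> 0 < s \<Longrightarrow> r < \<delta> \<Longrightarrow> s < \<delta> \<Longrightarrow> \<bar>mm r - mm s - \<Theta> * (Kp p r - Kp p s)\<bar> \<le> \<epsilon> * \<bar>Kp p r - Kp p s\<bar>"
proof -
  obtain \<delta> where \<delta>: "\<delta> > 0" "\<delta> \<le> R0" "\<And>r s. 0 < r \<Longrightarrow> r < s \<Longrightarrow> s < \<delta> \<Longrightarrow> slope r s < \<Theta> + \<epsilon>"
    using slope_less[OF assms] by blast
  have lt: "\<bar>mm s - mm r - \<Theta> * (Kp p s - Kp p r)\<bar> \<le> \<epsilon> * \<bar>Kp p s - Kp p r\<bar>" if "0 < r" "r < s" "s < \<delta>" for r s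
  proof -
    have "mm s - mm r - \<Theta> * (Kp p s - Kp p r) = (slope r s - \<Theta>) * (Kp p s - Kp p r)"
      using mm_diff[OF that(1,2)] by (simp add: algebra_simps)
    moreover have "\<bar>slope r s - \<Theta>\<bar> \<le> \<epsilon>" using \<delta>(2) \<delta>(3)[OF that] Theta_le[of r s] that by simp
    ultimately show ?thesis by (simp add: abs_mult mult_right_mono)
  qed
  have "\<bar>mm r - mm s - \<Theta> * (Kp p r - Kp p s)\<bar> \<le> \<epsilon> * \<bar>Kp p r - Kp p s\<bar>"
    if "0 < r" "0 < s" "r < \<delta>" "s < \<delta>" for r s
  proof -
    consider "r < s" | "r = s" | "s < r" by linarith
    then show ?thesis
    proof cases
      case 1
      have "mm r - mm s - \<Theta> * (Kp p r - Kp p s) = - (mm s - mm r - \<Theta> * (Kp p s - Kp p r))" by (simp add: algebra_simps)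
      then show ?thesis using lt[OF that(1) \<open>r < s\<close> that(4)] by (simp only: abs_minus_cancel abs_minus_commute[of "Kp p r"])
    qed (use lt[of s r] that in auto)
  qed
  then show ?thesis using that \<delta> by blast
qed

lemma has_density_Theta: "has_density p u \<Theta>"
  unfolding has_density_def
proof (intro allI impI)
  fix \<epsilon> :: real assume "\<epsilon> > 0"
  then obtain \<delta> where \<delta>: "\<delta> > 0" "\<delta> \<le> R0" "\<And>r s. 0 < r \<Longrightarrow> r < s \<Longrightarrow> s < \<delta> \<Longrightarrow> slope r s < \<Theta> + \<epsilon>"
    using slope_less by blast
  show "\<exists>\<delta>>0. \<forall>r s. 0 < r \<and> r < s \<and> s < \<delta> \<longrightarrow>
      \<bar>(Mmax u r - Mmax u s) / ereal (Kp p r - Kp p s) - ereal \<Theta>\<bar> < ereal \<epsilon>"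
  proof (intro exI[of _ \<delta>] conjI allI impI \<delta>(1))
    fix r s assume rs: "0 < r \<and> r < s \<and> s < \<delta>"
    then have K: "Kp p r - Kp p s \<noteq> 0" using Kp_strict_mono[OF p2, of r s] by simp
    have "(Mmax u r - Mmax u s) / ereal (Kp p r - Kp p s) = ereal ((mm r - mm s) / (Kp p r - Kp p s))"
      using Mmax_attained(1)[of r] Mmax_attained(1)[of s] rs \<delta>(2) K by simp
    also have "(mm r - mm s) / (Kp p r - Kp p s) = slope r s"
      unfolding slope_def by (metis minus_diff_eq minus_divide_divide)
    finally show "\<bar>(Mmax u r - Mmax u s) / ereal (Kp p r - Kp p s) - ereal \<Theta>\<bar> < ereal \<epsilon>"
      using \<delta>(2,3) Theta_le[of r s] rs \<open>\<epsilon> > 0\<close> by (simp add: abs_less_iff) (smt (verit))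
  qed
qed

section \<open>The maxima of the rescaled functions and their limit\<close>

definition flowb :: "real \<Rightarrow> real" where
  "flowb r = (if p \<noteq> 2 then 0 else - mm r)"

text \<open>The maximum of the rescaled function over the ball of radius t;
  \<open>flow_le_mw\<close> and \<open>flow_attains_mw\<close> justify this reading.\<close>

definition mw :: "real \<Rightarrow> real \<Rightarrow> real" where
  "mw r t = flowc p r * mm (r * t) + flowb r"

lemma flow_eq:
  assumes "0 < r" "r \<le> R0"
  shows "flow p u r x = ereal (flowc p r) * u (r *\<^sub>R x) + ereal (flowb r)"
  using Mmax_attained(1)[OF assms]
  by (cases "u (r *\<^sub>R x)") (auto simp: flow_def flowc_def flowb_def one_ereal_def[symmetric] zero_ereal_def[symmetric])

lemma flow_psh:
  assumes "0 < r" "r \<le> R0"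
  shows "G_psh GG ((\<lambda>x. r *\<^sub>R x) -` \<Omega>) (flow p u r)"
proof -
  have "flow p u r = (\<lambda>x. ereal (flowc p r) * u (r *\<^sub>R x) + ereal (flowb r))"
    using flow_eq[OF assms] by auto
  then show ?thesis using G_psh_rescale[OF psh_u assms(1) flowc_pos[OF assms(1)] subspace_GG] by simp
qed

lemma flow_dom:
  assumes "0 < r" "r * \<rho> \<le> R0"
  shows "cball 0 \<rho> \<subseteq> (\<lambda>x. r *\<^sub>R x) -` \<Omega>"
proof
  fix x :: "real^'n" assume "x \<in> cball 0 \<rho>"
  then have "r * norm x \<le> r * \<rho>" using assms(1) by (intro mult_left_mono) auto
  then have "r * norm x \<le> R0" using assms(2) by linarith
  then have "r *\<^sub>R x \<in> cball 0 R0" using assms(1) by simp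
  then show "x \<in> (\<lambda>x. r *\<^sub>R x) -` \<Omega>" using R0_sub by auto
qed

lemma flow_le_mw:
  assumes r: "0 < r" "r \<le> R0" "r * t \<le> R0" and t: "0 < t" "norm x \<le> t"
  shows "flow p u r x \<le> ereal (mw r t)"
proof -
  have "u (r *\<^sub>R x) \<le> ereal (mm (r * t))" using r t by (intro u_le_mm) (auto intro!: mult_left_mono)
  then have "ereal (flowc p r) * u (r *\<^sub>R x) \<le> ereal (flowc p r) * ereal (mm (r * t))"
    using less_imp_le[OF flowc_pos[OF r(1)]] by (intro ereal_mult_left_mono) auto
  then have "ereal (flowc p r) * u (r *\<^sub>R x) + ereal (flowb r) \<le> ereal (flowc p r) * ereal (mm (r * t)) + ereal (flowb r)"
    by (rule add_right_mono)
  then show ?thesis by (simp add: flow_eq[OF r(1,2)] mw_def)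
qed

lemma flow_attains_mw:
  assumes r: "0 < r" "r \<le> R0" "r * t \<le> R0" and t: "0 < t"
  shows "\<exists>x. norm x = t \<and> flow p u r x = ereal (mw r t)"
proof -
  obtain x where x: "norm x = r * t" "u x = ereal (mm (r * t))" using Mmax_attained(2)[of "r * t"] r t by auto
  have "norm ((1 / r) *\<^sub>R x) = t" using x(1) r(1) by simp
  moreover have "flow p u r ((1 / r) *\<^sub>R x) = ereal (mw r t)"
    using x r(1) by (simp add: flow_eq[OF r(1,2)] mw_def)
  ultimately show ?thesis by blast
qed

text \<open>No limit is involved: \<Theta> is below all slopes, and \<open>Kp_scale\<close> moves
  the inequality from scale r to scale 1.\<close>

lemma mw_diff:
  assumes r: "0 < r" "r * t \<le> R0" and t: "0 < s" "s \<le> t"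
  shows "\<Theta> * (Kp p t - Kp p s) \<le> mw r t - mw r s"
proof (cases "s = t")
  case False
  have rs: "r * s < r * t" "0 < r * s" using False r t by auto
  have "mw r t - mw r s = flowc p r * (mm (r * t) - mm (r * s))" by (simp add: mw_def algebra_simps)
  also have "\<dots> = slope (r * s) (r * t) * (flowc p r * (Kp p (r * t) - Kp p (r * s)))"
    using mm_diff[OF rs(2,1)] by simp
  also have "\<dots> = slope (r * s) (r * t) * (Kp p t - Kp p s)" using Kp_scale[of r t s p] r t by simp
  finally show ?thesis
    using Theta_le[OF rs(2,1) r(2)] Kp_mono[OF p2 t] by (simp add: mult_right_mono)
qed simp

text \<open>The error at the outer radius R, of either sign. By \<open>mw_diff\<close> it also
  bounds the error from above at all smaller radii.\<close>

definition excess :: "real \<Rightarrow> real \<Rightarrow> real" where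
  "excess R r = mw r R - \<Theta> * Kp p R"

lemma mw_le: "0 < r \<Longrightarrow> r * R \<le> R0 \<Longrightarrow> 0 < t \<Longrightarrow> t \<le> R \<Longrightarrow> mw r t \<le> \<Theta> * Kp p t + excess R r"
  using mw_diff[of r R t] by (simp add: excess_def algebra_simps)

lemma flow_le:
  assumes "0 < r" "r \<le> R0" "r * R \<le> R0" "x \<noteq> 0" "norm x \<le> R"
  shows "flow p u r x \<le> ereal (\<Theta> * Kp p (norm x) + excess R r)"
proof -
  have "r * norm x \<le> R0" using assms mult_left_mono[of "norm x" R r] by linarith
  then have "flow p u r x \<le> ereal (mw r (norm x))" using assms by (intro flow_le_mw) auto
  also have "\<dots> \<le> ereal (\<Theta> * Kp p (norm x) + excess R r)" using mw_le[of r R "norm x"] assms by simp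
  finally show ?thesis .
qed

text \<open>For p = 2 the flow is normalised to maximum 0 = ln 1. For p > 2 compare
  \<open>mm r\<close> with a fixed \<open>mm b\<close>: multiplication by c = r^(p-2) makes all
  terms in b vanish in the limit, while c K_p(r) = -1.\<close>

lemma mw_1_limit: "((\<lambda>r. mw r 1) \<longlongrightarrow> \<Theta> * Kp p 1) (at_right 0)"
proof (cases "p = 2")
  case True
  then show ?thesis unfolding mw_def flowc_def flowb_def Kp_def by simp
next
  case False
  show ?thesis
  proof (rule tendstoI)
    fix e :: real assume e: "e > 0"
    define \<epsilon> where "\<epsilon> = e / 4"
    have \<epsilon>: "\<epsilon> > 0" using e by (simp add: \<epsilon>_def)
    obtain \<delta> where \<delta>: "\<delta> > 0" "\<delta> \<le> R0"
      "\<And>r s. 0 < r \<Longrightarrow> 0 < s \<Longrightarrow> r < \<delta> \<Longrightarrow> s < \<delta> \<Longrightarrow> \<bar>mm r - mm s - \<Theta> * (Kp p r - Kp p s)\<bar> \<le> \<epsilon> * \<bar>Kp p r - Kp p s\<bar>"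
      using mm_approx[OF \<epsilon>] by blast
    define b where "b = \<delta> / 2"
    have b: "0 < b" "b < \<delta>" using \<delta> by (auto simp: b_def)
    have "((\<lambda>r. r powr (real p - 2)) \<longlongrightarrow> 0 powr (real p - 2)) (at_right 0)"
      using False p2 by (intro tendsto_powr' tendsto_intros) (auto simp: eventually_at_right_less intro: eventually_mono[OF eventually_at_right_less])
    then have "((\<lambda>r. r powr (real p - 2) * (\<bar>mm b\<bar> + (\<Theta> + \<epsilon>) * \<bar>Kp p b\<bar>)) \<longlongrightarrow> 0 * (\<bar>mm b\<bar> + (\<Theta> + \<epsilon>) * \<bar>Kp p b\<bar>)) (at_right 0)"
      by (intro tendsto_intros) simp
    then have "\<forall>\<^sub>F r in at_right 0. r powr (real p - 2) * (\<bar>mm b\<bar> + (\<Theta> + \<epsilon>) * \<bar>Kp p b\<bar>) < \<epsilon>"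
      using \<epsilon> by (intro order_tendstoD) auto
    moreover have "\<forall>\<^sub>F r in at_right 0. r < \<delta>" using \<delta>(1) by (rule order_tendstoD[OF tendsto_ident_at])
    ultimately show "\<forall>\<^sub>F r in at_right 0. dist (mw r 1) (\<Theta> * Kp p 1) < e"
      using eventually_at_right_less[of 0]
    proof eventually_elim
      case (elim r)
      define c where "c = r powr (real p - 2)"
      have c: "c > 0" "c * Kp p r = - 1" using elim(3) False by (auto simp: c_def Kp_def simp flip: powr_add)
      have "c * \<bar>mm r - mm b - \<Theta> * (Kp p r - Kp p b)\<bar> \<le> c * (\<epsilon> * \<bar>Kp p r - Kp p b\<bar>)"
        using \<delta>(3)[of r b] elim b c by (intro mult_left_mono) auto
      moreover have "c * \<bar>mm r - mm b - \<Theta> * (Kp p r - Kp p b)\<bar> = \<bar>c * mm r - c * mm b + \<Theta> + \<Theta> * (c * Kp p b)\<bar>"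
      proof -
        have "c * (mm r - mm b - \<Theta> * (Kp p r - Kp p b)) = c * mm r - c * mm b - \<Theta> * (c * Kp p r) + \<Theta> * (c * Kp p b)"
          by (simp add: algebra_simps)
        also have "\<dots> = c * mm r - c * mm b + \<Theta> + \<Theta> * (c * Kp p b)" by (simp add: c(2))
        finally show ?thesis using c(1) by (metis abs_mult abs_of_pos)
      qed
      moreover have "c * \<bar>Kp p r - Kp p b\<bar> = \<bar>- 1 - c * Kp p b\<bar>"
        using c(1) c(2)[symmetric] by (metis abs_mult abs_of_pos right_diff_distrib)
      then have "c * (\<epsilon> * \<bar>Kp p r - Kp p b\<bar>) \<le> \<epsilon> * (1 + c * \<bar>Kp p b\<bar>)"
        using \<epsilon> c(1) abs_triangle_ineq4[of "-1" "c * Kp p b"] by (simp add: abs_mult mult.left_commute)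
      moreover have "\<bar>\<Theta> * (c * Kp p b)\<bar> = c * (\<Theta> * \<bar>Kp p b\<bar>)" "\<bar>c * mm b\<bar> = c * \<bar>mm b\<bar>"
        using c(1) Theta_ge_0 by (auto simp: abs_mult)
      moreover have "c * \<bar>mm b\<bar> + c * (\<Theta> * \<bar>Kp p b\<bar>) + \<epsilon> * (c * \<bar>Kp p b\<bar>) < \<epsilon>"
        using elim(1) by (simp add: c_def algebra_simps)
      moreover have "\<bar>A + \<Theta>\<bar> \<le> \<bar>A - B + \<Theta> + T\<bar> + \<bar>T\<bar> + \<bar>B\<bar>" for A B T :: real by linarith
      note this[of "c * mm r" "c * mm b" "\<Theta> * (c * Kp p b)"]
      moreover have "\<epsilon> * (1 + c * \<bar>Kp p b\<bar>) = \<epsilon> + \<epsilon> * (c * \<bar>Kp p b\<bar>)" by (simp add: distrib_left)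
      ultimately have "\<bar>c * mm r + \<Theta>\<bar> < 3 * \<epsilon>" using \<epsilon> by linarith
      moreover have "mw r 1 = c * mm r" "Kp p 1 = - 1" using False by (auto simp: mw_def c_def flowc_def flowb_def Kp_def)
      ultimately show ?case using \<epsilon> by (simp add: dist_real_def \<epsilon>_def)
    qed
  qed
qed

text \<open>Differences of \<open>mw\<close> are slopes near 0 times differences of K_p, so the
  limit at t = 1 determines the others.\<close>

lemma mw_limit:
  assumes t: "t > 0"
  shows "((\<lambda>r. mw r t) \<longlongrightarrow> \<Theta> * Kp p t) (at_right 0)"
proof -
  have "((\<lambda>r. mw r t - mw r 1) \<longlongrightarrow> \<Theta> * (Kp p t - Kp p 1)) (at_right 0)"
  proof (rule tendstoI)
    fix e :: real assume e: "e > 0"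
    define \<epsilon> where "\<epsilon> = e / (\<bar>Kp p t - Kp p 1\<bar> + 1)"
    have \<epsilon>: "\<epsilon> > 0" using e by (simp add: \<epsilon>_def add_nonneg_pos)
    obtain \<delta> where \<delta>: "\<delta> > 0" "\<delta> \<le> R0"
      "\<And>r s. 0 < r \<Longrightarrow> 0 < s \<Longrightarrow> r < \<delta> \<Longrightarrow> s < \<delta> \<Longrightarrow> \<bar>mm r - mm s - \<Theta> * (Kp p r - Kp p s)\<bar> \<le> \<epsilon> * \<bar>Kp p r - Kp p s\<bar>"
      using mm_approx[OF \<epsilon>] by blast
    have "\<forall>\<^sub>F r in at_right 0. r < min \<delta> (\<delta> / t)" using \<delta>(1) t by (intro order_tendstoD[OF tendsto_ident_at]) auto
    then show "\<forall>\<^sub>F r in at_right 0. dist (mw r t - mw r 1) (\<Theta> * (Kp p t - Kp p 1)) < e"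
      using eventually_at_right_less[of 0]
    proof eventually_elim
      case (elim r)
      then have r: "0 < r" "r < \<delta>" "r * t < \<delta>" using t by (auto simp: field_simps)
      have c: "flowc p r > 0" using flowc_pos[OF r(1)] .
      have K: "flowc p r * (Kp p (r * t) - Kp p r) = Kp p t - Kp p 1" using Kp_scale[of r t 1 p] r t by simp
      have "mw r t - mw r 1 - \<Theta> * (Kp p t - Kp p 1) = flowc p r * (mm (r * t) - mm r - \<Theta> * (Kp p (r * t) - Kp p r))"
        unfolding K[symmetric] by (simp add: mw_def algebra_simps)
      then have "\<bar>mw r t - mw r 1 - \<Theta> * (Kp p t - Kp p 1)\<bar> = flowc p r * \<bar>mm (r * t) - mm r - \<Theta> * (Kp p (r * t) - Kp p r)\<bar>"
        using c by (simp add: abs_mult)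
      also have "\<dots> \<le> flowc p r * (\<epsilon> * \<bar>Kp p (r * t) - Kp p r\<bar>)"
        using \<delta>(3)[of "r * t" r] r t c by (intro mult_left_mono) auto
      also have "\<dots> = \<epsilon> * \<bar>Kp p t - Kp p 1\<bar>" using c unfolding K[symmetric] by (simp add: abs_mult)
      also have "\<dots> < e" using e unfolding \<epsilon>_def by (simp add: divide_less_eq add_nonneg_pos)
      finally show ?case by (simp add: dist_real_def)
    qed
  qed
  from tendsto_add[OF this mw_1_limit] show ?thesis by (simp add: algebra_simps)
qed

lemma excess_limit: "R > 0 \<Longrightarrow> (excess R \<longlongrightarrow> 0) (at_right 0)"
  using tendsto_diff[OF mw_limit[of R] tendsto_const[of "\<Theta> * Kp p R"]] unfolding excess_def by auto

lemma scales_at_right: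
  fixes r :: "nat \<Rightarrow> real"
  assumes "\<And>j. r j > 0" "r \<longlonglongrightarrow> 0"
  shows "filterlim r (at_right 0) sequentially"
proof -
  have "r j \<noteq> 0" for j using assms(1)[of j] by simp
  then show ?thesis using assms by (auto simp: filterlim_at)
qed

lemma scales_small:
  assumes "r \<longlonglongrightarrow> 0" "\<rho> > 0"
  shows "\<forall>\<^sub>F j in sequentially. r j \<le> R0 \<and> r j * \<rho> \<le> R0"
proof -
  have "\<forall>\<^sub>F j in sequentially. r j < min R0 (R0 / \<rho>)"
    using assms(2) R0_pos by (intro order_tendstoD(2)[OF assms(1)]) auto
  then show ?thesis using assms(2) by (auto elim!: eventually_mono simp: field_simps)
qed

lemma flow_G_sequence:
  assumes r: "\<And>j. r j > 0" "r \<longlonglongrightarrow> 0"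
  shows "G_sequence GG p (\<lambda>j. flow p u (r j)) \<Theta>"
proof
  note lim = scales_at_right[OF r] and small = scales_small[OF r(2)]
  show "\<Theta> \<ge> 0" by (rule Theta_ge_0)
  fix \<rho> :: real assume \<rho>: "\<rho> > 0"
  show "\<forall>\<^sub>F j in sequentially. \<exists>D. G_psh GG D (flow p u (r j)) \<and> cball 0 \<rho> \<subseteq> D"
    using small[OF \<rho>]
  proof eventually_elim
    case (elim j)
    then show ?case using flow_psh[of "r j"] flow_dom[of "r j" \<rho>] r(1)[of j] by blast
  qed
next
  note lim = scales_at_right[OF r] and small = scales_small[OF r(2)]
  fix \<rho> e :: real assume \<rho>: "\<rho> > 0" and e: "e > 0"
  have "(\<lambda>j. excess \<rho> (r j)) \<longlonglongrightarrow> 0" using filterlim_compose[OF excess_limit[OF \<rho>] lim] .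
  then have "\<forall>\<^sub>F j in sequentially. excess \<rho> (r j) < e" using e by (intro order_tendstoD) auto
  then show "\<forall>\<^sub>F j in sequentially. \<forall>x\<in>cball 0 \<rho>. x \<noteq> 0 \<longrightarrow> flow p u (r j) x \<le> ereal (\<Theta> * Kp p (norm x) + e)"
    using small[OF \<rho>]
  proof eventually_elim
    case (elim j)
    show ?case
    proof (intro ballI impI)
      fix x :: "real^'n" assume "x \<in> cball 0 \<rho>" "x \<noteq> 0"
      then have "flow p u (r j) x \<le> ereal (\<Theta> * Kp p (norm x) + excess \<rho> (r j))"
        using elim r(1)[of j] by (intro flow_le) auto
      also have "\<dots> \<le> ereal (\<Theta> * Kp p (norm x) + e)" using elim by simp
      finally show "flow p u (r j) x \<le> ereal (\<Theta> * Kp p (norm x) + e)" .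
    qed
  qed
next
  note lim = scales_at_right[OF r]
  fix e :: real assume e: "e > 0"
  have "(\<lambda>j. mw (r j) 1) \<longlonglongrightarrow> \<Theta> * Kp p 1" using filterlim_compose[OF mw_limit[of 1] lim] by simp
  then have "\<forall>\<^sub>F j in sequentially. \<Theta> * Kp p 1 - e < mw (r j) 1" using e by (intro order_tendstoD) auto
  moreover have "\<forall>\<^sub>F j in sequentially. r j < R0" using R0_pos by (intro order_tendstoD(2)[OF r(2)])
  ultimately show "\<forall>\<^sub>F j in sequentially. \<exists>x. norm x = 1 \<and> ereal (\<Theta> * Kp p 1 - e) \<le> flow p u (r j) x"
  proof eventually_elim
    case (elim j)
    then obtain x where "norm x = 1" "flow p u (r j) x = ereal (mw (r j) 1)"
      using flow_attains_mw[of "r j" 1] r(1)[of j] by auto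
    then show ?case using elim by (auto intro!: exI[of _ x])
  qed
qed

end

section \<open>Convergence in the mean\<close>

lemma usc_measurable:
  fixes u :: "'a::euclidean_space \<Rightarrow> ereal"
  assumes "usc_on S u" "S \<in> sets borel"
  shows "(\<lambda>x. if x \<in> S then u x else 0) \<in> borel_measurable borel"
proof (rule borel_measurableI_less)
  fix c
  obtain T where T: "open T" "{x\<in>S. u x < c} = S \<inter> T"
    using assms(1) by (auto simp: usc_on_openin openin_open)
  have "{x \<in> space borel. (if x \<in> S then u x else 0) < c} = (S \<inter> T) \<union> (if 0 < c then - S else {})"
    using T(2) by auto
  also have "\<dots> \<in> sets borel" using assms(2) T(1) by auto
  finally show "{x \<in> space borel. (if x \<in> S then u x else 0) < c} \<in> sets borel" .
qed

text \<open>Integrating a bound on all small balls over their centres (Fubini) avoids a covering argument.\<close>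
lemma nn_integral_from_local:
  fixes F :: "'a::euclidean_space \<Rightarrow> ennreal"
  assumes F[measurable]: "F \<in> borel_measurable borel" and Y[measurable]: "Y \<in> sets borel" and A[measurable]: "A \<in> sets borel"
    and YA: "\<And>y. y \<in> Y \<Longrightarrow> cball y s \<subseteq> A"
    and bound: "\<And>x. x \<in> A \<Longrightarrow> (\<integral>\<^sup>+y\<in>cball x s. F y \<partial>lborel) \<le> B"
  shows "(\<integral>\<^sup>+y\<in>Y. F y \<partial>lborel) * emeasure lborel (cball (0::'a) s) \<le> B * emeasure lborel A"
proof -
  have vol: "emeasure lborel (cball y s) = emeasure lborel (cball (0::'a) s)" for y :: 'a
    by (cases "s \<ge> 0") (simp_all add: emeasure_cball)
  have [measurable]: "Measurable.pred (borel \<Otimes>\<^sub>M borel) (\<lambda>z. dist (fst z) (snd z :: 'a) \<le> s)" by measurable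
  define k where "k x y = (indicator A x * (if dist x y \<le> s then F y * indicator Y y else 0) :: ennreal)" for x y
  have [measurable]: "(\<lambda>(x, y). k x y) \<in> borel_measurable (borel \<Otimes>\<^sub>M borel)"
    unfolding k_def case_prod_beta by measurable
  have "(\<integral>\<^sup>+y\<in>Y. F y \<partial>lborel) * emeasure lborel (cball (0::'a) s) = (\<integral>\<^sup>+y. (F y * indicator Y y) * emeasure lborel (cball (0::'a) s) \<partial>lborel)"
    by (rule nn_integral_multc[symmetric]) measurable
  also have "\<dots> = (\<integral>\<^sup>+y. (\<integral>\<^sup>+x. k x y \<partial>lborel) \<partial>lborel)"
  proof (rule nn_integral_cong)
    fix y
    have "(\<integral>\<^sup>+x. k x y \<partial>lborel) = (\<integral>\<^sup>+x. (F y * indicator Y y) * indicator (cball y s) x \<partial>lborel)"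
    proof (rule nn_integral_cong)
      fix x
      have "x \<in> A" if "y \<in> Y" "dist x y \<le> s" using YA[OF that(1)] that(2) by (auto simp: dist_commute)
      then show "k x y = (F y * indicator Y y) * indicator (cball y s) x"
        by (auto simp: k_def dist_commute split: split_indicator)
    qed
    also have "\<dots> = (F y * indicator Y y) * emeasure lborel (cball y s)"
      by (rule nn_integral_cmult_indicator) simp
    finally show "(F y * indicator Y y) * emeasure lborel (cball (0::'a) s) = (\<integral>\<^sup>+x. k x y \<partial>lborel)"
      unfolding vol[of y] by (rule sym)
  qed
  also have "\<dots> = (\<integral>\<^sup>+x. (\<integral>\<^sup>+y. k x y \<partial>lborel) \<partial>lborel)"
    by (rule lborel_pair.Fubini') simp
  also have "\<dots> \<le> (\<integral>\<^sup>+x. B * indicator A x \<partial>lborel)"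
  proof (rule nn_integral_mono)
    fix x
    show "(\<integral>\<^sup>+y. k x y \<partial>lborel) \<le> B * indicator A x"
    proof (cases "x \<in> A")
      case True
      have "(\<integral>\<^sup>+y. k x y \<partial>lborel) \<le> (\<integral>\<^sup>+y\<in>cball x s. F y \<partial>lborel)"
        by (intro nn_integral_mono) (auto simp: k_def split: split_indicator)
      then show ?thesis using bound[OF True] True by simp
    qed (simp add: k_def)
  qed
  also have "\<dots> = B * emeasure lborel A" by (rule nn_integral_cmult_indicator) simp
  finally show ?thesis .
qed

lemma Kp_measurable: "(\<lambda>x. Kp p (norm x)) \<in> borel_measurable (borel :: 'a::euclidean_space measure)"
  unfolding Kp_def by (cases "p = 2") simp_all

text \<open>This uses p <= n: differences of K_p at scale \<rho> are of order
  1/\<open>flowc p \<rho>\<close>, and the factor \<rho>^n beats them, leaving \<rho>^2.\<close>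

lemma power_flowc_le:
  assumes "2 \<le> p" "p \<le> n" "0 < \<rho>" "\<rho> \<le> 1"
  shows "\<rho> ^ n \<le> \<rho>\<^sup>2 * flowc p \<rho>"
proof -
  have "\<rho> ^ n \<le> \<rho> ^ p" using assms by (intro power_decreasing) auto
  also have "\<dots> = \<rho>\<^sup>2 * flowc p \<rho>"
  proof (cases "p = 2")
    case False
    have "p = 2 + (p - 2)" using assms(1) by simp
    then have "\<rho> ^ p = \<rho> ^ (2 + (p - 2))" by (rule arg_cong)
    also have "\<dots> = \<rho>\<^sup>2 * \<rho> ^ (p - 2)" by (simp only: power_add)
    also have "\<rho> ^ (p - 2) = flowc p \<rho>" using assms False by (simp add: flowc_def powr_realpow[symmetric] of_nat_diff)
    finally show ?thesis .
  qed (simp add: flowc_def)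
  finally show ?thesis .
qed

section \<open>Uniform contact on annuli and integral estimates for the gap\<close>

context psh_germ
begin

text \<open>Otherwise there are, for a subsequence, centres x whose balls miss the bound by e. They
  accumulate at some nonzero l, and \<open>attained_everywhere\<close>, applied to a further
  subsequence, contradicts the miss near l.\<close>

lemma flow_hits:
  assumes r: "\<And>j. r j > 0" "r \<longlonglongrightarrow> 0" and e: "e > 0" "\<rho> > 0" and ab: "0 < a"
  shows "\<forall>\<^sub>F j in sequentially. \<forall>x. a \<le> norm x \<and> norm x \<le> b \<longrightarrow>
    (\<exists>y\<in>ball x \<rho>. ereal (\<Theta> * Kp p (norm x) - e) < flow p u (r j) y)"
proof (rule ccontr)
  assume "\<not> ?thesis"
  from not_eventually_sequentiallyD[OF this] obtain s :: "nat \<Rightarrow> nat" where s: "strict_mono s"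
    "\<forall>j. \<not> (\<forall>x. a \<le> norm x \<and> norm x \<le> b \<longrightarrow>
      (\<exists>y\<in>ball x \<rho>. ereal (\<Theta> * Kp p (norm x) - e) < flow p u (r (s j)) y))"
    by (elim exE conjE) (rule that)
  define miss where "miss j x \<longleftrightarrow> (\<forall>y\<in>ball x \<rho>. flow p u (r (s j)) y \<le> ereal (\<Theta> * Kp p (norm x) - e))" for j x
  have "\<exists>x. (a \<le> norm x \<and> norm x \<le> b) \<and> miss j x" for j
    using s(2)[rule_format, of j] unfolding miss_def by (auto simp: not_less)
  then obtain x where x1: "\<And>j. a \<le> norm (x j) \<and> norm (x j) \<le> b" and x2: "\<And>j. miss j (x j)" by metis
  note x = x1 x2[unfolded miss_def, rule_format]
  have "compact (cball 0 b - ball (0::real^'n) a)" by (intro compact_diff) auto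
  moreover have "x j \<in> cball 0 b - ball 0 a" for j using x(1)[of j] by auto
  ultimately obtain l t where l: "l \<in> cball 0 b - ball 0 a" "strict_mono t" "(x \<circ> t) \<longlonglongrightarrow> l"
    unfolding compact_def by metis
  have l0: "l \<noteq> 0" using l(1) ab by auto
  define r' where "r' = (\<lambda>j. r (s (t j)))"
  have "strict_mono (s \<circ> t)" using s(1) l(2) by (rule strict_mono_o)
  then have "r' \<longlonglongrightarrow> 0" using LIMSEQ_subseq_LIMSEQ[OF r(2)] by (auto simp: r'_def o_def)
  then interpret S: G_sequence GG p "\<lambda>j. flow p u (r' j)" \<Theta>
    using r(1) by (intro flow_G_sequence) (auto simp: r'_def)
  have "S.attained l" by (rule S.attained_everywhere[OF l0])
  then have fr: "\<exists>\<^sub>F j in sequentially. \<exists>y\<in>ball l (\<rho>/2). ereal (\<Theta> * Kp p (norm l) - e / 2) < flow p u (r' j) y"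
    using e unfolding S.attained_def by simp
  have "isCont (\<lambda>x. \<Theta> * Kp p (norm x)) l" by (rule S.isCont_Kp_norm[OF l0])
  then have "(\<lambda>j. \<Theta> * Kp p (norm (x (t j)))) \<longlonglongrightarrow> \<Theta> * Kp p (norm l)"
    using isCont_tendsto_compose l(3) by (fastforce simp: o_def)
  then have "\<forall>\<^sub>F j in sequentially. \<Theta> * Kp p (norm (x (t j))) < \<Theta> * Kp p (norm l) + e / 2"
    using e by (intro order_tendstoD) auto
  moreover have "\<forall>\<^sub>F j in sequentially. dist (x (t j)) l < \<rho> / 2"
    using tendstoD[OF l(3), of "\<rho> / 2"] e by (simp add: o_def)
  ultimately have "\<forall>\<^sub>F j in sequentially. \<not> (\<exists>y\<in>ball l (\<rho>/2). ereal (\<Theta> * Kp p (norm l) - e / 2) < flow p u (r' j) y)"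
  proof eventually_elim
    case (elim j)
    show ?case
    proof
      assume "\<exists>y\<in>ball l (\<rho>/2). ereal (\<Theta> * Kp p (norm l) - e / 2) < flow p u (r' j) y"
      then obtain y where y: "dist l y < \<rho> / 2" "ereal (\<Theta> * Kp p (norm l) - e / 2) < flow p u (r' j) y" by auto
      have "y \<in> ball (x (t j)) \<rho>" using y(1) elim(2) dist_triangle[of "x (t j)" y l] by simp
      then have "flow p u (r' j) y \<le> ereal (\<Theta> * Kp p (norm (x (t j))) - e)" using x(2) by (simp add: r'_def)
      with y(2) have "ereal (\<Theta> * Kp p (norm l) - e / 2) < ereal (\<Theta> * Kp p (norm (x (t j))) - e)" by order
      then show False using elim(1) by simp
    qed
  qed
  with fr show False by (simp add: frequently_def)
qed

text \<open>\<open>e2ennreal\<close> cuts negative values off at 0; by \<open>flow_le\<close> there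
  are none for small r and 0 < |x| <= R.\<close>

definition gap :: "real \<Rightarrow> real \<Rightarrow> real^'n \<Rightarrow> ennreal" where
  "gap R r x = e2ennreal (ereal (\<Theta> * Kp p (norm x) + excess R r) - flow p u r x)"

text \<open>The Harnack ball lies in the ball of radius |y| + \<rho> about 0, so the bound at this
  outer radius, excess included, serves as the constant above the flow.\<close>

lemma flow_harnack:
  assumes r: "0 < r" "r \<le> R0" "r * R \<le> R0" and \<rho>: "\<rho> > 0" and y: "norm y + \<rho> \<le> R"
    "flow p u r y = ereal a"
  shows "(\<integral>\<^sup>+x\<in>cball y (\<rho>/4). e2ennreal (ereal (\<Theta> * Kp p (norm y + \<rho>) + excess R r) - flow p u r x) \<partial>lborel) \<le>
    ennreal (harnack_const TYPE('n) * \<rho> ^ CARD('n) * (\<Theta> * Kp p (norm y + \<rho>) + excess R r - a))"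
proof -
  let ?t = "norm y + \<rho>"
  have t: "0 < ?t" using \<rho> by (simp add: add_nonneg_pos)
  have nx: "norm x \<le> ?t" if "x \<in> cball y \<rho>" for x
    using that norm_triangle_sub[of x y] by (simp add: dist_norm norm_minus_commute)
  have rt: "r * ?t \<le> R0" using r mult_left_mono[OF y(1), of r] by linarith
  have fc: "flow p u r x \<le> ereal (\<Theta> * Kp p ?t + excess R r)" if "x \<in> cball y \<rho>" for x
  proof -
    have "flow p u r x \<le> ereal (mw r ?t)" using flow_le_mw[OF r(1,2) rt t nx[OF that]] .
    also have "\<dots> \<le> ereal (\<Theta> * Kp p ?t + excess R r)" using mw_le[OF r(1,3) t y(1)] by simp
    finally show ?thesis .
  qed
  have "cball y \<rho> \<subseteq> cball 0 ?t" using nx by auto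
  then have sub: "cball y \<rho> \<subseteq> (\<lambda>x. r *\<^sub>R x) -` \<Omega>" using flow_dom[OF r(1) rt] by blast
  show ?thesis by (rule weak_harnack[OF flow_psh[OF r(1,2)] trace_Fcone sub \<rho> fc y(2)])
qed

lemma gap_harnack:
  assumes r: "0 < r" "r \<le> R0" "r * R \<le> R0" and \<rho>: "\<rho> > 0" and y: "norm y + \<rho> \<le> R"
    "flow p u r y = ereal a"
  shows "(\<integral>\<^sup>+x\<in>cball y (\<rho>/4). gap R r x \<partial>lborel) \<le>
    ennreal (harnack_const TYPE('n) * \<rho> ^ CARD('n) * (\<Theta> * Kp p (norm y + \<rho>) + excess R r - a))"
proof -
  let ?t = "norm y + \<rho>"
  have "(\<integral>\<^sup>+x\<in>cball y (\<rho>/4). gap R r x \<partial>lborel) \<le>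
      (\<integral>\<^sup>+x\<in>cball y (\<rho>/4). e2ennreal (ereal (\<Theta> * Kp p ?t + excess R r) - flow p u r x) \<partial>lborel)"
  \<comment> \<open>At the origin \<open>Kp\<close> has only a default value, which spoils
    monotonicity; the origin is a null set.\<close>
  proof (rule nn_integral_mono_AE, rule AE_mp[OF AE_lborel_singleton[of 0]], rule AE_I2, rule impI)
    fix x :: "real^'n" assume x: "x \<noteq> 0"
    have "gap R r x \<le> e2ennreal (ereal (\<Theta> * Kp p ?t + excess R r) - flow p u r x)" if "x \<in> cball y (\<rho>/4)"
    proof -
      have "norm x \<le> ?t"
        using that \<rho> norm_triangle_sub[of x y] by (simp add: dist_norm norm_minus_commute)
      then have "\<Theta> * Kp p (norm x) \<le> \<Theta> * Kp p ?t"
        using Kp_mono[OF p2, of "norm x" ?t] x Theta_ge_0 by (intro mult_left_mono) auto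
      then show ?thesis unfolding gap_def by (intro e2ennreal_mono ereal_minus_mono) auto
    qed
    then show "gap R r x * indicator (cball y (\<rho>/4)) x \<le>
        e2ennreal (ereal (\<Theta> * Kp p ?t + excess R r) - flow p u r x) * indicator (cball y (\<rho>/4)) x"
      by (auto split: split_indicator)
  qed
  also note flow_harnack[OF assms]
  finally show ?thesis .
qed

text \<open>A point y near x with almost maximal value makes the Harnack bound small: what is left
  is the oscillation of \<Theta> K_p, the excess and the defect e. The balls are nested since
  \<rho>/8 + \<rho>/8 = \<rho>/4.\<close>

lemma gap_local:
  assumes r: "0 < r" "r \<le> R0" "r * R \<le> R0" and \<rho>: "\<rho> > 0" and x: "x \<noteq> 0" "norm x + 2 * \<rho> \<le> R"
    and hit: "\<exists>y\<in>ball x (\<rho>/8). ereal (\<Theta> * Kp p (norm x) - e) < flow p u r y" and c: "excess R r \<le> c"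
  shows "(\<integral>\<^sup>+y\<in>cball x (\<rho>/8). gap R r y \<partial>lborel) \<le>
    ennreal (harnack_const TYPE('n) * \<rho> ^ CARD('n) * (\<Theta> * (Kp p (norm x + 2 * \<rho>) - Kp p (norm x)) + c + e))"
proof -
  obtain y where y: "y \<in> ball x (\<rho>/8)" "ereal (\<Theta> * Kp p (norm x) - e) < flow p u r y" using hit by blast
  have ny: "norm y \<le> norm x + \<rho> / 8" using y(1) norm_triangle_sub[of y x] by (simp add: dist_norm norm_minus_commute)
  then have ny2: "norm y + \<rho> \<le> norm x + 2 * \<rho>" using \<rho> by simp
  have yR: "norm y + \<rho> \<le> R" using ny2 x(2) by simp
  have t: "0 < norm y + \<rho>" using \<rho> by (simp add: add_nonneg_pos)
  have "r * (norm y + \<rho>) \<le> R0" using r mult_left_mono[OF yR, of r] by linarith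
  then have "flow p u r y \<le> ereal (mw r (norm y + \<rho>))"
    using flow_le_mw[OF r(1,2) _ t, of y] \<rho> by simp
  then obtain a where a: "flow p u r y = ereal a" using y(2) by (cases "flow p u r y") auto
  have sub: "cball x (\<rho>/8) \<subseteq> cball y (\<rho>/4)"
  proof
    fix z assume "z \<in> cball x (\<rho>/8)"
    then show "z \<in> cball y (\<rho>/4)" using y(1) dist_triangle[of y z x] by (simp add: dist_commute)
  qed
  have "(\<integral>\<^sup>+z\<in>cball x (\<rho>/8). gap R r z \<partial>lborel) \<le> (\<integral>\<^sup>+z\<in>cball y (\<rho>/4). gap R r z \<partial>lborel)"
    using sub by (intro nn_integral_mono) (auto split: split_indicator)
  also have "\<dots> \<le> ennreal (harnack_const TYPE('n) * \<rho> ^ CARD('n) * (\<Theta> * Kp p (norm y + \<rho>) + excess R r - a))"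
    by (rule gap_harnack[OF r \<rho> yR a])
  also have "\<dots> \<le> ennreal (harnack_const TYPE('n) * \<rho> ^ CARD('n) * (\<Theta> * (Kp p (norm x + 2 * \<rho>) - Kp p (norm x)) + c + e))"
  proof (intro ennreal_leI mult_left_mono)
    have "\<Theta> * Kp p (norm y + \<rho>) \<le> \<Theta> * Kp p (norm x + 2 * \<rho>)"
      using Kp_mono[OF p2 t ny2] Theta_ge_0 by (intro mult_left_mono) auto
    then show "\<Theta> * Kp p (norm y + \<rho>) + excess R r - a \<le> \<Theta> * (Kp p (norm x + 2 * \<rho>) - Kp p (norm x)) + c + e"
      using y(2) a c by (simp add: algebra_simps)
  qed (use harnack_const_pos[where 'n='n] \<rho> in auto)
  finally show ?thesis .
qed

lemma flow_measurable:
  assumes "0 < r" "r \<le> R0" "r * R \<le> R0"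
  shows "(\<lambda>x. if x \<in> cball 0 R then flow p u r x else 0) \<in> borel_measurable borel"
  using flow_psh[OF assms(1,2)] flow_dom[OF assms(1,3)]
  by (intro usc_measurable) (auto simp: G_psh_def intro: usc_on_subset)

lemma gap_measurable:
  assumes "0 < r" "r \<le> R0" "r * R \<le> R0"
  shows "(\<lambda>x. gap R r x * indicator (cball 0 R) x) \<in> borel_measurable borel"
proof -
  note [measurable] = flow_measurable[OF assms] Kp_measurable[of p]
  have "(\<lambda>x. gap R r x * indicator (cball 0 R) x) =
    (\<lambda>x. e2ennreal (ereal (\<Theta> * Kp p (norm x) + excess R r) - (if x \<in> cball 0 R then flow p u r x else 0)) * indicator (cball 0 R) x)"
    by (auto simp: fun_eq_iff gap_def split: split_indicator)
  also have "\<dots> \<in> borel_measurable borel" by measurable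
  finally show ?thesis .
qed

lemma p_le_CARD: "p \<le> CARD('n)"
proof -
  obtain W where "W \<in> GG" using GG_cover by blast
  then show ?thesis using dim_GG[of W] dim_subset_UNIV[of W] by simp
qed

text \<open>Near the origin a single Harnack ball of small radius \<rho>1 suffices, by
  \<open>power_flowc_le\<close>. On the remaining annulus \<rho> is chosen so that \<Theta> K_p
  oscillates by at most \<epsilon> on Harnack balls, and the local bounds are integrated over their
  centres.\<close>

theorem gap_limit:
  assumes r: "\<And>j. r j > 0" "r \<longlonglongrightarrow> 0" and R: "R > 0" and \<eta>: "\<eta> > 0"
  shows "\<forall>\<^sub>F j in sequentially. (\<integral>\<^sup>+x\<in>cball 0 R. gap (R + 3) (r j) x \<partial>lborel) \<le> ennreal \<eta>"
proof -
  \<comment> \<open>The margin 3 consists of 1 for centres up to norm R + 1 and of 2 for the term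
    2\<rho> in \<open>gap_local\<close>.\<close>
  let ?n = "CARD('n)" and ?H = "harnack_const TYPE('n)" and ?R = "R + 3"
  have H: "?H > 0" by (rule harnack_const_pos)
  \<comment> \<open>Scaled by \<rho>1, the radii 1/16 and 1/16 + 2 are those that occur near the
    origin.\<close>
  define \<kappa>0 where "\<kappa>0 = Kp p (1 / 16 + 2) - Kp p (1 / 16)"
  have \<kappa>0: "\<kappa>0 \<ge> 0" using Kp_mono[OF p2, of "1/16" "1/16+2"] by (simp add: \<kappa>0_def)
  define M where "M = ?H * (\<Theta> * \<kappa>0 + 2)"
  have M: "M > 0" using H \<kappa>0 Theta_ge_0 by (simp add: M_def add_nonneg_pos)
  obtain \<rho>1 where \<rho>1: "0 < \<rho>1" "\<rho>1 \<le> 1" "M * \<rho>1\<^sup>2 \<le> \<eta> / 2"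
  proof -
    have "min 1 (\<eta> / (2 * M)) * M \<le> \<eta> / 2" using M \<eta> by (simp add: min_def field_simps)
    moreover have "(min 1 (\<eta> / (2 * M)))\<^sup>2 \<le> min 1 (\<eta> / (2 * M)) * 1"
      unfolding power2_eq_square using M \<eta> by (intro mult_left_mono) auto
    then have "M * (min 1 (\<eta> / (2 * M)))\<^sup>2 \<le> M * min 1 (\<eta> / (2 * M))" using M by (intro mult_left_mono) auto
    ultimately have "M * (min 1 (\<eta> / (2 * M)))\<^sup>2 \<le> \<eta> / 2" by (simp only: mult.commute[of M])
    then show ?thesis using M \<eta> by (intro that[of "min 1 (\<eta> / (2 * M))"]) auto
  qed
  \<comment> \<open>A ball of radius \<rho>1/8 about a point of norm \<rho>1/16 contains the ball of
    radius \<rho>1/16 about 0.\<close>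
  define d0 where "d0 = \<rho>1 / 16"
  have d0: "d0 > 0" using \<rho>1 by (simp add: d0_def)
  define vol where "vol = unit_ball_vol (real ?n)"
  have vol: "vol > 0" by (simp add: vol_def)
  \<comment> \<open>The volume ratio of the region of centres to a ball of radius \<rho>/8 is at
    most 8^n (R + 1)^n / \<rho>^n, and the Harnack bound supplies \<rho>^n. The 3 counts
    oscillation, excess and defect, each at most \<epsilon>.\<close>
  define N where "N = ?H * 8 ^ ?n * (R + 1) ^ ?n * 3"
  have N: "N > 0" using H R by (simp add: N_def)
  define \<epsilon> where "\<epsilon> = min 1 (\<eta> / (2 * N))"
  have \<epsilon>: "\<epsilon> > 0" "\<epsilon> \<le> 1" "N * \<epsilon> \<le> \<eta> / 2" using N \<eta> by (auto simp: \<epsilon>_def min_def field_simps)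
  obtain \<rho> where \<rho>: "0 < \<rho>" "\<rho> \<le> 1" "\<rho> / 8 \<le> d0 / 2"
    "\<And>t. d0 / 2 \<le> t \<Longrightarrow> t \<le> R + 1 \<Longrightarrow> \<Theta> * (Kp p (t + 2 * \<rho>) - Kp p t) \<le> \<epsilon>"
  proof -
    have "continuous_on {d0/2..R+3} (\<lambda>t. \<Theta> * Kp p t)"
      using d0 by (intro continuous_intros continuous_on_subset[OF continuous_on_Kp]) auto
    then have "uniformly_continuous_on {d0/2..R+3} (\<lambda>t. \<Theta> * Kp p t)" by (intro compact_uniformly_continuous) auto
    then obtain d where d: "d > 0" "\<And>s t. s \<in> {d0/2..R+3} \<Longrightarrow> t \<in> {d0/2..R+3} \<Longrightarrow> dist s t < d \<Longrightarrow> dist (\<Theta> * Kp p s) (\<Theta> * Kp p t) < \<epsilon>"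
      using \<epsilon>(1) unfolding uniformly_continuous_on_def by metis
    define q where "q = min (min 1 (d / 4)) (4 * d0)"
    have q: "q > 0" "q \<le> 1" "q \<le> d / 4" "q \<le> 4 * d0" using d d0 by (auto simp: q_def)
    show ?thesis
    proof (rule that[of q])
      fix t assume t: "d0 / 2 \<le> t" "t \<le> R + 1"
      have "dist (\<Theta> * Kp p (t + 2 * q)) (\<Theta> * Kp p t) < \<epsilon>"
        using q d(1) t by (intro d(2)) (auto simp: dist_real_def)
      then show "\<Theta> * (Kp p (t + 2 * q) - Kp p t) \<le> \<epsilon>" by (simp add: dist_real_def right_diff_distrib abs_less_iff)
    qed (use q in auto)
  qed
  have "(\<lambda>j. excess ?R (r j)) \<longlonglongrightarrow> 0"
    using filterlim_compose[OF excess_limit[of ?R] scales_at_right[OF r]] R by simp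
  then have ev1: "\<forall>\<^sub>F j in sequentially. excess ?R (r j) < \<epsilon>" using \<epsilon>(1) by (intro order_tendstoD) auto
  have ev2: "\<forall>\<^sub>F j in sequentially. r j \<le> R0 \<and> r j * ?R \<le> R0" using R by (intro scales_small[OF r(2)]) auto
  have ev3: "\<forall>\<^sub>F j in sequentially. \<forall>x. d0 \<le> norm x \<and> norm x \<le> d0 \<longrightarrow>
      (\<exists>y\<in>ball x (\<rho>1/8). ereal (\<Theta> * Kp p (norm x) - \<epsilon>) < flow p u (r j) y)"
    using \<rho>1 d0 by (intro flow_hits[OF r \<epsilon>(1)]) auto
  have ev4: "\<forall>\<^sub>F j in sequentially. \<forall>x. d0 / 2 \<le> norm x \<and> norm x \<le> R + 1 \<longrightarrow>
      (\<exists>y\<in>ball x (\<rho>/8). ereal (\<Theta> * Kp p (norm x) - \<epsilon>) < flow p u (r j) y)"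
    using \<rho> d0 by (intro flow_hits[OF r \<epsilon>(1)]) auto
  from ev1 ev2 ev3 ev4 show ?thesis
  proof eventually_elim
    case (elim j)
    have rj: "0 < r j" "r j \<le> R0" "r j * ?R \<le> R0" using elim(2) r(1) by auto
    let ?g = "gap ?R (r j)"
    define F where "F x = ?g x * indicator (cball 0 ?R) x" for x
    have F[measurable]: "F \<in> borel_measurable borel" unfolding F_def by (rule gap_measurable[OF rj])
    have near: "(\<integral>\<^sup>+x\<in>cball 0 d0. ?g x \<partial>lborel) \<le> ennreal (\<eta> / 2)"
    proof -
      obtain e :: "real^'n" where e: "norm e = d0" using vector_choose_size[of d0] d0 by auto
      have "e \<noteq> 0" using e d0 by auto
      have "cball 0 d0 \<subseteq> cball e (\<rho>1/8)"
      proof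
        fix z :: "real^'n" assume "z \<in> cball 0 d0"
        then show "z \<in> cball e (\<rho>1/8)" using norm_triangle_ineq4[of e z] e by (simp add: dist_norm d0_def)
      qed
      then have "(\<integral>\<^sup>+x\<in>cball 0 d0. ?g x \<partial>lborel) \<le> (\<integral>\<^sup>+x\<in>cball e (\<rho>1/8). ?g x \<partial>lborel)"
        by (intro nn_integral_mono) (auto split: split_indicator)
      also have "\<dots> \<le> ennreal (?H * \<rho>1 ^ ?n * (\<Theta> * (Kp p (norm e + 2 * \<rho>1) - Kp p (norm e)) + 1 + 1))"
      proof (rule gap_local[OF rj \<rho>1(1) \<open>e \<noteq> 0\<close>])
        show "norm e + 2 * \<rho>1 \<le> ?R" using e \<rho>1 R by (simp add: d0_def)
        have "\<exists>y\<in>ball e (\<rho>1/8). ereal (\<Theta> * Kp p (norm e) - \<epsilon>) < flow p u (r j) y"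
          by (rule elim(3)[rule_format]) (simp add: e)
        then show "\<exists>y\<in>ball e (\<rho>1/8). ereal (\<Theta> * Kp p (norm e) - 1) < flow p u (r j) y"
          using \<epsilon>(2) by (meson diff_left_mono ereal_less_eq(3) order_le_less_trans)
        show "excess ?R (r j) \<le> 1" using elim(1) \<epsilon>(2) by simp
      qed
      also have "\<dots> \<le> ennreal (\<eta> / 2)"
      proof (rule ennreal_leI)
        have "flowc p \<rho>1 * (Kp p (\<rho>1 * (1/16 + 2)) - Kp p (\<rho>1 * (1/16))) = \<kappa>0"
          unfolding \<kappa>0_def using \<rho>1 by (intro Kp_scale) auto
        moreover have "\<rho>1 * (1/16 + 2) = norm e + 2 * \<rho>1" "\<rho>1 * (1/16) = norm e" by (auto simp: e d0_def)
        ultimately have K: "flowc p \<rho>1 * (Kp p (norm e + 2 * \<rho>1) - Kp p (norm e)) = \<kappa>0" by simp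
        have diff0: "Kp p (norm e + 2 * \<rho>1) - Kp p (norm e) \<ge> 0"
          using Kp_mono[OF p2, of "norm e" "norm e + 2 * \<rho>1"] e d0 \<rho>1 by simp
        have "\<rho>1 ^ ?n * (Kp p (norm e + 2 * \<rho>1) - Kp p (norm e)) \<le> (\<rho>1\<^sup>2 * flowc p \<rho>1) * (Kp p (norm e + 2 * \<rho>1) - Kp p (norm e))"
          using power_flowc_le[OF p2 p_le_CARD] \<rho>1 diff0 by (intro mult_right_mono) auto
        also have "\<dots> = \<rho>1\<^sup>2 * \<kappa>0" by (simp add: mult.assoc K)
        finally have 1: "\<Theta> * (\<rho>1 ^ ?n * (Kp p (norm e + 2 * \<rho>1) - Kp p (norm e))) \<le> \<Theta> * (\<rho>1\<^sup>2 * \<kappa>0)"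
          using Theta_ge_0 by (rule mult_left_mono)
        have 2: "\<rho>1 ^ ?n \<le> \<rho>1\<^sup>2" using \<rho>1 p2 p_le_CARD by (intro power_decreasing) auto
        have "?H * \<rho>1 ^ ?n * (\<Theta> * (Kp p (norm e + 2 * \<rho>1) - Kp p (norm e)) + 1 + 1) =
          ?H * (\<Theta> * (\<rho>1 ^ ?n * (Kp p (norm e + 2 * \<rho>1) - Kp p (norm e))) + 2 * \<rho>1 ^ ?n)"
          by (simp add: algebra_simps)
        also have "\<dots> \<le> ?H * (\<Theta> * (\<rho>1\<^sup>2 * \<kappa>0) + 2 * \<rho>1\<^sup>2)"
          by (rule mult_left_mono[OF add_mono[OF 1]]) (use 2 H in auto)
        also have "\<dots> = M * \<rho>1\<^sup>2" by (simp add: M_def algebra_simps)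
        finally show "?H * \<rho>1 ^ ?n * (\<Theta> * (Kp p (norm e + 2 * \<rho>1) - Kp p (norm e)) + 1 + 1) \<le> \<eta> / 2"
          using \<rho>1(3) by linarith
      qed
      finally show ?thesis .
    qed
    let ?Y = "cball (0::real^'n) R - ball 0 d0" and ?A = "cball (0::real^'n) (R + 1) - ball 0 (d0 / 2)"
    have far: "(\<integral>\<^sup>+x\<in>?Y. F x \<partial>lborel) \<le> ennreal (\<eta> / 2)"
    proof -
      define B where "B = ?H * \<rho> ^ ?n * (3 * \<epsilon>)"
      have B: "B \<ge> 0" using H \<rho>(1) \<epsilon>(1) by (simp add: B_def)
      have s: "vol * (\<rho>/8) ^ ?n > 0" using vol \<rho>(1) by simp
      have "(\<integral>\<^sup>+x\<in>?Y. F x \<partial>lborel) * emeasure lborel (cball (0::real^'n) (\<rho>/8)) \<le> ennreal B * emeasure lborel ?A"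
      proof (rule nn_integral_from_local[OF F])
        fix y :: "real^'n" assume y: "y \<in> ?Y"
        show "cball y (\<rho>/8) \<subseteq> ?A"
        proof
          fix z assume "z \<in> cball y (\<rho>/8)"
          then have "norm (y - z) \<le> d0 / 2" "norm (y - z) \<le> 1" using \<rho>(2,3) by (auto simp: dist_norm)
          then show "z \<in> ?A" using y norm_triangle_sub[of z y] norm_triangle_sub[of y z] by (auto simp: norm_minus_commute)
        qed
      next
        fix x :: "real^'n" assume x: "x \<in> ?A"
        then have nx: "d0 / 2 \<le> norm x" "norm x \<le> R + 1" by auto
        have "x \<noteq> 0" using nx d0 by auto
        have "(\<integral>\<^sup>+y\<in>cball x (\<rho>/8). F y \<partial>lborel) \<le> (\<integral>\<^sup>+y\<in>cball x (\<rho>/8). ?g y \<partial>lborel)"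
          by (intro nn_integral_mono) (auto simp: F_def split: split_indicator)
        also have "\<dots> \<le> ennreal (?H * \<rho> ^ ?n * (\<Theta> * (Kp p (norm x + 2 * \<rho>) - Kp p (norm x)) + \<epsilon> + \<epsilon>))"
          using nx \<rho>(2) elim(1,4) by (intro gap_local[OF rj \<rho>(1) \<open>x \<noteq> 0\<close>]) auto
        also have "\<dots> \<le> ennreal B"
          unfolding B_def using \<rho>(1) \<rho>(4)[OF nx] H by (intro ennreal_leI mult_left_mono) auto
        finally show "(\<integral>\<^sup>+y\<in>cball x (\<rho>/8). F y \<partial>lborel) \<le> ennreal B" .
      qed auto
      also have "\<dots> \<le> ennreal B * emeasure lborel (cball (0::real^'n) (R + 1))"
        by (intro mult_left_mono emeasure_mono) auto
      also have "\<dots> = ennreal (B * (vol * (R + 1) ^ ?n))"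
        using R B vol by (simp add: emeasure_cball vol_def ennreal_mult)
      also have "B * (vol * (R + 1) ^ ?n) = (N * \<epsilon>) * (vol * (\<rho>/8) ^ ?n)"
        by (simp add: B_def N_def power_divide)
      finally have "(\<integral>\<^sup>+x\<in>?Y. F x \<partial>lborel) * ennreal (vol * (\<rho>/8) ^ ?n) \<le> ennreal (N * \<epsilon>) * ennreal (vol * (\<rho>/8) ^ ?n)"
        using \<rho>(1) vol N \<epsilon>(1) by (simp add: emeasure_cball vol_def ennreal_mult)
      moreover have "a \<le> b" if "a * ennreal (vol * (\<rho>/8) ^ ?n) \<le> b * ennreal (vol * (\<rho>/8) ^ ?n)" for a b
        using that s ennreal_mult_le_mult_iff[of "ennreal (vol * (\<rho>/8) ^ ?n)" a b]
        by (simp add: mult.commute[of _ "ennreal (vol * (\<rho>/8) ^ ?n)"] ennreal_eq_0_iff)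
      ultimately have "(\<integral>\<^sup>+x\<in>?Y. F x \<partial>lborel) \<le> ennreal (N * \<epsilon>)" by blast
      also have "\<dots> \<le> ennreal (\<eta> / 2)" using \<epsilon>(3) by (rule ennreal_leI)
      finally show ?thesis .
    qed
    have "(\<integral>\<^sup>+x\<in>cball 0 R. ?g x \<partial>lborel) \<le> (\<integral>\<^sup>+x. F x * indicator (cball 0 d0) x + F x * indicator ?Y x \<partial>lborel)"
      by (intro nn_integral_mono) (auto simp: F_def split: split_indicator)
    also have "\<dots> = (\<integral>\<^sup>+x\<in>cball 0 d0. F x \<partial>lborel) + (\<integral>\<^sup>+x\<in>?Y. F x \<partial>lborel)"
      by (rule nn_integral_add) measurable
    also have "(\<integral>\<^sup>+x\<in>cball 0 d0. F x \<partial>lborel) \<le> (\<integral>\<^sup>+x\<in>cball 0 d0. ?g x \<partial>lborel)"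
      by (intro nn_integral_mono) (auto simp: F_def split: split_indicator)
    also note near
    also note far
    also have "ennreal (\<eta> / 2) + ennreal (\<eta> / 2) = ennreal \<eta>" using \<eta> by (simp flip: ennreal_plus)
    finally show ?case by (simp add: add_mono)
  qed
qed

end

section \<open>Tangents\<close>

text \<open>The triangle inequality on each ball equates the real parts; finiteness almost
  everywhere of both limits then equates the extended values.\<close>

lemma L1loc_unique:
  fixes f :: "nat \<Rightarrow> real^'n \<Rightarrow> ereal"
  assumes "L1loc_tendsto f v" "L1loc_tendsto f v'"
  shows "AE x in lborel. v x = v' x"
proof -
  have v[measurable]: "v \<in> borel_measurable borel" "v' \<in> borel_measurable borel"
    using assms by (auto simp: L1loc_tendsto_def)
  have "AE x in lborel. x \<in> cball 0 (real k + 1) \<longrightarrow> v x = v' x" for k :: nat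
  proof -
    let ?B = "cball (0::real^'n) (real k + 1)"
    have R: "real k + 1 > 0" by simp
    note L = assms[unfolded L1loc_tendsto_def, THEN conjunct2, rule_format, OF R]
    let ?I = "\<lambda>j. \<integral>\<^sup>+x\<in>?B. ennreal \<bar>real_of_ereal (f j x) - real_of_ereal (v x)\<bar> \<partial>lborel"
    let ?I' = "\<lambda>j. \<integral>\<^sup>+x\<in>?B. ennreal \<bar>real_of_ereal (f j x) - real_of_ereal (v' x)\<bar> \<partial>lborel"
    let ?D = "\<integral>\<^sup>+x\<in>?B. ennreal \<bar>real_of_ereal (v x) - real_of_ereal (v' x)\<bar> \<partial>lborel"
    have "\<forall>\<^sub>F j in sequentially. (\<lambda>x. f j x * ereal (indicator ?B x)) \<in> borel_measurable lborel"
      using L(1) by (auto elim: eventually_mono)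
    then have "\<forall>\<^sub>F j in sequentially. ?D \<le> ?I j + ?I' j"
    proof eventually_elim
      case (elim j)
      have m: "(\<lambda>x. f j x * ereal (indicator ?B x)) \<in> borel_measurable borel" using elim by simp
      note [measurable] = m
      have I: "(\<integral>\<^sup>+x\<in>?B. ennreal \<bar>real_of_ereal (f j x) - real_of_ereal (g x)\<bar> \<partial>lborel) =
        (\<integral>\<^sup>+x\<in>?B. ennreal \<bar>real_of_ereal (f j x * ereal (indicator ?B x)) - real_of_ereal (g x)\<bar> \<partial>lborel)" for g
        by (intro nn_integral_cong) (auto split: split_indicator)
      have "?D \<le> (\<integral>\<^sup>+x. ennreal \<bar>real_of_ereal (f j x * ereal (indicator ?B x)) - real_of_ereal (v x)\<bar> * indicator ?B x +
          ennreal \<bar>real_of_ereal (f j x * ereal (indicator ?B x)) - real_of_ereal (v' x)\<bar> * indicator ?B x \<partial>lborel)"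
        by (intro nn_integral_mono) (auto split: split_indicator intro!: ennreal_leI simp flip: ennreal_plus)
      also have "\<dots> = ?I j + ?I' j" unfolding I by (rule nn_integral_add) measurable
      finally show ?case .
    qed
    moreover have "(\<lambda>j. ?I j + ?I' j) \<longlonglongrightarrow> 0 + 0"
      using L by (intro tendsto_add) auto
    ultimately have "?D \<le> 0 + 0" by (intro tendsto_lowerbound[of _ "0 + 0" sequentially ?D]) auto
    then have "?D = 0" by simp
    then have "AE x in lborel. ennreal \<bar>real_of_ereal (v x) - real_of_ereal (v' x)\<bar> * indicator ?B x = 0"
      by (subst (asm) nn_integral_0_iff_AE) auto
    moreover have "AE x in lborel. x \<in> ?B \<longrightarrow> \<bar>v x\<bar> \<noteq> \<infinity>" "AE x in lborel. x \<in> ?B \<longrightarrow> \<bar>v' x\<bar> \<noteq> \<infinity>"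
      using L by auto
    ultimately show ?thesis
    proof eventually_elim
      case (elim x)
      show ?case
      proof
        assume x: "x \<in> ?B"
        then have "real_of_ereal (v x) = real_of_ereal (v' x)" using elim(1) by (simp add: ennreal_eq_0_iff)
        then show "v x = v' x" using elim(2,3) x by (metis ereal_real')
      qed
    qed
  qed
  then have "AE x in lborel. \<forall>k::nat. x \<in> cball 0 (real k + 1) \<longrightarrow> v x = v' x"
    unfolding AE_all_countable by blast
  then show ?thesis
  proof eventually_elim
    case (elim x)
    obtain k :: nat where "norm x \<le> real k" using real_arch_simple by blast
    then have "x \<in> cball 0 (real k + 1)" by simp
    then show ?case using elim by blast
  qed
qed

context psh_germ
begin

definition tangent :: "real^'n \<Rightarrow> ereal" where
  "tangent x = (if x = 0 then - \<infinity> else ereal (\<Theta> * Kp p (norm x)))"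

lemma gap_bound:
  assumes r: "0 < r" "r \<le> R0" "r * R \<le> R0" and x: "x \<noteq> 0" "norm x \<le> R"
  shows "ennreal \<bar>real_of_ereal (flow p u r x) - real_of_ereal (tangent x)\<bar> \<le> gap R r x + ennreal \<bar>excess R r\<bar>"
proof (cases "flow p u r x")
  case (real a)
  have "a \<le> \<Theta> * Kp p (norm x) + excess R r" using flow_le[OF r x] real by simp
  moreover have "gap R r x = ennreal (\<Theta> * Kp p (norm x) + excess R r - a)" by (simp add: gap_def real)
  ultimately show ?thesis using x(1)
    by (auto simp: tangent_def real simp flip: ennreal_plus intro!: ennreal_leI)
next
  case PInf
  then show ?thesis using flow_le[OF r x] by simp
next
  \<comment> \<open>\<open>real_of_ereal\<close> sends -infinity to 0, but the gap is infinite
    here.\<close>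
  case MInf
  then show ?thesis by (simp add: gap_def)
qed

lemma gap_measurable_ball:
  assumes "0 < r" "r \<le> R0" "r * (R + 3) \<le> R0"
  shows "(\<lambda>x. gap (R + 3) r x * indicator (cball 0 R) x) \<in> borel_measurable borel"
proof -
  note [measurable] = gap_measurable[OF assms]
  have "(\<lambda>x. gap (R + 3) r x * indicator (cball 0 R) x) =
      (\<lambda>x. (gap (R + 3) r x * indicator (cball 0 (R + 3)) x) * indicator (cball 0 R) x)"
    by (auto simp: fun_eq_iff split: split_indicator)
  also have "\<dots> \<in> borel_measurable borel" by measurable
  finally show ?thesis .
qed

text \<open>Up to constants the tangent lies above one single rescaled function, whose integral the
  Harnack inequality bounds from below. So no integral has to be evaluated at the
  singularity.\<close>

lemma tangent_integrable:
  assumes R: "R > 0"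
  shows "(\<integral>\<^sup>+x\<in>cball 0 R. ennreal \<bar>real_of_ereal (tangent x)\<bar> \<partial>lborel) < \<infinity>"
proof -
  \<comment> \<open>The ball of radius \<rho>/4 = 2R about a point of norm R contains
    \<open>cball 0 R\<close>.\<close>
  define \<rho> where "\<rho> = 8 * R"
  define Q where "Q = R + \<rho>"
  have Q: "Q > 0" "\<rho> > 0" "R \<le> Q" using R by (auto simp: Q_def \<rho>_def)
  define r where "r = min R0 (R0 / Q)"
  have "r \<le> R0 / Q" by (simp add: r_def)
  then have rQ: "r * Q \<le> R0" using Q by (simp add: field_simps)
  have r: "0 < r" "r \<le> R0" "r * Q \<le> R0" using R0_pos Q rQ by (auto simp: r_def)
  have rR: "r * R \<le> R0" using r mult_left_mono[OF Q(3), of r] by linarith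
  then obtain y where y: "norm y = R" "flow p u r y = ereal (mw r R)"
    using flow_attains_mw[OF r(1,2) _ R] by blast
  define m where "m = \<Theta> * Kp p Q"
  define h where "h x = e2ennreal (ereal (m + excess Q r) - flow p u r x)" for x
  have sub: "cball 0 R \<subseteq> cball y (\<rho>/4)"
  proof
    fix z :: "real^'n" assume "z \<in> cball 0 R"
    then show "z \<in> cball y (\<rho>/4)" using norm_triangle_ineq4[of y z] y(1) by (simp add: dist_norm \<rho>_def)
  qed
  have "(\<integral>\<^sup>+x\<in>cball y (\<rho>/4). h x \<partial>lborel) \<le>
      ennreal (harnack_const TYPE('n) * \<rho> ^ CARD('n) * (m + excess Q r - mw r R))"
    using flow_harnack[OF r Q(2) _ y(2)] y(1) by (simp add: Q_def h_def m_def)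
  then have fin: "(\<integral>\<^sup>+x\<in>cball y (\<rho>/4). h x \<partial>lborel) < \<infinity>" by (auto intro: le_less_trans)
  have "(\<integral>\<^sup>+x\<in>cball 0 R. ennreal \<bar>real_of_ereal (tangent x)\<bar> \<partial>lborel) \<le>
      (\<integral>\<^sup>+x. ennreal \<bar>m\<bar> * indicator (cball 0 R) x + h x * indicator (cball y (\<rho>/4)) x * indicator (cball 0 Q) x \<partial>lborel)"
  proof (rule nn_integral_mono)
    fix x :: "real^'n"
    have "ennreal \<bar>real_of_ereal (tangent x)\<bar> \<le> ennreal \<bar>m\<bar> + h x" if "norm x \<le> R"
    proof (cases "x = 0")
      case False
      have "Kp p (norm x) \<le> Kp p Q" using False that Q(3) by (intro Kp_mono p2) auto
      then have Vm: "\<Theta> * Kp p (norm x) \<le> m" unfolding m_def using Theta_ge_0 by (rule mult_left_mono)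
      have "flow p u r x \<le> ereal (\<Theta> * Kp p (norm x) + excess Q r)"
        using that False Q(3) by (intro flow_le[OF r]) auto
      then have "ereal (m - \<Theta> * Kp p (norm x)) \<le> ereal (m + excess Q r) - flow p u r x"
        by (cases "flow p u r x") auto
      then have "ennreal (m - \<Theta> * Kp p (norm x)) \<le> h x"
        unfolding h_def by (metis e2ennreal_mono e2ennreal_ereal)
      then have "ennreal \<bar>m\<bar> + ennreal (m - \<Theta> * Kp p (norm x)) \<le> ennreal \<bar>m\<bar> + h x" by (rule add_left_mono)
      moreover have "ennreal \<bar>\<Theta> * Kp p (norm x)\<bar> \<le> ennreal \<bar>m\<bar> + ennreal (m - \<Theta> * Kp p (norm x))"
      proof -
        have "\<bar>\<Theta> * Kp p (norm x)\<bar> \<le> \<bar>m\<bar> + (m - \<Theta> * Kp p (norm x))" using Vm by linarith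
        then have "ennreal \<bar>\<Theta> * Kp p (norm x)\<bar> \<le> ennreal (\<bar>m\<bar> + (m - \<Theta> * Kp p (norm x)))" by (rule ennreal_leI)
        also have "\<dots> = ennreal \<bar>m\<bar> + ennreal (m - \<Theta> * Kp p (norm x))"
          using Vm by (intro ennreal_plus) auto
        finally show ?thesis .
      qed
      ultimately have "ennreal \<bar>\<Theta> * Kp p (norm x)\<bar> \<le> ennreal \<bar>m\<bar> + h x" by (rule order_trans[rotated])
      then show ?thesis using False by (simp add: tangent_def)
    qed (simp add: tangent_def)
    moreover have "x \<in> cball y (\<rho>/4) \<and> norm x \<le> Q" if "norm x \<le> R" using that sub Q(3) by auto
    ultimately show "ennreal \<bar>real_of_ereal (tangent x)\<bar> * indicator (cball 0 R) x \<le>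
        ennreal \<bar>m\<bar> * indicator (cball 0 R) x + h x * indicator (cball y (\<rho>/4)) x * indicator (cball 0 Q) x"
      by (auto split: split_indicator)
  qed
  also have "\<dots> = (\<integral>\<^sup>+x. ennreal \<bar>m\<bar> * indicator (cball (0::real^'n) R) x \<partial>lborel) +
      (\<integral>\<^sup>+x. h x * indicator (cball y (\<rho>/4)) x * indicator (cball 0 Q) x \<partial>lborel)"
  proof (rule nn_integral_add)
    note [measurable] = flow_measurable[OF r]
    have "(\<lambda>x. h x * indicator (cball y (\<rho>/4)) x * indicator (cball 0 Q) x) =
      (\<lambda>x. e2ennreal (ereal (m + excess Q r) - (if x \<in> cball 0 Q then flow p u r x else 0))
        * indicator (cball y (\<rho>/4)) x * indicator (cball 0 Q) x)"
      by (auto simp: h_def fun_eq_iff split: split_indicator)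
    also have "\<dots> \<in> borel_measurable lborel" by measurable
    finally show "(\<lambda>x. h x * indicator (cball y (\<rho>/4)) x * indicator (cball 0 Q) x) \<in> borel_measurable lborel" .
  qed measurable
  also have "\<dots> < \<infinity>"
  proof -
    have "(\<integral>\<^sup>+x. ennreal \<bar>m\<bar> * indicator (cball (0::real^'n) R) x \<partial>lborel) < \<infinity>"
      using emeasure_lborel_cball_finite[of "0::real^'n" R]
      by (subst nn_integral_cmult_indicator) (auto simp: ennreal_mult_less_top)
    moreover have "(\<integral>\<^sup>+x. h x * indicator (cball y (\<rho>/4)) x * indicator (cball 0 Q) x \<partial>lborel) \<le> (\<integral>\<^sup>+x\<in>cball y (\<rho>/4). h x \<partial>lborel)"
      by (intro nn_integral_mono) (auto split: split_indicator)
    ultimately show ?thesis using fin by (auto intro: le_less_trans)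
  qed
  finally show ?thesis .
qed

text \<open>The gap and the excess together bound the distance in the mean for every null sequence
  of scales. The whole sequence converges, which is what makes the tangent unique.\<close>

lemma flow_tendsto_tangent:
  assumes r: "\<And>j. r j > 0" "r \<longlonglongrightarrow> 0"
  shows "L1loc_tendsto (\<lambda>j. flow p u (r j)) tangent"
  unfolding L1loc_tendsto_def
proof (intro conjI allI impI)
  note [measurable] = Kp_measurable[of p]
  have [measurable]: "tangent \<in> borel_measurable borel" unfolding tangent_def[abs_def] by measurable
  then show "tangent \<in> borel_measurable lborel" by simp
  fix R :: real assume R: "R > 0"
  let ?R = "R + 3" and ?B = "cball (0::real^'n) R"
  show "AE x in lborel. x \<in> ?B \<longrightarrow> \<bar>tangent x\<bar> \<noteq> \<infinity>"
    using AE_lborel_singleton[of "0::real^'n"] by eventually_elim (simp add: tangent_def)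
  show "(\<integral>\<^sup>+x\<in>?B. ennreal \<bar>real_of_ereal (tangent x)\<bar> \<partial>lborel) < \<infinity>" by (rule tangent_integrable[OF R])
  have small: "\<forall>\<^sub>F j in sequentially. r j \<le> R0 \<and> r j * ?R \<le> R0" using R by (intro scales_small[OF r(2)]) auto
  have sub: "r * R \<le> R0" if "0 < r" "r * ?R \<le> R0" for r
    using that by (simp add: distrib_left)
  show "\<forall>\<^sub>F j in sequentially. (\<lambda>x. flow p u (r j) x * ereal (indicator ?B x)) \<in> borel_measurable lborel \<and>
      (AE x in lborel. x \<in> ?B \<longrightarrow> \<bar>flow p u (r j) x\<bar> \<noteq> \<infinity>)"
    using small gap_limit[OF r R zero_less_one]
  proof eventually_elim
    case (elim j)
    have rj: "0 < r j" "r j \<le> R0" "r j * ?R \<le> R0" using elim(1) r(1) by auto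
    note rR = sub[OF rj(1,3)]
    have "(\<lambda>x. flow p u (r j) x * ereal (indicator ?B x)) = (\<lambda>x. if x \<in> ?B then flow p u (r j) x else 0)"
      by (auto simp: fun_eq_iff one_ereal_def[symmetric] zero_ereal_def[symmetric])
    then have m: "(\<lambda>x. flow p u (r j) x * ereal (indicator ?B x)) \<in> borel_measurable lborel"
      using flow_measurable[OF rj(1,2) rR] by simp
    note gm = gap_measurable_ball[OF rj]
    \<comment> \<open>A finite integral of the gap excludes the value -infinity almost
      everywhere.\<close>
    have "(\<integral>\<^sup>+x\<in>?B. gap ?R (r j) x \<partial>lborel) \<noteq> \<infinity>" using elim(2) by (auto simp: top_unique)
    then have "AE x in lborel. gap ?R (r j) x * indicator ?B x \<noteq> \<infinity>"
      using gm by (intro nn_integral_PInf_AE) auto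
    then have "AE x in lborel. x \<in> ?B \<longrightarrow> \<bar>flow p u (r j) x\<bar> \<noteq> \<infinity>"
    proof eventually_elim
      case (elim x)
      show ?case
      proof
        assume x: "x \<in> ?B"
        then have "flow p u (r j) x \<le> ereal (mw (r j) R)" using flow_le_mw[OF rj(1,2) rR R, of x] by simp
        moreover have "flow p u (r j) x \<noteq> -\<infinity>" using elim x by (auto simp: gap_def)
        ultimately show "\<bar>flow p u (r j) x\<bar> \<noteq> \<infinity>" by auto
      qed
    qed
    with m show ?case by blast
  qed
  show "(\<lambda>j. \<integral>\<^sup>+x\<in>?B. ennreal \<bar>real_of_ereal (flow p u (r j) x) - real_of_ereal (tangent x)\<bar> \<partial>lborel) \<longlonglongrightarrow> 0"
  proof (rule tendsto_zero_ennreal)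
    fix e :: real assume e: "e > 0"
    define vB where "vB = measure lborel ?B"
    have vB: "emeasure lborel ?B = ennreal vB" "vB \<ge> 0"
      using emeasure_lborel_cball_finite[of "0::real^'n" R] by (auto simp: vB_def emeasure_eq_ennreal_measure)
    have "(\<lambda>j. \<bar>excess ?R (r j)\<bar> * vB) \<longlonglongrightarrow> \<bar>0\<bar> * vB"
      using filterlim_compose[OF excess_limit[of ?R] scales_at_right[OF r]] R by (intro tendsto_intros) simp
    then have "\<forall>\<^sub>F j in sequentially. \<bar>excess ?R (r j)\<bar> * vB < e / 2" using e by (intro order_tendstoD) auto
    moreover have "e / 2 > 0" using e by simp
    note gap_limit[OF r R this]
    ultimately show "\<forall>\<^sub>F j in sequentially.
      (\<integral>\<^sup>+x\<in>?B. ennreal \<bar>real_of_ereal (flow p u (r j) x) - real_of_ereal (tangent x)\<bar> \<partial>lborel) < ennreal e"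
      using small
    proof eventually_elim
      case (elim j)
      have rj: "0 < r j" "r j \<le> R0" "r j * ?R \<le> R0" using elim(3) r(1) by auto
      let ?g = "\<lambda>x. gap ?R (r j) x * indicator ?B x" and ?c = "ennreal \<bar>excess ?R (r j)\<bar>"
      have "(\<integral>\<^sup>+x\<in>?B. ennreal \<bar>real_of_ereal (flow p u (r j) x) - real_of_ereal (tangent x)\<bar> \<partial>lborel) \<le>
        (\<integral>\<^sup>+x. ?c * indicator ?B x + ?g x \<partial>lborel)"
      proof (rule nn_integral_mono_AE, rule AE_mp[OF AE_lborel_singleton[of 0]], rule AE_I2, rule impI)
        fix x :: "real^'n" assume "x \<noteq> 0"
        then show "ennreal \<bar>real_of_ereal (flow p u (r j) x) - real_of_ereal (tangent x)\<bar> * indicator ?B x \<le> ?c * indicator ?B x + ?g x"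
          using gap_bound[OF rj, of x] by (auto split: split_indicator simp: add.commute)
      qed
      also have "\<dots> = (\<integral>\<^sup>+x. ?c * indicator ?B x \<partial>lborel) + (\<integral>\<^sup>+x. ?g x \<partial>lborel)"
        by (rule nn_integral_add) (simp_all add: gap_measurable_ball[OF rj])
      also have "(\<integral>\<^sup>+x. ?c * indicator ?B x \<partial>lborel) = ennreal (\<bar>excess ?R (r j)\<bar> * vB)"
        by (subst nn_integral_cmult_indicator) (auto simp: vB ennreal_mult)
      also have "ennreal (\<bar>excess ?R (r j)\<bar> * vB) + (\<integral>\<^sup>+x. ?g x \<partial>lborel) \<le> ennreal (\<bar>excess ?R (r j)\<bar> * vB) + ennreal (e / 2)"
        using elim(2) by (rule add_left_mono)
      also have "\<dots> = ennreal (\<bar>excess ?R (r j)\<bar> * vB + e / 2)" using e vB by simp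
      also have "\<dots> < ennreal e" using elim(1) e vB by (intro ennreal_lessI) auto
      finally show ?case .
    qed
  qed
qed

end

theorem theorem11p2:
  fixes GG :: "(real^'n) set set" and K :: "(real^'n \<Rightarrow> real^'n) set" and p :: nat
  assumes "CARD('n) \<ge> 2" and "2 \<le> p" and "p \<le> CARD('n)"
    and "closed_in_grassmannian p GG"
    and "orth_subgroup K" and "transitive_on_sphere K" and "invariant_under K GG"
    and "transitivity_property GG"
  shows "\<forall>(\<Omega>::(real^'n) set) u. open \<Omega> \<and> connected \<Omega> \<and> 0 \<in> \<Omega> \<and> G_psh GG \<Omega> u \<and>
            (\<exists>x\<in>\<Omega>. u x \<noteq> -\<infinity>) \<longrightarrow>
          (\<exists>\<Theta>. has_density p u \<Theta> \<and>
             (\<exists>v. is_tangent p u v) \<and>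
             (\<forall>v. is_tangent p u v \<longrightarrow>
                 (AE x in lborel. v x = (if x = 0 then - \<infinity> else ereal (\<Theta> * Kp p (norm x))))))"
proof (intro allI impI)
  fix \<Omega> :: "(real^'n) set" and u
  assume A: "open \<Omega> \<and> connected \<Omega> \<and> 0 \<in> \<Omega> \<and> G_psh GG \<Omega> u \<and> (\<exists>x\<in>\<Omega>. u x \<noteq> -\<infinity>)"
  have gr: "GG \<subseteq> grassmannian p" using assms(4) by (simp add: closed_in_grassmannian_def)
  \<comment> \<open>The chain joining any two vectors is nonempty, so \<open>GG\<close> has a
    member.\<close>
  obtain Ws where "Ws \<noteq> []" "set Ws \<subseteq> GG"
    using assms(8) unfolding transitivity_property_def by blast
  then have ne: "GG \<noteq> {}" by auto
  obtain R0 where R0: "R0 > 0" "cball 0 R0 \<subseteq> \<Omega>" using A open_contains_cball by blast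
  interpret psh_germ GG p \<Omega> u R0
  proof
    show "2 \<le> p" by fact
    show "subspace W" "dim W = p" if "W \<in> GG" for W using gr that by (auto simp: grassmannian_def)
    show "trace H \<ge> 0" if "H \<in> Fcone GG" for H
      using Fcone_trace_nonneg[OF gr ne _ assms(5,6,7) that] assms(2) by simp
    show "transitivity_property GG" by fact
  qed (use A R0 in auto)
  show "\<exists>\<Theta>. has_density p u \<Theta> \<and> (\<exists>v. is_tangent p u v) \<and>
      (\<forall>v. is_tangent p u v \<longrightarrow> (AE x in lborel. v x = (if x = 0 then - \<infinity> else ereal (\<Theta> * Kp p (norm x)))))"
  proof (intro exI[of _ \<Theta>] conjI allI impI)
    show "has_density p u \<Theta>" by (rule has_density_Theta)
    have r: "1 / (real j + 1) > 0" for j :: nat by simp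
    have "(\<lambda>j. 1 / (real j + 1)) \<longlonglongrightarrow> 0"
      using LIMSEQ_inverse_real_of_nat by (simp add: inverse_eq_divide add.commute)
    then have "is_tangent p u tangent"
      unfolding is_tangent_def
      by (intro exI[of _ "\<lambda>j. 1 / (real j + 1)"] conjI allI r flow_tendsto_tangent)
    then show "\<exists>v. is_tangent p u v" by blast
    fix v assume "is_tangent p u v"
    then obtain r where "\<And>j. r j > 0" "r \<longlonglongrightarrow> 0" "L1loc_tendsto (\<lambda>j. flow p u (r j)) v"
      unfolding is_tangent_def by blast
    \<comment> \<open>Along the same scales the flow also converges to \<open>tangent\<close>, so
      the two limits agree.\<close>
    then have "AE x in lborel. v x = tangent x" using L1loc_unique flow_tendsto_tangent by blast
    then show "AE x in lborel. v x = (if x = 0 then - \<infinity> else ereal (\<Theta> * Kp p (norm x)))"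
      by (simp add: tangent_def)
  qed
qed

end
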